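(* Let $H$ be a fixed non-matching graph with $e(H)\ge 3$, and let $\ell$ be a fixed integer with $e(H)\le \ell\le (e(H)-1)^{e(H)/(e(H)-2)}$. For every $\delta>0$ there are constants $a=a(H,\ell,\delta)>0$ and $A=A(H,\ell,\delta)>0$ such that, for $G=G(n,p)$ with $p=p(n)\in[0,1]$, the following hold. (i) If $p\le a n^{-1/m_2(H)}$, then with high probability $$\ell^{(1-\delta)e(G)}\le R_{H,\ell}(G)\le \ell^{e(G)}.$$ (ii) If $p\ge A n^{-1/m_2(H)}$, then with high probability $$(e(H)-1)^{e(G)}\le R_{H,\ell}(G)\le (e(H)-1)^{(1+\delta)e(G)}.$$
   Context: All graphs are finite and simple; $v(G)$, $e(G)$ denote numbers of vertices and edges. $H$ has no isolated vertices (isolated vertices play no role and are deleted). $H$ is non-matching if it contains two adjacent edges. $[s]=\{1,\dots,s\}$. $G(n,p)$ is the binomial random graph on $[n]$, each edge present independently with probability $p$. "With high probability" means with probability tending to $1$ as $n\to\infty$. A copy of $H$ (as a not necessarily induced subgraph) in an edge-coloured graph is rainbow if its edges receive pairwise distinct colours. $R_{H,\ell}(G)$ is the number of maps $\chi:E(G)\to[\ell]$ such that $G$ coloured by $\chi$ contains no rainbow copy of $H$. The maximum 2-density is $m_2(H)=\max\{\frac{e(F)-1}{v(F)-2}: F\subseteq H,\ v(F)\ge 3\}$. *)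

theory Defs
  imports "HOL-Probability.Probability" "HOL-Probability.Product_PMF"
begin

type_synonym 'a graph = "'a set \<times> 'a set set"

abbreviation verts :: "'a graph \<Rightarrow> 'a set" where "verts \<equiv> fst"
abbreviation edges :: "'a graph \<Rightarrow> 'a set set" where "edges \<equiv> snd"

definition all_pairs :: "'a set \<Rightarrow> 'a set set" where
  "all_pairs V = {e. e \<subseteq> V \<and> card e = 2}"

definition simple_graph :: "'a graph \<Rightarrow> bool" where
  "simple_graph G \<longleftrightarrow> finite (verts G) \<and> edges G \<subseteq> all_pairs (verts G)"

definition vcount :: "'a graph \<Rightarrow> nat" where
  "vcount G = card (verts G)"

definition ecount :: "'a graph \<Rightarrow> nat" where
  "ecount G = card (edges G)"

definition no_isolated_vertices :: "'a graph \<Rightarrow> bool" where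
  "no_isolated_vertices G \<longleftrightarrow> (\<forall>v\<in>verts G. \<exists>e\<in>edges G. v \<in> e)"

definition non_matching :: "'a graph \<Rightarrow> bool" where
  "non_matching G \<longleftrightarrow> (\<exists>e\<in>edges G. \<exists>f\<in>edges G. e \<noteq> f \<and> e \<inter> f \<noteq> {})"

definition subgraph :: "'a graph \<Rightarrow> 'a graph \<Rightarrow> bool" where
  "subgraph F G \<longleftrightarrow> simple_graph F \<and> verts F \<subseteq> verts G \<and> edges F \<subseteq> edges G"

definition graph_iso :: "'a graph \<Rightarrow> 'b graph \<Rightarrow> bool" where
  "graph_iso H F \<longleftrightarrow>
     (\<exists>\<phi>. bij_betw \<phi> (verts H) (verts F) \<and> edges F = (\<lambda>e. \<phi> ` e) ` edges H)"

definition copy_of :: "'a graph \<Rightarrow> 'b graph \<Rightarrow> 'b graph \<Rightarrow> bool" where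
  "copy_of H G F \<longleftrightarrow> subgraph F G \<and> graph_iso H F"

definition has_rainbow_copy :: "'a graph \<Rightarrow> 'b graph \<Rightarrow> ('b set \<Rightarrow> nat) \<Rightarrow> bool" where
  "has_rainbow_copy H G c \<longleftrightarrow> (\<exists>F. copy_of H G F \<and> inj_on c (edges F))"

text \<open>Colourings are extensional functions on the edge set, so that each map from the
  edge set to the colours is counted once.\<close>

definition rainbow_free_colourings :: "'a graph \<Rightarrow> nat \<Rightarrow> 'b graph \<Rightarrow> nat" where
  "rainbow_free_colourings H l G =
     card {c \<in> edges G \<rightarrow>\<^sub>E {1..l}. \<not> has_rainbow_copy H G c}"

text \<open>Meaningful only for graphs with at least three vertices; otherwise the maximum is
  over the empty set. Every non-matching graph has at least three vertices.\<close>

definition max_2_density :: "'a graph \<Rightarrow> real" where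
  "max_2_density H =
     Max {(real (ecount F) - 1) / (real (vcount F) - 2) | F. subgraph F H \<and> vcount F \<ge> 3}"

definition random_graph :: "nat \<Rightarrow> real \<Rightarrow> nat graph pmf" where
  "random_graph n p =
     map_pmf (\<lambda>b. ({1..n}, {e \<in> all_pairs {1..n}. b e}))
       (Pi_pmf (all_pairs {1..n}) False (\<lambda>_. bernoulli_pmf p))"

definition whp :: "(nat \<Rightarrow> real) \<Rightarrow> (nat graph \<Rightarrow> bool) \<Rightarrow> bool" where
  "whp p P \<longleftrightarrow>
     (\<lambda>n. measure_pmf.prob (random_graph n (p n)) {G. P G}) \<longlonglongrightarrow> 1"

end

theory Submission
  imports Defs "HOL-Real_Asymp.Real_Asymp"
begin

text \<open>
  Upper bound in (ii). A rainbow-free colouring of \<open>G\<close> is an independent set in the hypergraph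
  whose vertices are the pairs (edge of \<open>K\<^sub>n\<close>, colour) and whose hyperedges are the rainbow
  copies of \<open>H\<close>. The container method yields a small fingerprint of every colouring that
  determines a palette for each edge, such that few rainbow copies of \<open>H\<close> fit into the palettes.
  On a copy without a rainbow colouring some \<open>k\<close> palettes have size less than \<open>k\<close>; convexity of
  \<open>k ln (k - 1)\<close> and the bound on \<open>l\<close> then give a geometric mean of at most \<open>e(H) - 1\<close>, and averaging
  over all copies extends this to \<open>K\<^sub>n\<close>. Since a fingerprint lies inside \<open>G\<close>, a first-moment
  computation over fingerprints beats their number as soon as \<open>p\<close> is a large multiple of the
  threshold.

  Lower bound in (i). Below the threshold a densest subgraph \<open>F\<close> of \<open>H\<close> has few copies in \<open>G\<close>, by
  Chebyshev's inequality. Colouring two edges of every copy of \<open>F\<close> with colour 1 leaves nearly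
  all edges free.
\<close>

section \<open>Fingerprints and containers\<close>

text \<open>Write r = e(H). The bound on \<open>l\<close> is the case k = 2 of the palette
  inequality: two edges with one common colour and full palettes elsewhere give l^(r-2) \<le>
  (r-1)^r. For k = r there is equality, and convexity settles the sizes between. The threshold
  \<tau> = n^(-1/m_2(H)) is also the container parameter: j prescribed edges lie in O(n^(v-2)
  \<tau>^(j-1)) copies of H because every subgraph of H obeys the density bound. Fingerprints have
  size O(\<tau> n^2), and a plain union bound over all of them would lose a factor log n in the
  threshold. The loss is avoided because the edges of a fingerprint T must be present, which costs
  p^|T|; the sum over T then competes with exp(- c p n^2) already for p = A \<tau>. Palettes can be
  empty, so logarithms of their sizes cannot be averaged. A small power q takes the place of the
  logarithm, and the slack \<delta> pays for it. In (i) the difficulty is that p may be so small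
  that e(G) is not concentrated; there, typically, G contains no copy of F at all.\<close>

text \<open>The value \<open>F X\<close> has a certificate of size at most \<open>b\<close>, as for a decision tree that queries
  membership in \<open>X\<close> and pays only for positive answers. The certificates are the fingerprints.\<close>

definition certified :: "real \<Rightarrow> ('v set \<Rightarrow> 's) \<Rightarrow> bool" where
  "certified b F \<longleftrightarrow>
     (\<forall>X. \<exists>T\<subseteq>X. finite T \<and> real (card T) \<le> b \<and> (\<forall>Y. T \<subseteq> Y \<longrightarrow> Y \<subseteq> X \<longrightarrow> F Y = F X))"

lemma certified_const: "b \<ge> 0 \<Longrightarrow> certified b (\<lambda>X. s)"
  unfolding certified_def by (intro allI exI[of _ "{}"]) auto

lemma certified_mono: "certified b F \<Longrightarrow> b \<le> b' \<Longrightarrow> certified b' F"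
  unfolding certified_def by (meson order_trans)

text \<open>The second stage may depend on the first outcome: between \<open>T \<union> T'\<close>
  and \<open>X\<close> that outcome does not change, so both certificates apply at once and only
  their sizes add up.\<close>

lemma certified_bind:
  assumes F: "certified b F" and G: "\<And>s. certified b' (G s)"
  shows "certified (b + b') (\<lambda>X. G (F X) X)"
  unfolding certified_def
proof
  fix X
  obtain T where T: "T \<subseteq> X" "finite T" "real (card T) \<le> b" "\<And>Y. T \<subseteq> Y \<Longrightarrow> Y \<subseteq> X \<Longrightarrow> F Y = F X"
    using F unfolding certified_def by meson
  obtain T' where T': "T' \<subseteq> X" "finite T'" "real (card T') \<le> b'"
      "\<And>Y. T' \<subseteq> Y \<Longrightarrow> Y \<subseteq> X \<Longrightarrow> G (F X) Y = G (F X) X"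
    using G unfolding certified_def by meson
  have c: "real (card (T \<union> T')) \<le> b + b'"
    using card_Un_le[of T T'] T(3) T'(3) by linarith
  have eq: "G (F Y) Y = G (F X) X" if "T \<union> T' \<subseteq> Y" "Y \<subseteq> X" for Y
  proof -
    have "F Y = F X" using that by (intro T(4)) auto
    moreover have "G (F X) Y = G (F X) X" using that by (intro T'(4)) auto
    ultimately show ?thesis by metis
  qed
  show "\<exists>T\<subseteq>X. finite T \<and> real (card T) \<le> b + b' \<and>
      (\<forall>Y. T \<subseteq> Y \<longrightarrow> Y \<subseteq> X \<longrightarrow> G (F Y) Y = G (F X) X)"
  proof (intro exI[of _ "T \<union> T'"] conjI allI impI)
    show "G (F Y) Y = G (F X) X" if "T \<union> T' \<subseteq> Y" "Y \<subseteq> X" for Y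
      using that by (rule eq)
  qed (use T T' c in blast)+
qed

text \<open>A choice of elements that is stable under passing to smaller sets makes every
  greedy step depend on a single element of \<open>X\<close>.\<close>

lemma stable_choice:
  assumes "finite V"
  obtains pick :: "'v set \<Rightarrow> 'v" where
    "\<And>A. A \<subseteq> V \<Longrightarrow> A \<noteq> {} \<Longrightarrow> pick A \<in> A"
    "\<And>A B. A \<subseteq> V \<Longrightarrow> B \<subseteq> A \<Longrightarrow> pick A \<in> B \<Longrightarrow> pick B = pick A"
proof -
  obtain h :: "'v \<Rightarrow> nat" where h: "inj_on h V"
    using assms finite_imp_inj_to_nat_seg by blast
  define pick where "pick A = (SOME v. v \<in> A \<and> (\<forall>w\<in>A. h v \<le> h w))" for A
  have ex: "pick A \<in> A \<and> (\<forall>w\<in>A. h (pick A) \<le> h w)" if "A \<noteq> {}" for A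
    unfolding pick_def
    by (rule someI_ex, rule exI[of _ "arg_min h (\<lambda>v. v \<in> A)"])
       (metis (mono_tags, lifting) all_not_in_conv arg_min_nat_lemma that)
  show thesis
  proof (rule that[of pick])
    show "pick A \<in> A" if "A \<subseteq> V" "A \<noteq> {}" for A using ex that by blast
    show "pick B = pick A" if AB: "A \<subseteq> V" "B \<subseteq> A" "pick A \<in> B" for A B
    proof -
      have "pick B \<in> B" "h (pick B) \<le> h (pick A)" "h (pick A) \<le> h (pick B)"
        using ex[of B] ex[of A] AB by auto
      then show ?thesis using h AB unfolding inj_on_def by (meson antisym subsetD)
    qed
  qed
qed

text \<open>While some element of \<open>U s\<close> lies in \<open>X\<close>, the process takes one
  such element and moves on. The elements taken form the certificate, and each raises
  \<open>pot\<close> by at least \<open>d\<close>, so there are at most \<open>M / d\<close> of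
  them. \<open>Inv\<close> speaks of the state alone, whereas \<open>Q\<close> may mention
  \<open>X\<close>; it is how independence of \<open>X\<close> is carried along later.\<close>

lemma greedy_certified:
  fixes U :: "'s \<Rightarrow> 'v set" and step :: "'s \<Rightarrow> 'v \<Rightarrow> 's" and pot :: "'s \<Rightarrow> real"
  assumes V: "finite V" "\<And>s. U s \<subseteq> V"
    and inv0: "Inv s0" and inv: "\<And>s v. Inv s \<Longrightarrow> v \<in> U s \<Longrightarrow> Inv (step s v)"
    and pot: "\<And>s v. Inv s \<Longrightarrow> v \<in> U s \<Longrightarrow> pot (step s v) \<ge> pot s + d"
    and pot_le: "\<And>s. Inv s \<Longrightarrow> pot s \<le> M" and pot0: "pot s0 \<ge> 0" and d: "d > 0"
  shows "\<exists>F. certified (M / d) F \<and> (\<forall>X. Inv (F X) \<and> U (F X) \<inter> X = {} \<and>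
    (\<forall>Q. Q s0 \<longrightarrow> (\<forall>s v. Inv s \<and> Q s \<and> v \<in> U s \<inter> X \<longrightarrow> Q (step s v)) \<longrightarrow> Q (F X)))"
proof -
  obtain pick :: "'v set \<Rightarrow> 'v" where
    pick: "\<And>A. A \<subseteq> V \<Longrightarrow> A \<noteq> {} \<Longrightarrow> pick A \<in> A"
    and stable: "\<And>A B. A \<subseteq> V \<Longrightarrow> B \<subseteq> A \<Longrightarrow> pick A \<in> B \<Longrightarrow> pick B = pick A"
    using stable_choice[OF V(1)] by metis
  \<comment> \<open>The first argument is fuel that makes the recursion primitive; the run stops
    early once \<open>U s\<close> misses \<open>X\<close>.\<close>
  define run :: "nat \<Rightarrow> 's \<Rightarrow> 'v set \<Rightarrow> 's" where
    "run = rec_nat (\<lambda>s X. s)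
       (\<lambda>k r s X. if U s \<inter> X = {} then s else r (step s (pick (U s \<inter> X))) X)"
  have run0: "run 0 s X = s" for s X by (simp add: run_def)
  have runS: "run (Suc k) s X =
      (if U s \<inter> X = {} then s else run k (step s (pick (U s \<inter> X))) X)" for k s X
    by (simp add: run_def)
  have pk: "pick (U s \<inter> X) \<in> U s" "pick (U s \<inter> X) \<in> X" if "U s \<inter> X \<noteq> {}" for s X
    using pick[of "U s \<inter> X"] V(2)[of s] that by auto
  have cert: "certified (real k) (run k s)" for k s
  proof (induction k arbitrary: s)
    case 0
    have "run 0 s = (\<lambda>X. s)" by (rule ext) (rule run0)
    then show ?case using certified_const[of 0 s] by simp
  next
    case (Suc k)
    show ?case unfolding certified_def
    proof
      fix X
      show "\<exists>T\<subseteq>X. finite T \<and> real (card T) \<le> real (Suc k) \<and>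
              (\<forall>Y. T \<subseteq> Y \<longrightarrow> Y \<subseteq> X \<longrightarrow> run (Suc k) s Y = run (Suc k) s X)"
      proof (cases "U s \<inter> X = {}")
        case True
        then have "run (Suc k) s Y = run (Suc k) s X" if "Y \<subseteq> X" for Y
          using that by (auto simp: runS)
        moreover have "{} \<subseteq> X \<and> finite ({} :: 'v set) \<and> real (card ({} :: 'v set)) \<le> real (Suc k)"
          by simp
        ultimately show ?thesis by blast
      next
        case False
        define v where "v = pick (U s \<inter> X)"
        obtain T where T: "T \<subseteq> X" "finite T" "real (card T) \<le> real k"
          "\<And>Y. T \<subseteq> Y \<Longrightarrow> Y \<subseteq> X \<Longrightarrow> run k (step s v) Y = run k (step s v) X"
          using Suc[of "step s v"] unfolding certified_def by meson
        have v: "v \<in> U s" "v \<in> X" using pk False by (auto simp: v_def)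
        have "run (Suc k) s Y = run (Suc k) s X" if Y: "insert v T \<subseteq> Y" "Y \<subseteq> X" for Y
        proof -
          \<comment> \<open>A smaller set that still contains the old choice makes the same choice,
            so the runs on \<open>X\<close> and \<open>Y\<close> agree in their first step.\<close>
          have "pick (U s \<inter> Y) = v" unfolding v_def
            using Y v V(2)[of s] by (intro stable) (auto simp: v_def)
          then show ?thesis using T(4)[of Y] Y v False by (auto simp: runS v_def[symmetric])
        qed
        moreover have "insert v T \<subseteq> X" "finite (insert v T)" "real (card (insert v T)) \<le> real (Suc k)"
          using T(1-3) v by (auto simp: card_insert_if)
        ultimately show ?thesis by blast
      qed
    qed
  qed
  have runQ: "Q (run k s X)" if "Inv s" "Q s"
    "\<And>s v. Inv s \<Longrightarrow> Q s \<Longrightarrow> v \<in> U s \<Longrightarrow> v \<in> X \<Longrightarrow> Q (step s v)" for k s X Q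
    using that(1,2)
  proof (induction k arbitrary: s)
    case (Suc k)
    show ?case
    proof (cases "U s \<inter> X = {}")
      case True
      then show ?thesis using Suc.prems by (simp add: runS)
    next
      case False
      then have "Q (step s (pick (U s \<inter> X)))" "Inv (step s (pick (U s \<inter> X)))"
        using that(3) Suc.prems pk[OF False] inv by blast+
      then show ?thesis using Suc.IH False by (simp add: runS)
    qed
  qed (auto simp: run0)
  have runinv: "Inv (run k s X)" if "Inv s" for k s X
    by (rule runQ[where Q = Inv]) (use that inv in blast)+
  have runpot: "U (run k s X) \<inter> X = {} \<or> pot (run k s X) \<ge> pot s + real k * d" if "Inv s" for k s X
    using that
  proof (induction k arbitrary: s)
    case 0 then show ?case by (simp add: run0)
  next
    case (Suc k)
    show ?case
    proof (cases "U s \<inter> X = {}")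
      case True then show ?thesis by (simp add: runS)
    next
      case False
      let ?v = "pick (U s \<inter> X)"
      have "Inv (step s ?v)" using inv[OF Suc.prems] pk[OF False] by blast
      moreover have "pot (step s ?v) \<ge> pot s + d" using pot[OF Suc.prems] pk[OF False] by blast
      ultimately show ?thesis using Suc.IH[of "step s ?v"] False
        by (auto simp: runS algebra_simps)
    qed
  qed
  have Md: "0 \<le> M / d" using pot_le[OF inv0] pot0 d by simp
  \<comment> \<open>Fuel \<open>k\<close> is enough: if \<open>U\<close> still met \<open>X\<close>
    at the end, one more step would push the potential to \<open>(k + 1) * d > M\<close>.\<close>
  define k where "k = nat \<lfloor>M / d\<rfloor>"
  have k: "real k \<le> M / d" "M / d < real k + 1" using Md unfolding k_def by linarith+
  have fin: "U (run k s0 X) \<inter> X = {}" for X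
  proof (rule ccontr)
    assume ne: "U (run k s0 X) \<inter> X \<noteq> {}"
    then obtain v where v: "v \<in> U (run k s0 X)" by blast
    have "pot (run k s0 X) \<ge> real k * d" using runpot[OF inv0, of k X] ne pot0 by auto
    then have "pot (step (run k s0 X) v) \<ge> real k * d + d"
      using pot[OF runinv[OF inv0] v] by linarith
    then have "(real k + 1) * d \<le> M"
      using pot_le[OF inv[OF runinv[OF inv0] v]] by (simp add: algebra_simps)
    then have "real k + 1 \<le> M / d" using d by (simp add: pos_le_divide_eq)
    then show False using k by linarith
  qed
  show ?thesis
  proof (intro exI[of _ "run k s0"] conjI allI impI)
    show "certified (M / d) (run k s0)" by (rule certified_mono[OF cert k(1)])
    show "Inv (run k s0 X)" for X by (rule runinv[OF inv0])
    show "U (run k s0 X) \<inter> X = {}" for X by (rule fin)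
    show "Q (run k s0 X)" if "Q s0" "\<forall>s v. Inv s \<and> Q s \<and> v \<in> U s \<inter> X \<longrightarrow> Q (step s v)" for X Q
      using runQ[of s0 Q X k] inv0 that by simp
  qed
qed

section \<open>Weighted hypergraphs and the container theorem\<close>

definition deg :: "'v set \<Rightarrow> ('v set \<Rightarrow> real) \<Rightarrow> 'v set \<Rightarrow> real" where
  "deg W g S = (\<Sum>f | f \<subseteq> W \<and> S \<subseteq> f. g f)"

definition uniform :: "'v set \<Rightarrow> nat \<Rightarrow> ('v set \<Rightarrow> real) \<Rightarrow> bool" where
  "uniform W j g \<longleftrightarrow> (\<forall>f. g f \<ge> 0) \<and> (\<forall>f. g f \<noteq> 0 \<longrightarrow> f \<subseteq> W \<and> card f = j)"

text \<open>The co-degree condition of the container method: vertex degrees have scale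
  \<open>m\<close>, and each further prescribed vertex costs a factor \<open>\<tau>\<close>. The
  empty set is left out because \<open>deg W g {}\<close> is the total weight.\<close>

definition degrees_bounded :: "'v set \<Rightarrow> real \<Rightarrow> real \<Rightarrow> real \<Rightarrow> ('v set \<Rightarrow> real) \<Rightarrow> bool" where
  "degrees_bounded W K \<tau> m g \<longleftrightarrow>
     (\<forall>S. S \<subseteq> W \<longrightarrow> S \<noteq> {} \<longrightarrow> deg W g S \<le> K * m * \<tau> ^ (card S - 1))"

definition independent_in :: "('v set \<Rightarrow> real) \<Rightarrow> 'v set \<Rightarrow> bool" where
  "independent_in g X \<longleftrightarrow> (\<forall>f. g f \<noteq> 0 \<longrightarrow> \<not> f \<subseteq> X)"

lemma degree_singleton_le: "degrees_bounded W K \<tau> m g \<Longrightarrow> v \<in> W \<Longrightarrow> deg W g {v} \<le> K * m"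
  unfolding degrees_bounded_def by (drule spec[of _ "{v}"]) simp

lemma deg_nonneg: "uniform W j g \<Longrightarrow> deg W g S \<ge> 0"
  unfolding deg_def uniform_def by (auto intro!: sum_nonneg)

lemma sum_deg_eq:
  assumes "finite W" "uniform W j g" "\<R> \<subseteq> Pow W"
  shows "(\<Sum>R\<in>\<R>. deg W g R) = (\<Sum>f\<in>Pow W. g f * real (card {R\<in>\<R>. R \<subseteq> f}))"
proof -
  have fin: "finite \<R>" using assms by (meson finite_Pow_iff finite_subset)
  have "(\<Sum>R\<in>\<R>. deg W g R) = (\<Sum>R\<in>\<R>. \<Sum>f\<in>Pow W. if R \<subseteq> f then g f else 0)"
    unfolding deg_def using assms(1)
    by (intro sum.cong[OF refl]) (auto simp: sum.If_cases Pow_def Int_def intro: sum.cong)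
  also have "\<dots> = (\<Sum>f\<in>Pow W. \<Sum>R\<in>\<R>. if R \<subseteq> f then g f else 0)" by (rule sum.swap)
  also have "\<dots> = (\<Sum>f\<in>Pow W. g f * real (card {R\<in>\<R>. R \<subseteq> f}))"
    using fin by (intro sum.cong[OF refl]) (auto simp: sum.If_cases Int_def mult.commute)
  finally show ?thesis .
qed

lemma total_le_sum_deg:
  assumes "finite W" "uniform W (Suc j) g"
  shows "deg W g {} \<le> (\<Sum>v\<in>W. deg W g {v})"
proof -
  have "(\<Sum>v\<in>W. deg W g {v}) = (\<Sum>R\<in>(\<lambda>v. {v}) ` W. deg W g R)"
    by (subst sum.reindex) auto
  also have "\<dots> = (\<Sum>f\<in>Pow W. g f * real (card {R\<in>(\<lambda>v. {v}) ` W. R \<subseteq> f}))"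
    using assms by (intro sum_deg_eq) auto
  finally have *: "(\<Sum>v\<in>W. deg W g {v}) =
    (\<Sum>f\<in>Pow W. g f * real (card {R\<in>(\<lambda>v. {v}) ` W. R \<subseteq> f}))" .
  have "g f \<le> g f * real (card {R\<in>(\<lambda>v. {v}) ` W. R \<subseteq> f})" if "f \<in> Pow W" for f
  proof (cases "g f = 0")
    case False
    then have "card f = Suc j" "f \<subseteq> W" "g f \<ge> 0" using assms unfolding uniform_def by auto
    then have "f \<noteq> {}" by auto
    then obtain v where "v \<in> f" by auto
    then have "{v} \<in> {R\<in>(\<lambda>v. {v}) ` W. R \<subseteq> f}" using \<open>f \<subseteq> W\<close> by auto
    then have "card {R\<in>(\<lambda>v. {v}) ` W. R \<subseteq> f} \<ge> 1"
      using assms(1) card_gt_0_iff[of "{R\<in>(\<lambda>v. {v}) ` W. R \<subseteq> f}"] by (auto simp: Suc_le_eq)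
    then have "1 \<le> real (card {R\<in>(\<lambda>v. {v}) ` W. R \<subseteq> f})" by linarith
    then show ?thesis using \<open>g f \<ge> 0\<close> by (metis mult_left_mono mult.right_neutral)
  qed auto
  then have "(\<Sum>f\<in>Pow W. g f) \<le> (\<Sum>v\<in>W. deg W g {v})" unfolding * by (rule sum_mono)
  then show ?thesis by (simp add: deg_def[of W g "{}"] Pow_def)
qed

lemma sum_link:
  assumes "finite W" "v \<in> W"
  shows "(\<Sum>S | S \<subseteq> W \<and> v \<notin> S \<and> P S. g (insert v S)) =
         (\<Sum>f | f \<subseteq> W \<and> v \<in> f \<and> P (f - {v}). g f)"
  by (rule sum.reindex_bij_witness[of _ "\<lambda>f. f - {v}" "insert v"])
     (use assms in \<open>auto simp: insert_absorb\<close>)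

lemma sum_Pow_swap:
  assumes "finite W"
  shows "(\<Sum>f\<in>Pow W. \<Sum>x\<in>A. if Q x f then g f else 0) = (\<Sum>x\<in>A. \<Sum>f | f \<subseteq> W \<and> Q x f. g f)"
proof -
  have "(\<Sum>f | f \<subseteq> W \<and> Q x f. g f) = (\<Sum>f\<in>Pow W. if Q x f then g f else 0)" for x
    by (rule sum.mono_neutral_cong_left) (use assms in auto)
  then show ?thesis by (subst sum.swap) simp
qed

text \<open>The new hypergraph is built from links of vertices of \<open>X\<close>, skipping sets that contain a
  saturated set; \<open>U\<close> consists of the vertices whose links would still contribute much. An edge
  either meets \<open>U\<close>, or is counted in a small contribution, or contains a saturated set. So if
  the new hypergraph is sparse, then \<open>U\<close> is large.\<close>

lemma container_step:
  fixes g :: "'v set \<Rightarrow> real"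
  assumes W: "finite W" "real (card W) \<le> N" and pos: "\<tau> > 0" "m > 0" "K > 0" "\<eta> > 0" "N > 0"
    and g: "uniform W (Suc (Suc j)) g" and bnd: "degrees_bounded W K \<tau> m g"
    and tot: "\<eta> * m * N \<le> deg W g {}"
  obtains F U where "certified (4 * K / \<eta> * \<tau> * N) F" "\<And>h. U h \<subseteq> W"
    "\<And>X. U (F X) \<inter> X = {}"
    "\<And>X. uniform W (Suc j) (F X)" "\<And>X. degrees_bounded W (2 * K) \<tau> (\<tau> * m) (F X)"
    "\<And>X. independent_in g X \<Longrightarrow> independent_in (F X) X"
    "\<And>X. real (card (U (F X))) \<ge> \<eta> / (4 * K) * N \<or>
         \<eta> / (4 * 2 ^ Suc j) * (\<tau> * m) * N \<le> deg W (F X) {}"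
proof -
  \<comment> \<open>A set \<open>R\<close> counts as saturated at half of the degree
    \<open>2 * K * (\<tau> * m) * \<tau> ^ (card R - 1)\<close> allowed in the new hypergraph. One
    step adds at most \<open>K * m * \<tau> ^ card R\<close> to the degree of \<open>R\<close>, by
    the co-degree of \<open>insert v R\<close> in \<open>g\<close>, and nothing once
    \<open>R\<close> is saturated; hence the bound with \<open>2 * K\<close> survives.\<close>
  define unsat where "unsat h S \<longleftrightarrow> (\<forall>R. R \<subseteq> S \<longrightarrow> R \<noteq> {} \<longrightarrow> deg W h R < K * m * \<tau> ^ card R)"
    for h :: "'v set \<Rightarrow> real" and S
  define gain where "gain h v = (\<Sum>f | f \<subseteq> W \<and> v \<in> f \<and> unsat h (f - {v}). g f)" for h v
  define U where "U h = {v\<in>W. gain h v \<ge> \<eta> / 2 * m}" for h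
  define step where "step h v = (\<lambda>S. h S + (if S \<subseteq> W \<and> v \<notin> S \<and> unsat h S then g (insert v S) else 0))"
    for h v
  define Inv where "Inv h \<longleftrightarrow> uniform W (Suc j) h \<and> degrees_bounded W (2 * K) \<tau> (\<tau> * m) h" for h
  have g0: "g f \<ge> 0" for f using g by (auto simp: uniform_def)
  have degstep: "deg W (step h v) R = deg W h R +
      (\<Sum>S | S \<subseteq> W \<and> v \<notin> S \<and> (R \<subseteq> S \<and> unsat h S). g (insert v S))" for h v R
  proof -
    have "(\<Sum>S | S \<subseteq> W \<and> R \<subseteq> S. if S \<subseteq> W \<and> v \<notin> S \<and> unsat h S then g (insert v S) else 0) =
       (\<Sum>S | S \<subseteq> W \<and> v \<notin> S \<and> (R \<subseteq> S \<and> unsat h S). g (insert v S))"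
      using W by (intro sum.mono_neutral_cong_right) auto
    then show ?thesis by (simp add: deg_def step_def sum.distrib)
  qed
  have inv_step: "Inv (step h v)" if h: "Inv h" and v: "v \<in> U h" for h v
  proof -
    have hu: "uniform W (Suc j) h" and hb: "degrees_bounded W (2 * K) \<tau> (\<tau> * m) h"
      using h by (auto simp: Inv_def)
    have vW: "v \<in> W" using v by (simp add: U_def)
    have "uniform W (Suc j) (step h v)"
      unfolding uniform_def
    proof (intro conjI allI impI)
      fix S
      show "step h v S \<ge> 0" using hu g0 by (auto simp: step_def uniform_def)
      assume "step h v S \<noteq> 0"
      then consider "h S \<noteq> 0" | "S \<subseteq> W" "v \<notin> S" "g (insert v S) \<noteq> 0"
        by (cases "h S = 0") (auto simp: step_def split: if_splits)
      then show "S \<subseteq> W" and "card S = Suc j"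
      proof (atomize (full), cases)
        case 1 then show "S \<subseteq> W \<and> card S = Suc j" using hu by (auto simp: uniform_def)
      next
        case 2
        then have "card (insert v S) = Suc (Suc j)" using g by (auto simp: uniform_def)
        moreover have "finite S" using 2 W finite_subset by blast
        ultimately show "S \<subseteq> W \<and> card S = Suc j" using 2 by simp
      qed
    qed
    moreover have "degrees_bounded W (2 * K) \<tau> (\<tau> * m) (step h v)"
      unfolding degrees_bounded_def
    proof (intro allI impI)
      fix R assume R: "R \<subseteq> W" "R \<noteq> {}"
      then have cR: "card R \<ge> 1" "finite R"
        using W finite_subset by (auto simp: Suc_le_eq card_gt_0_iff)
      have pw: "\<tau> * m * \<tau> ^ (card R - 1) = m * \<tau> ^ card R"
        using cR by (cases "card R") auto
      show "deg W (step h v) R \<le> 2 * K * (\<tau> * m) * \<tau> ^ (card R - 1)"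
      proof (cases "deg W h R < K * m * \<tau> ^ card R")
        case False
        then have "{S. S \<subseteq> W \<and> v \<notin> S \<and> R \<subseteq> S \<and> unsat h S} = {}"
          using R by (auto simp: unsat_def)
        then have "deg W (step h v) R = deg W h R" unfolding degstep by (simp only:) simp
        then show ?thesis using hb R by (auto simp: degrees_bounded_def)
      next
        case True
        have "(\<Sum>S | S \<subseteq> W \<and> v \<notin> S \<and> (R \<subseteq> S \<and> unsat h S). g (insert v S)) \<le> K * m * \<tau> ^ card R"
        proof (cases "v \<in> R")
          case True
          then have "{S. S \<subseteq> W \<and> v \<notin> S \<and> R \<subseteq> S \<and> unsat h S} = {}" by auto
          then show ?thesis using pos by (simp only:) simp
        next
          case False
          have "(\<Sum>S | S \<subseteq> W \<and> v \<notin> S \<and> (R \<subseteq> S \<and> unsat h S). g (insert v S)) =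
            (\<Sum>f | f \<subseteq> W \<and> v \<in> f \<and> (R \<subseteq> f - {v} \<and> unsat h (f - {v})). g f)"
            by (rule sum_link[OF W(1) vW])
          also have "\<dots> \<le> deg W g (insert v R)"
            unfolding deg_def by (rule sum_mono2) (use W g0 in auto)
          also have "\<dots> \<le> K * m * \<tau> ^ (card (insert v R) - 1)"
            using bnd R vW by (simp add: degrees_bounded_def)
          also have "card (insert v R) - 1 = card R" using False cR by simp
          finally show ?thesis .
        qed
        then have "deg W (step h v) R \<le> 2 * (K * (m * \<tau> ^ card R))"
          using True unfolding degstep by (simp add: algebra_simps)
        also have "\<dots> = 2 * K * (\<tau> * m * \<tau> ^ (card R - 1))" unfolding pw by simp
        finally show ?thesis by (simp add: mult.assoc)
      qed
    qed
    ultimately show ?thesis by (simp add: Inv_def)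
  qed
  have pot_step: "deg W (step h v) {} \<ge> deg W h {} + \<eta> / 2 * m" if "Inv h" "v \<in> U h" for h v
  proof -
    have "v \<in> W" using that(2) by (simp add: U_def)
    then have "deg W (step h v) {} = deg W h {} + gain h v"
      unfolding degstep gain_def using sum_link[OF W(1), where v = v and P = "unsat h" and g = g] by simp
    then show ?thesis using that(2) by (simp add: U_def)
  qed
  have pot_le: "deg W h {} \<le> N * (2 * K * (\<tau> * m))" if "Inv h" for h
  proof -
    have "deg W h {} \<le> (\<Sum>v\<in>W. deg W h {v})"
      using that W by (intro total_le_sum_deg) (auto simp: Inv_def)
    also have "\<dots> \<le> (\<Sum>v\<in>W. 2 * K * (\<tau> * m))"
    proof (rule sum_mono)
      fix v assume v: "v \<in> W"
      then show "deg W h {v} \<le> 2 * K * (\<tau> * m)"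
        using degree_singleton_le[of W "2 * K" \<tau> "\<tau> * m" h v] that by (simp add: Inv_def)
    qed
    also have "\<dots> \<le> N * (2 * K * (\<tau> * m))"
      using W pos by (simp add: mult_right_mono)
    finally show ?thesis .
  qed
  have inv0: "Inv (\<lambda>_. 0)" using pos by (auto simp: Inv_def uniform_def degrees_bounded_def deg_def)
  have U_subset: "U h \<subseteq> W" for h by (auto simp: U_def)
  have pot0: "deg W (\<lambda>_. 0) {} \<ge> 0" by (simp add: deg_def)
  have dpos: "\<eta> / 2 * m > 0" using pos by simp
  have "\<exists>F. certified (N * (2 * K * (\<tau> * m)) / (\<eta> / 2 * m)) F \<and>
      (\<forall>X. Inv (F X) \<and> U (F X) \<inter> X = {} \<and> (\<forall>Q. Q (\<lambda>_. 0) \<longrightarrow>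
         (\<forall>s v. Inv s \<and> Q s \<and> v \<in> U s \<inter> X \<longrightarrow> Q (step s v)) \<longrightarrow> Q (F X)))"
    by (rule greedy_certified[where pot = "\<lambda>h. deg W h {}", OF W(1) U_subset inv0 inv_step
          pot_step pot_le pot0 dpos])
  then obtain F where F0: "certified (N * (2 * K * (\<tau> * m)) / (\<eta> / 2 * m)) F \<and>
      (\<forall>X. Inv (F X) \<and> U (F X) \<inter> X = {} \<and> (\<forall>Q. Q (\<lambda>_. 0) \<longrightarrow>
         (\<forall>s v. Inv s \<and> Q s \<and> v \<in> U s \<inter> X \<longrightarrow> Q (step s v)) \<longrightarrow> Q (F X)))"
    by (rule exE)
  note F1 = conjunct1[OF F0]
  note FX = spec[OF conjunct2[OF F0]]
  have F2: "Inv (F X)" for X by (rule conjunct1[OF FX])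
  have F3: "U (F X) \<inter> X = {}" for X by (rule conjunct1[OF conjunct2[OF FX]])
  have ind: "independent_in (F X) X" if X: "independent_in g X" for X
  proof -
    have "independent_in (\<lambda>_. 0) X" by (simp add: independent_in_def)
    moreover have "independent_in (step s v) X" if "independent_in s X" "v \<in> X" for s v
      using that X unfolding independent_in_def step_def
      by (auto split: if_splits) (metis add_0 insert_subset)
    ultimately show ?thesis
      using mp[OF spec[OF conjunct2[OF conjunct2[OF FX]], of "\<lambda>h. independent_in h X"]] by simp
  qed
  have main: "deg W g {} \<le> real (card (U h)) * (K * m) + \<eta> / 2 * m * N + 2 ^ Suc j / \<tau> * deg W h {}"
    if h: "Inv h" for h
  proof -
    have hu: "uniform W (Suc j) h" using h by (auto simp: Inv_def)
    then have h0: "h f \<ge> 0" for f by (auto simp: uniform_def)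
    \<comment> \<open>Saturation gives \<open>deg W g R \<le> deg W h R / \<tau>\<close>. Summing
      \<open>deg W h\<close> over all sets counts each edge of \<open>h\<close> once per subset,
      that is \<open>2 ^ Suc j\<close> times, so the edges of \<open>g\<close> through saturated
      sets are paid for by the weight of \<open>h\<close>.\<close>
    define Sat where "Sat = {R. R \<subseteq> W \<and> R \<noteq> {} \<and> deg W h R \<ge> K * m * \<tau> ^ card R}"
    have finSat: "finite Sat" unfolding Sat_def using W by auto
    have UW: "U h \<subseteq> W" "finite (U h)" using W by (auto simp: U_def)
    have "g f \<le> (\<Sum>v\<in>U h. if v \<in> f then g f else 0)
        + (\<Sum>v\<in>W - U h. if v \<in> f \<and> unsat h (f - {v}) then g f else 0)
        + (\<Sum>R\<in>Sat. if R \<subseteq> f then g f else 0)" (is "_ \<le> ?A f + ?B f + ?C f")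
      if f: "f \<in> Pow W" for f
    proof (cases "g f = 0")
      case False
      have nn: "?A f \<ge> 0" "?B f \<ge> 0" "?C f \<ge> 0" using g0 by (auto intro!: sum_nonneg)
      have "f \<noteq> {}" using False g by (auto simp: uniform_def)
      then obtain v where v: "v \<in> f" by blast
      then have vW: "v \<in> W" using f by auto
      consider "v \<in> U h" | "v \<notin> U h" "unsat h (f - {v})" | R where "R \<in> Sat" "R \<subseteq> f"
      proof -
        have "\<exists>R. R \<in> Sat \<and> R \<subseteq> f" if "\<not> unsat h (f - {v})"
        proof -
          have "\<exists>R. R \<subseteq> f - {v} \<and> R \<noteq> {} \<and> \<not> deg W h R < K * m * \<tau> ^ card R"
            using that unfolding unsat_def by simp
          then obtain R where R: "R \<subseteq> f - {v}" "R \<noteq> {}" "\<not> deg W h R < K * m * \<tau> ^ card R"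
            by (elim exE conjE)
          have "R \<subseteq> W" "R \<subseteq> f" using R(1) f by auto
          then show ?thesis using R(2,3) unfolding Sat_def by (intro exI[of _ R]) simp
        qed
        then show ?thesis using that by blast
      qed
      then show ?thesis
      proof cases
        case 1
        then have "g f \<le> ?A f" using v g0 UW
          by (intro order_trans[OF _ member_le_sum[of v]]) auto
        then show ?thesis using nn by linarith
      next
        case 2
        then have "g f \<le> ?B f" using v vW g0 W
          by (intro order_trans[OF _ member_le_sum[of v]]) auto
        then show ?thesis using nn by linarith
      next
        case 3
        then have "g f \<le> ?C f" using g0 finSat
          by (intro order_trans[OF _ member_le_sum[of R]]) auto
        then show ?thesis using nn by linarith
      qed
    qed (use g0 in \<open>auto intro!: add_nonneg_nonneg sum_nonneg\<close>)
    then have "(\<Sum>f\<in>Pow W. g f) \<le> (\<Sum>f\<in>Pow W. ?A f + ?B f + ?C f)" by (rule sum_mono)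
    moreover have "(\<Sum>f\<in>Pow W. ?A f) = (\<Sum>v\<in>U h. deg W g {v})"
      by (simp add: deg_def sum_Pow_swap[OF W(1)])
    moreover have "(\<Sum>f\<in>Pow W. ?B f) = (\<Sum>v\<in>W - U h. gain h v)"
      by (simp add: gain_def sum_Pow_swap[OF W(1)])
    moreover have "(\<Sum>f\<in>Pow W. ?C f) = (\<Sum>R\<in>Sat. deg W g R)"
      by (simp add: deg_def sum_Pow_swap[OF W(1)])
    ultimately have 1: "deg W g {} \<le> (\<Sum>v\<in>U h. deg W g {v}) + (\<Sum>v\<in>W - U h. gain h v) + (\<Sum>R\<in>Sat. deg W g R)"
      by (simp add: sum.distrib deg_def[of W g "{}"] Pow_def)
    have "(\<Sum>v\<in>U h. deg W g {v}) \<le> (\<Sum>v\<in>U h. K * m)"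
    proof (rule sum_mono)
      fix v assume v: "v \<in> U h"
      then show "deg W g {v} \<le> K * m"
        using degree_singleton_le[OF bnd] UW by auto
    qed
    moreover have "(\<Sum>v\<in>W - U h. gain h v) \<le> \<eta> / 2 * m * N"
    proof -
      have "(\<Sum>v\<in>W - U h. gain h v) \<le> (\<Sum>v\<in>W - U h. \<eta> / 2 * m)"
        by (rule sum_mono) (auto simp: U_def)
      also have "\<dots> = real (card (W - U h)) * (\<eta> / 2 * m)" by simp
      also have "\<dots> \<le> N * (\<eta> / 2 * m)"
        using pos W card_mono[of W "W - U h"] by (intro mult_right_mono) auto
      finally show ?thesis by (simp add: mult_ac)
    qed
    moreover have "(\<Sum>R\<in>Sat. deg W g R) \<le> 2 ^ Suc j / \<tau> * deg W h {}"
    proof -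
      have "deg W g R \<le> deg W h R / \<tau>" if R: "R \<in> Sat" for R
      proof -
        have "deg W g R \<le> K * m * \<tau> ^ (card R - 1)"
          using bnd R by (auto simp: degrees_bounded_def Sat_def)
        also have "\<dots> = K * m * \<tau> ^ card R / \<tau>"
        proof -
          have "card R > 0" using R W finite_subset by (auto simp: Sat_def card_gt_0_iff)
          then show ?thesis using pos by (cases "card R") auto
        qed
        also have "\<dots> \<le> deg W h R / \<tau>"
          using R pos by (intro divide_right_mono) (auto simp: Sat_def)
        finally show ?thesis .
      qed
      then have "(\<Sum>R\<in>Sat. deg W g R) \<le> (\<Sum>R\<in>Sat. deg W h R / \<tau>)" by (rule sum_mono)
      also have "\<dots> = (\<Sum>R\<in>Sat. deg W h R) / \<tau>" by (simp add: sum_divide_distrib)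
      also have "\<dots> \<le> (\<Sum>R\<in>Pow W. deg W h R) / \<tau>"
        using pos W deg_nonneg[OF hu]
        by (intro divide_right_mono sum_mono2) (auto simp: Sat_def)
      also have "(\<Sum>R\<in>Pow W. deg W h R) = (\<Sum>f\<in>Pow W. h f * real (card {R\<in>Pow W. R \<subseteq> f}))"
        by (rule sum_deg_eq[OF W(1) hu]) simp
      also have "\<dots> = (\<Sum>f\<in>Pow W. h f * 2 ^ Suc j)"
      proof (rule sum.cong[OF refl])
        fix f assume f: "f \<in> Pow W"
        show "h f * real (card {R\<in>Pow W. R \<subseteq> f}) = h f * 2 ^ Suc j"
        proof (cases "h f = 0")
          case False
          then have "card f = Suc j" using hu unfolding uniform_def by blast
          moreover have "{R\<in>Pow W. R \<subseteq> f} = Pow f" using f by blast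
          moreover have "finite f" using f W(1) by (meson PowD finite_subset)
          ultimately show ?thesis by (simp add: card_Pow)
        qed simp
      qed
      also have "\<dots> = 2 ^ Suc j * deg W h {}"
        by (simp add: deg_def Pow_def sum_distrib_left mult_ac)
      finally show ?thesis by simp
    qed
    ultimately show ?thesis using 1 by simp
  qed
  \<comment> \<open>If both alternatives failed, the three terms of \<open>main\<close> would be
    less than a quarter, at most a half and less than a quarter of \<open>\<eta> * m * N\<close>,
    against \<open>tot\<close>.\<close>
  have alt: "real (card (U h)) \<ge> \<eta> / (4 * K) * N \<or>
         \<eta> / (4 * 2 ^ Suc j) * (\<tau> * m) * N \<le> deg W h {}" if h: "Inv h" for h
  proof (rule ccontr)
    assume "\<not> ?thesis"
    then have a: "real (card (U h)) < \<eta> / (4 * K) * N"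
      and b: "deg W h {} < \<eta> / (4 * 2 ^ Suc j) * (\<tau> * m) * N" by auto
    have "real (card (U h)) * (K * m) < \<eta> / (4 * K) * N * (K * m)"
      using a pos by (intro mult_strict_right_mono) auto
    also have "\<dots> = \<eta> * m * N / 4" using pos by (simp add: field_simps)
    finally have a': "real (card (U h)) * (K * m) < \<eta> * m * N / 4" .
    have "2 ^ Suc j / \<tau> * deg W h {} < 2 ^ Suc j / \<tau> * (\<eta> / (4 * 2 ^ Suc j) * (\<tau> * m) * N)"
      using b pos by (intro mult_strict_left_mono) auto
    also have "\<dots> = \<eta> * m * N / 4" using pos by (simp add: field_simps)
    finally show False using main[OF h] a' tot by simp
  qed
  show thesis
  proof (rule that[of F U])
    have "N * (2 * K * (\<tau> * m)) / (\<eta> / 2 * m) = 4 * K / \<eta> * \<tau> * N"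
      using pos by (simp add: field_simps)
    then show "certified (4 * K / \<eta> * \<tau> * N) F" using F1 by simp
    show "U h \<subseteq> W" for h by (auto simp: U_def)
    show "U (F X) \<inter> X = {}" for X by (rule F3)
    show "uniform W (Suc j) (F X)" "degrees_bounded W (2 * K) \<tau> (\<tau> * m) (F X)" for X
      using F2[of X] by (auto simp: Inv_def)
    show "independent_in (F X) X" if "independent_in g X" for X by (rule ind[OF that])
    show "real (card (U (F X))) \<ge> \<eta> / (4 * K) * N \<or>
         \<eta> / (4 * 2 ^ Suc j) * (\<tau> * m) * N \<le> deg W (F X) {}" for X
      by (rule alt[OF F2])
  qed
qed

text \<open>Induction on the uniformity. For edges of size 1 the vertices of nonzero weight are
  forbidden to \<open>X\<close>, and they are numerous because degrees are bounded. Otherwise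
  \<open>container_step\<close> yields either a large set \<open>U\<close> disjoint from
  \<open>X\<close>, which can be removed, or a dense hypergraph of smaller uniformity in which
  \<open>X\<close> is still independent. \<open>\<delta>\<close> and \<open>B\<close> are chosen
  before \<open>W\<close>, which is what allows iteration.\<close>

lemma container_shrink:
  fixes K \<eta> :: real
  assumes "K > 0" "\<eta> > 0"
  shows "\<exists>\<delta>>0. \<exists>B\<ge>0. \<forall>(W :: 'v set) N \<tau> m g. finite W \<longrightarrow> real (card W) \<le> N \<longrightarrow> N > 0 \<longrightarrow>
     \<tau> > 0 \<longrightarrow> m > 0 \<longrightarrow> uniform W (Suc j) g \<longrightarrow> degrees_bounded W K \<tau> m g \<longrightarrow>
     \<eta> * m * N \<le> deg W g {} \<longrightarrow>
     (\<exists>F. certified (B * \<tau> * N) F \<and>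
        (\<forall>X. F X \<subseteq> W \<and> (X \<subseteq> W \<longrightarrow> independent_in g X \<longrightarrow> X \<subseteq> F X) \<and>
             real (card (F X)) \<le> real (card W) - \<delta> * N))"
  using assms
proof (induction j arbitrary: K \<eta>)
  case 0
  show ?case
  proof (rule exI[of _ "\<eta> / K"], rule conjI[rotated], rule exI[of _ 0], rule conjI[rotated],
      intro allI impI)
    fix W :: "'v set" and N \<tau> m :: real and g
    assume W: "finite W" "real (card W) \<le> N" "N > 0" "\<tau> > 0" "m > 0"
      and g: "uniform W (Suc 0) g" and b: "degrees_bounded W K \<tau> m g"
      and tot: "\<eta> * m * N \<le> deg W g {}"
    define A where "A = {v\<in>W. g {v} \<noteq> 0}"
    have A: "A \<subseteq> W" "finite A" using W by (auto simp: A_def)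
    have z: "deg W g {v} = 0" if "v \<in> W - A" for v
    proof -
      have "g f = 0" if "f \<subseteq> W" "v \<in> f" for f
      proof (rule ccontr)
        assume "g f \<noteq> 0"
        moreover from this have "card f = 1" using g by (auto simp: uniform_def)
        then have "f = {v}" using that(2) by (auto simp: card_1_singleton_iff)
        ultimately show False using \<open>v \<in> W - A\<close> by (auto simp: A_def)
      qed
      then show ?thesis by (simp add: deg_def)
    qed
    have "\<eta> * m * N \<le> (\<Sum>v\<in>W. deg W g {v})"
      using tot total_le_sum_deg[OF W(1) g] by linarith
    also have "\<dots> = (\<Sum>v\<in>A. deg W g {v})"
      using A W z by (intro sum.mono_neutral_right) auto
    also have "\<dots> \<le> (\<Sum>v\<in>A. K * m)"
      using degree_singleton_le[OF b] A by (intro sum_mono) auto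
    finally have "\<eta> * N * m \<le> real (card A) * K * m" by (simp add: algebra_simps)
    then have "\<eta> * N \<le> real (card A) * K" using W by simp
    then have "\<eta> / K * N \<le> real (card A)" using 0 by (simp add: field_simps)
    moreover have "real (card (W - A)) = real (card W) - real (card A)"
      using A W by (simp add: card_Diff_subset card_mono of_nat_diff)
    ultimately have c: "real (card (W - A)) \<le> real (card W) - \<eta> / K * N" by linarith
    have "X \<subseteq> W - A" if "X \<subseteq> W" "independent_in g X" for X
      using that by (auto simp: independent_in_def A_def)
    then show "\<exists>F. certified (0 * \<tau> * N) F \<and>
        (\<forall>X. F X \<subseteq> W \<and> (X \<subseteq> W \<longrightarrow> independent_in g X \<longrightarrow> X \<subseteq> F X) \<and>
             real (card (F X)) \<le> real (card W) - \<eta> / K * N)"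
      using c by (intro exI[of _ "\<lambda>_. W - A"]) (auto intro!: certified_const)
  qed (use 0 in auto)
next
  case (Suc j)
  define \<eta>' where "\<eta>' = \<eta> / (4 * 2 ^ Suc j)"
  have "2 * K > 0" "\<eta>' > 0" using Suc.prems by (auto simp: \<eta>'_def)
  from Suc.IH[OF this] obtain \<delta>' B' where \<delta>': "\<delta>' > 0" "B' \<ge> 0"
    and IH: "\<And>(W :: 'v set) N \<tau> m g. finite W \<Longrightarrow> real (card W) \<le> N \<Longrightarrow> N > 0 \<Longrightarrow>
     \<tau> > 0 \<Longrightarrow> m > 0 \<Longrightarrow> uniform W (Suc j) g \<Longrightarrow> degrees_bounded W (2 * K) \<tau> m g \<Longrightarrow>
     \<eta>' * m * N \<le> deg W g {} \<Longrightarrow>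
     (\<exists>F. certified (B' * \<tau> * N) F \<and>
        (\<forall>X. F X \<subseteq> W \<and> (X \<subseteq> W \<longrightarrow> independent_in g X \<longrightarrow> X \<subseteq> F X) \<and>
             real (card (F X)) \<le> real (card W) - \<delta>' * N))" by metis
  define \<delta> where "\<delta> = min \<delta>' (\<eta> / (4 * K))"
  have \<delta>: "\<delta> > 0" using \<delta>' Suc.prems by (auto simp: \<delta>_def)
  show ?case
  proof (rule exI[of _ \<delta>], rule conjI[rotated], rule exI[of _ "4 * K / \<eta> + B'"],
      rule conjI[rotated], intro allI impI)
    fix W :: "'v set" and N \<tau> m :: real and g
    assume W: "finite W" "real (card W) \<le> N" "N > 0" "\<tau> > 0" "m > 0"
      and g: "uniform W (Suc (Suc j)) g" and b: "degrees_bounded W K \<tau> m g"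
      and tot: "\<eta> * m * N \<le> deg W g {}"
    obtain F U where F: "certified (4 * K / \<eta> * \<tau> * N) F" and U: "\<And>h. U h \<subseteq> W"
      and FU: "\<And>X. U (F X) \<inter> X = {}"
      and Fu: "\<And>X. uniform W (Suc j) (F X)" and Fb: "\<And>X. degrees_bounded W (2 * K) \<tau> (\<tau> * m) (F X)"
      and Fi: "\<And>X. independent_in g X \<Longrightarrow> independent_in (F X) X"
      and alt: "\<And>X. real (card (U (F X))) \<ge> \<eta> / (4 * K) * N \<or> \<eta>' * (\<tau> * m) * N \<le> deg W (F X) {}"
      using container_step[OF W(1,2,4,5) Suc.prems W(3) g b tot] unfolding \<eta>'_def by metis
    \<comment> \<open>\<open>certified_bind\<close> asks for a certified continuation at every state
      \<open>h\<close>, including those that no \<open>X\<close> produces; there the constant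
      \<open>W\<close> serves as default. The premise \<open>h = F X\<close> gives access to
      \<open>U h \<inter> X = {}\<close>.\<close>
    define ok where "ok h F' \<longleftrightarrow> certified (B' * \<tau> * N) F' \<and>
       (\<forall>X. h = F X \<longrightarrow> F' X \<subseteq> W \<and> (X \<subseteq> W \<longrightarrow> independent_in g X \<longrightarrow> X \<subseteq> F' X) \<and>
          real (card (F' X)) \<le> real (card W) - \<delta> * N)" for h F'
    have "\<exists>F'. ok h F'" for h
    proof (cases "\<exists>X. h = F X")
      case True
      then obtain X0 where X0: "h = F X0" by blast
      show ?thesis
      proof (cases "real (card (U h)) \<ge> \<eta> / (4 * K) * N")
        case True
        have "real (card (W - U h)) = real (card W) - real (card (U h))"
          using U[of h] W by (simp add: card_Diff_subset card_mono of_nat_diff finite_subset)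
        moreover have "\<delta> * N \<le> \<eta> / (4 * K) * N"
          using W by (intro mult_right_mono) (auto simp: \<delta>_def)
        ultimately have "real (card (W - U h)) \<le> real (card W) - \<delta> * N" using True by linarith
        moreover have "X \<subseteq> W - U h" if "X \<subseteq> W" "h = F X" for X using FU[of X] that by blast
        ultimately show ?thesis unfolding ok_def using \<delta>' W
          by (intro exI[of _ "\<lambda>_. W - U h"] conjI certified_const) auto
      next
        case False
        then have "\<eta>' * (\<tau> * m) * N \<le> deg W h {}" using alt[of X0] X0 by auto
        then obtain F' where F': "certified (B' * \<tau> * N) F'"
          "\<And>X. F' X \<subseteq> W \<and> (X \<subseteq> W \<longrightarrow> independent_in h X \<longrightarrow> X \<subseteq> F' X) \<and>
             real (card (F' X)) \<le> real (card W) - \<delta>' * N"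
          using IH[of W N \<tau> "\<tau> * m" h] W Fu[of X0] Fb[of X0] X0 by auto
        have "\<delta> * N \<le> \<delta>' * N" using W by (intro mult_right_mono) (auto simp: \<delta>_def)
        then have "real (card (F' X)) \<le> real (card W) - \<delta> * N" for X
          using F'(2)[of X] by linarith
        then show ?thesis unfolding ok_def using F' Fi by (intro exI[of _ F']) auto
      qed
    next
      case False
      then show ?thesis unfolding ok_def using \<delta>' W
        by (intro exI[of _ "\<lambda>_. W"] conjI certified_const) auto
    qed
    then obtain G where G: "\<And>h. ok h (G h)" by metis
    have "certified (4 * K / \<eta> * \<tau> * N + B' * \<tau> * N) (\<lambda>X. G (F X) X)"
      by (rule certified_bind[OF F]) (use G in \<open>simp add: ok_def\<close>)
    then have "certified ((4 * K / \<eta> + B') * \<tau> * N) (\<lambda>X. G (F X) X)"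
      by (simp add: algebra_simps)
    then show "\<exists>F. certified ((4 * K / \<eta> + B') * \<tau> * N) F \<and>
        (\<forall>X. F X \<subseteq> W \<and> (X \<subseteq> W \<longrightarrow> independent_in g X \<longrightarrow> X \<subseteq> F X) \<and>
             real (card (F X)) \<le> real (card W) - \<delta> * N)"
      using G by (intro exI[of _ "\<lambda>X. G (F X) X"]) (auto simp: ok_def)
  qed (use \<delta> \<delta>' Suc.prems in auto)
qed

lemma deg_mono:
  assumes "finite W" "uniform W j g" "W' \<subseteq> W"
  shows "deg W' g S \<le> deg W g S"
  unfolding deg_def using assms by (intro sum_mono2) (auto simp: uniform_def)

text \<open>\<open>container_shrink\<close> is repeated while the current container still spans
  weight \<open>\<eta> * m * N\<close>. Every round removes at least \<open>\<delta> * N\<close>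
  vertices out of at most \<open>N\<close>, so about \<open>1 / \<delta>\<close> rounds suffice, and
  their fingerprints add up to a constant multiple of \<open>\<tau> * N\<close>.\<close>

theorem hypergraph_containers:
  fixes K \<eta> :: real
  assumes "K > 0" "\<eta> > 0"
  shows "\<exists>B\<ge>0. \<forall>(V :: 'v set) N \<tau> m g. finite V \<longrightarrow> real (card V) \<le> N \<longrightarrow> N > 0 \<longrightarrow>
     \<tau> > 0 \<longrightarrow> m > 0 \<longrightarrow> uniform V (Suc j) g \<longrightarrow> degrees_bounded V K \<tau> m g \<longrightarrow>
     (\<exists>F. certified (B * \<tau> * N) F \<and>
        (\<forall>X. F X \<subseteq> V \<and> (X \<subseteq> V \<longrightarrow> independent_in g X \<longrightarrow> X \<subseteq> F X) \<and>
             deg (F X) g {} < \<eta> * m * N))"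
proof -
  from container_shrink[OF assms, of j] obtain \<delta> B where \<delta>: "\<delta> > 0" "B \<ge> 0"
    and shrink: "\<And>(W :: 'v set) N \<tau> m g. finite W \<Longrightarrow> real (card W) \<le> N \<Longrightarrow> N > 0 \<Longrightarrow>
     \<tau> > 0 \<Longrightarrow> m > 0 \<Longrightarrow> uniform W (Suc j) g \<Longrightarrow> degrees_bounded W K \<tau> m g \<Longrightarrow>
     \<eta> * m * N \<le> deg W g {} \<Longrightarrow>
     (\<exists>F. certified (B * \<tau> * N) F \<and>
        (\<forall>X. F X \<subseteq> W \<and> (X \<subseteq> W \<longrightarrow> independent_in g X \<longrightarrow> X \<subseteq> F X) \<and>
             real (card (F X)) \<le> real (card W) - \<delta> * N))" by metis
  define k where "k = nat \<lceil>1 / \<delta>\<rceil>"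
  have "1 / \<delta> \<le> real k" unfolding k_def by linarith
  then have k: "1 \<le> real k * \<delta>" using \<delta> by (simp add: field_simps)
  show ?thesis
  proof (intro exI[of _ "real k * B"] conjI allI impI)
    show "real k * B \<ge> 0" using \<delta> by simp
    fix V :: "'v set" and N \<tau> m :: real and g
    assume V: "finite V" "real (card V) \<le> N" "N > 0" "\<tau> > 0" "m > 0"
      and g: "uniform V (Suc j) g" and b: "degrees_bounded V K \<tau> m g"
    have pos: "\<eta> * m * N > 0" using assms V by simp
    have "\<exists>F. certified (real i * B * \<tau> * N) F \<and>
        (\<forall>X. F X \<subseteq> W \<and> (X \<subseteq> W \<longrightarrow> independent_in g X \<longrightarrow> X \<subseteq> F X) \<and> deg (F X) g {} < \<eta> * m * N)"
      if "W \<subseteq> V" "real (card W) \<le> real i * \<delta> * N" for i W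
      using that
    proof (induction i arbitrary: W)
      case 0
      then have "W = {}" using V(1) finite_subset by fastforce
      moreover have "g {} = 0" using g by (auto simp: uniform_def)
      ultimately show ?case using pos
        by (intro exI[of _ "\<lambda>_. {}"]) (auto simp: deg_def intro!: certified_const)
    next
      case (Suc i)
      have Wfin: "finite W" using Suc.prems V finite_subset by blast
      show ?case
      proof (cases "deg W g {} < \<eta> * m * N")
        case True
        then show ?thesis using \<delta> V
          by (intro exI[of _ "\<lambda>_. W"] conjI certified_const) auto
      next
        case False
        \<comment> \<open>\<open>uniform\<close> wants all edges inside the current vertex set.
          Discarding the others keeps the degrees within \<open>W\<close>, and independent sets stay
          independent.\<close>
        define g' where "g' f = (if f \<subseteq> W then g f else 0)" for f
        have deg': "deg W g' S = deg W g S" for S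
          unfolding deg_def g'_def by (intro sum.cong) auto
        have "uniform W (Suc j) g'" using g by (auto simp: uniform_def g'_def)
        moreover have "degrees_bounded W K \<tau> m g'"
          unfolding degrees_bounded_def deg'
          using b Suc.prems(1) deg_mono[OF V(1) g Suc.prems(1)]
          unfolding degrees_bounded_def by (meson order_trans)
        moreover have "real (card W) \<le> N" using Suc.prems(1) V card_mono[of V W] by simp
        ultimately obtain F where F: "certified (B * \<tau> * N) F"
          "\<And>X. F X \<subseteq> W \<and> (X \<subseteq> W \<longrightarrow> independent_in g' X \<longrightarrow> X \<subseteq> F X) \<and>
             real (card (F X)) \<le> real (card W) - \<delta> * N"
          using shrink[of W N \<tau> m g'] False V Wfin by (auto simp: deg')
        have ind': "independent_in g' X" if "independent_in g X" for X
          using that by (auto simp: independent_in_def g'_def)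
        define ok where "ok W' F' \<longleftrightarrow> certified (real i * B * \<tau> * N) F' \<and>
          (W' \<subseteq> V \<longrightarrow> real (card W') \<le> real i * \<delta> * N \<longrightarrow> (\<forall>X. F' X \<subseteq> W' \<and>
             (X \<subseteq> W' \<longrightarrow> independent_in g X \<longrightarrow> X \<subseteq> F' X) \<and> deg (F' X) g {} < \<eta> * m * N))" for W' F'
        have "\<exists>F'. ok W' F'" for W'
        proof (cases "W' \<subseteq> V \<and> real (card W') \<le> real i * \<delta> * N")
          case True
          then show ?thesis using Suc.IH[of W'] by (auto simp: ok_def)
        next
          case False
          then show ?thesis unfolding ok_def using \<delta> V
            by (intro exI[of _ "\<lambda>_. {}"] conjI certified_const) auto
        qed
        then obtain G where G: "\<And>W'. ok W' (G W')" by metis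
        have good: "F X \<subseteq> V \<and> real (card (F X)) \<le> real i * \<delta> * N" for X
          using F(2)[of X] Suc.prems by (auto simp: algebra_simps)
        have "certified (B * \<tau> * N + real i * B * \<tau> * N) (\<lambda>X. G (F X) X)"
          by (rule certified_bind[OF F(1)]) (use G in \<open>simp add: ok_def\<close>)
        then have c: "certified (real (Suc i) * B * \<tau> * N) (\<lambda>X. G (F X) X)"
          by (simp add: algebra_simps)
        have GF: "G (F X) X \<subseteq> F X" "X \<subseteq> F X \<Longrightarrow> independent_in g X \<Longrightarrow> X \<subseteq> G (F X) X"
          "deg (G (F X) X) g {} < \<eta> * m * N" for X
          using G[of "F X"] good[of X] unfolding ok_def by blast+
        have "G (F X) X \<subseteq> W" for X using GF(1)[of X] F(2)[of X] by blast
        moreover have "X \<subseteq> G (F X) X" if "X \<subseteq> W" "independent_in g X" for X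
          using GF(2)[of X] F(2)[of X] that ind' by blast
        ultimately show ?thesis using c GF(3) by (intro exI[of _ "\<lambda>X. G (F X) X"]) simp
      qed
    qed
    moreover have "real (card V) \<le> real k * \<delta> * N"
      using V k mult_right_mono[of 1 "real k * \<delta>" N] by linarith
    ultimately show "\<exists>F. certified (real k * B * \<tau> * N) F \<and>
        (\<forall>X. F X \<subseteq> V \<and> (X \<subseteq> V \<longrightarrow> independent_in g X \<longrightarrow> X \<subseteq> F X) \<and> deg (F X) g {} < \<eta> * m * N)"
      by blast
  qed
qed

section \<open>Palettes without distinct representatives\<close>

text \<open>This follows from Hall's theorem but has a direct proof. Remove an element
  \<open>e\<close> with the largest palette: representatives of the rest occupy fewer than
  \<open>card E\<close> colours, so either \<open>P e\<close> has a spare colour, or every palette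
  is smaller than \<open>card E\<close> and \<open>K = E\<close> works.\<close>

lemma distinct_representatives_or_small:
  fixes P :: "'a \<Rightarrow> 'c set"
  assumes "finite E" "\<And>e. e \<in> E \<Longrightarrow> finite (P e)"
  shows "(\<exists>\<kappa>. inj_on \<kappa> E \<and> (\<forall>e\<in>E. \<kappa> e \<in> P e)) \<or>
         (\<exists>K\<subseteq>E. K \<noteq> {} \<and> (\<forall>e\<in>K. card (P e) < card K))"
  using assms
proof (induction "card E" arbitrary: E)
  case 0
  then show ?case by auto
next
  case (Suc k)
  have "E \<noteq> {}" using Suc by auto
  have "Max ((\<lambda>e. card (P e)) ` E) \<in> (\<lambda>e. card (P e)) ` E"
    using Suc.prems \<open>E \<noteq> {}\<close> by (intro Max_in) auto
  then obtain e where e: "e \<in> E" "card (P e) = Max ((\<lambda>e. card (P e)) ` E)" by auto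
  then have max: "card (P f) \<le> card (P e)" if "f \<in> E" for f
    using that Suc.prems by simp
  have cE: "card (E - {e}) = k" using Suc e by simp
  have "(\<exists>\<kappa>. inj_on \<kappa> (E - {e}) \<and> (\<forall>f\<in>E - {e}. \<kappa> f \<in> P f)) \<or>
         (\<exists>K\<subseteq>E - {e}. K \<noteq> {} \<and> (\<forall>f\<in>K. card (P f) < card K))"
    using Suc.hyps(1)[of "E - {e}"] cE Suc.prems by simp
  then show ?case
  proof
    assume "\<exists>K\<subseteq>E - {e}. K \<noteq> {} \<and> (\<forall>f\<in>K. card (P f) < card K)"
    then show ?thesis by blast
  next
    assume "\<exists>\<kappa>. inj_on \<kappa> (E - {e}) \<and> (\<forall>f\<in>E - {e}. \<kappa> f \<in> P f)"
    then obtain \<kappa> where \<kappa>: "inj_on \<kappa> (E - {e})" "\<forall>f\<in>E - {e}. \<kappa> f \<in> P f" by blast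
    show ?thesis
    proof (cases "card (P e) < card E")
      case True
      then have "\<forall>f\<in>E. card (P f) < card E" using max by (meson le_less_trans)
      then show ?thesis using \<open>E \<noteq> {}\<close> by blast
    next
      case False
      have "card (\<kappa> ` (E - {e})) \<le> k" using cE card_image_le[of "E - {e}" \<kappa>] Suc.prems by simp
      then have "card (\<kappa> ` (E - {e})) < card (P e)" using False Suc.hyps(2) by simp
      then have "\<not> P e \<subseteq> \<kappa> ` (E - {e})"
        using card_mono[of "\<kappa> ` (E - {e})" "P e"] Suc.prems by fastforce
      then obtain c where c: "c \<in> P e" "c \<notin> \<kappa> ` (E - {e})" by blast
      have "inj_on (\<kappa>(e := c)) (insert e (E - {e}))"
        using \<kappa>(1) c(2) by (auto simp: inj_on_def)
      then have "inj_on (\<kappa>(e := c)) E" using e(1) by (simp add: insert_absorb)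
      moreover have "\<forall>f\<in>E. (\<kappa>(e := c)) f \<in> P f" using \<kappa>(2) c(1) by auto
      ultimately show ?thesis by blast
    qed
  qed
qed

text \<open>The second derivative is \<open>(x - 2) / (x - 1)^2\<close>, whence the domain
  \<open>{2..}\<close>.\<close>

lemma convex_mult_ln_shift: "convex_on {2..} (\<lambda>x::real. x * ln (x - 1))"
proof (rule f''_ge0_imp_convex)
  fix x :: real assume x: "x \<in> {2..}"
  show "((\<lambda>x. x * ln (x - 1)) has_real_derivative ln (x - 1) + x / (x - 1)) (at x)"
    using x by (auto intro!: derivative_eq_intros)
  show "((\<lambda>x. ln (x - 1) + x / (x - 1)) has_real_derivative
      1 / (x - 1) + ((x - 1) - x) / ((x - 1) * (x - 1))) (at x)"
    using x by (auto intro!: derivative_eq_intros)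
  have "1 / (x - 1) + ((x - 1) - x) / ((x - 1) * (x - 1)) = (x - 2) / ((x - 1) * (x - 1))"
  proof -
    define y where "y = x - 1"
    have "y \<ge> 1" "x = y + 1" using x by (auto simp: y_def)
    then show ?thesis by (simp add: field_simps)
  qed
  then show "1 / (x - 1) + ((x - 1) - x) / ((x - 1) * (x - 1)) \<ge> 0" using x by simp
qed simp

text \<open>The left side is convex in \<open>k\<close>, so the extreme sizes decide: at
  \<open>k = 2\<close> it is \<open>(r - 2) * L\<close>, bounded by hypothesis, and at
  \<open>k = r\<close> equality holds.\<close>

lemma palette_weight_bound:
  fixes k r L :: real
  assumes k: "2 \<le> k" "k \<le> r" and r: "3 \<le> r" and L: "(r - 2) * L \<le> r * ln (r - 1)"
  shows "k * ln (k - 1) + (r - k) * L \<le> r * ln (r - 1)"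
proof -
  define t where "t = (k - 2) / (r - 2)"
  have t: "0 \<le> t" "t \<le> 1" using k r by (auto simp: t_def field_simps)
  have tk: "t * (r - 2) = k - 2" using r by (simp add: t_def)
  have "(1 - t) * 2 + t * r = 2 + t * (r - 2)" by (simp add: algebra_simps)
  then have keq: "(1 - t) * 2 + t * r = k" by (simp add: tk)
  have "k * ln (k - 1) \<le> (1 - t) * (2 * ln (2 - 1)) + t * (r * ln (r - 1))"
    using convex_onD[OF convex_mult_ln_shift t, of 2 r] r unfolding real_scaleR_def keq by simp
  then have 1: "k * ln (k - 1) \<le> t * (r * ln (r - 1))" by simp
  have "r - k = (1 - t) * (r - 2)" using tk by (simp add: algebra_simps)
  then have "(r - k) * L = (1 - t) * ((r - 2) * L)" by simp
  also have "\<dots> \<le> (1 - t) * (r * ln (r - 1))" using L t by (intro mult_left_mono) auto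
  finally show ?thesis using 1 by (simp add: algebra_simps)
qed

text \<open>For a set \<open>K\<close> of size \<open>k\<close> the worst palettes have
  \<open>k - 1\<close> colours on \<open>K\<close> and \<open>l\<close> elsewhere, which leads to
  \<open>h k q\<close>. For \<open>k \<ge> 2\<close> this vanishes at exponent 0, and its derivative
  there is the logarithm of the product of the palette sizes over \<open>\<rho> ^ r\<close>; the
  extra \<open>\<delta>\<close> in the exponent of \<open>\<rho>\<close> makes it negative. As there
  are finitely many \<open>k\<close>, one small \<open>q\<close> serves them all.\<close>

lemma palette_exponent:
  fixes r l :: nat and \<delta> :: real
  assumes r: "3 \<le> r" and l: "1 \<le> l" and \<delta>: "\<delta> > 0"
    and bound: "real l \<le> (real r - 1) powr (real r / (real r - 2))"
  defines "\<rho> \<equiv> (real r - 1) powr (1 + \<delta>)"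
  shows "\<exists>q c. 0 < q \<and> q \<le> 1 \<and> 0 < c \<and>
    (\<forall>(E :: 'e set) s K. finite E \<longrightarrow> card E = r \<longrightarrow> K \<subseteq> E \<longrightarrow> K \<noteq> {} \<longrightarrow>
       (\<forall>e\<in>E. s e \<le> l) \<longrightarrow> (\<forall>e\<in>K. s e < card K) \<longrightarrow>
       (\<Sum>e\<in>E. (real (s e) / \<rho>) powr q - 1) \<le> - c)"
proof -
  define h where "h k x = real k * ((real k - 1) / \<rho>) powr x + (real r - real k) * (real l / \<rho>) powr x - real r"
    for k :: nat and x :: real
  have \<rho>: "\<rho> > 0" using r by (simp add: \<rho>_def)
  have ln\<rho>: "ln \<rho> = (1 + \<delta>) * ln (real r - 1)" using r by (simp add: \<rho>_def ln_powr)
  have lnr: "ln (real r - 1) > 0" using r by simp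
  have "ln (real l) \<le> real r / (real r - 2) * ln (real r - 1)"
  proof -
    have "ln (real l) \<le> ln ((real r - 1) powr (real r / (real r - 2)))"
      using l bound by (intro ln_mono) auto
    then show ?thesis using r by (simp add: ln_powr)
  qed
  then have L: "(real r - 2) * ln (real l) \<le> real r * ln (real r - 1)"
    using r by (simp add: field_simps)
  have ev: "eventually (\<lambda>x. h k x < 0) (at_right 0)" if k: "k \<in> {1..r}" for k
  \<comment> \<open>For \<open>k = 1\<close> a palette is empty and its term \<open>0 powr x\<close>
    is 0, so the limit at 0 is already \<open>-1\<close> and no derivative is involved.\<close>
  proof (cases "k = 1")
    case True
    have "((\<lambda>x. (real r - 1) * (real l / \<rho>) powr x - real r) \<longlongrightarrow>
        (real r - 1) * (real l / \<rho>) powr 0 - real r) (at_right 0)"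
      using l \<rho> by (intro tendsto_intros) auto
    then have "eventually (\<lambda>x. (real r - 1) * (real l / \<rho>) powr x - real r < 0) (at_right 0)"
      using l \<rho> by (intro order_tendstoD(2)) auto
    then show ?thesis using True by (simp add: h_def)
  next
    case False
    then have k2: "2 \<le> k" "k \<le> r" using k by auto
    define D where "D = real k * ln ((real k - 1) / \<rho>) + (real r - real k) * ln (real l / \<rho>)"
    have "D = real k * ln (real k - 1) + (real r - real k) * ln (real l) - real r * ln \<rho>"
      using k2 l \<rho> by (simp add: D_def ln_div algebra_simps)
    also have "\<dots> \<le> real r * ln (real r - 1) - real r * ln \<rho>"
      using palette_weight_bound[of "real k" "real r" "ln (real l)"] k2 r L by simp
    also have "\<dots> = - (real r * (\<delta> * ln (real r - 1)))" by (simp add: ln\<rho> algebra_simps)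
    also have "\<dots> < 0" using r \<delta> lnr by simp
    finally have D: "D < 0" .
    have der: "((\<lambda>x. a powr x) has_real_derivative ln a) (at 0)" if "a > 0" for a :: real
    proof -
      have "((\<lambda>x. exp (x * ln a)) has_real_derivative ln a) (at 0)"
        by (auto intro!: derivative_eq_intros)
      then show ?thesis using that by (simp add: powr_def)
    qed
    have "(h k has_real_derivative D) (at 0)"
      unfolding h_def D_def
      by (rule derivative_eq_intros der refl | use k2 l \<rho> in simp)+
    then obtain d where d: "d > 0" "\<And>x. 0 < x \<Longrightarrow> x < d \<Longrightarrow> h k (0 + x) < h k 0"
      using has_real_derivative_neg_dec_right[of "h k" D 0 UNIV] D by auto
    have "h k 0 = 0" using k2 l \<rho> by (simp add: h_def)
    then show ?thesis using d by (auto simp: eventually_at_right_field intro!: exI[of _ d])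
  qed
  have "eventually (\<lambda>x. (\<forall>k\<in>{1..r}. h k x < 0) \<and> x < 1) (at_right (0::real))"
    using ev by (intro eventually_conj eventually_ball_finite eventually_at_rightI[of 0 1]) auto
  then obtain b where b: "b > 0" "\<And>x. 0 < x \<Longrightarrow> x < b \<Longrightarrow> (\<forall>k\<in>{1..r}. h k x < 0) \<and> x < 1"
    by (auto simp: eventually_at_right_field)
  define q where "q = b / 2"
  have q: "0 < q" "q < b" using b by (auto simp: q_def)
  define c where "c = Min ((\<lambda>k. - h k q) ` {1..r})"
  have c: "c > 0" unfolding c_def using b(2)[OF q] r by (subst Min_gr_iff) auto
  have ck: "h k q \<le> - c" if "k \<in> {1..r}" for k
  proof -
    have "c \<le> - h k q" unfolding c_def using that by (intro Min_le) auto
    then show ?thesis by simp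
  qed
  show ?thesis
  proof (rule exI[of _ q], rule exI[of _ c], intro conjI allI impI)
    fix E :: "'e set" and s K
    assume E: "finite E" "card E = r" "K \<subseteq> E" "K \<noteq> {}"
      and s: "\<forall>e\<in>E. s e \<le> l" "\<forall>e\<in>K. s e < card K"
    have fK: "finite K" using E finite_subset by blast
    have kr: "1 \<le> card K" "card K \<le> r" using E fK by (auto simp: Suc_le_eq card_gt_0_iff card_mono)
    have "(\<Sum>e\<in>E. (real (s e) / \<rho>) powr q) =
        (\<Sum>e\<in>K. (real (s e) / \<rho>) powr q) + (\<Sum>e\<in>E - K. (real (s e) / \<rho>) powr q)"
      using E by (simp add: sum.subset_diff add.commute)
    also have "\<dots> \<le> (\<Sum>e\<in>K. ((real (card K) - 1) / \<rho>) powr q) + (\<Sum>e\<in>E - K. (real l / \<rho>) powr q)"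
    proof (intro add_mono sum_mono powr_mono2 divide_right_mono)
      fix e assume "e \<in> K"
      then have "s e < card K" using s(2) by blast
      then show "real (s e) \<le> real (card K) - 1" by linarith
    qed (use s \<rho> q in auto)
    also have "\<dots> = h (card K) q + real r"
      using E fK kr by (simp add: h_def card_Diff_subset of_nat_diff)
    also have "\<dots> \<le> - c + real r" using ck[of "card K"] kr by simp
    finally show "(\<Sum>e\<in>E. (real (s e) / \<rho>) powr q - 1) \<le> - c"
      using E by (simp add: sum_subtractf)
  next
    show "q \<le> 1" using b(2)[OF q] by simp
  qed (use q c in auto)
qed

section \<open>Random subsets\<close>

text \<open>The edge set of \<open>random_graph\<close> over an arbitrary ground set;
  \<open>prob_random_graph\<close> makes the link.\<close>

definition random_subset :: "'e set \<Rightarrow> real \<Rightarrow> 'e set pmf" where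
  "random_subset A p = map_pmf (\<lambda>b. {e \<in> A. b e}) (Pi_pmf A False (\<lambda>_. bernoulli_pmf p))"

lemma set_random_subset: "set_pmf (random_subset A p) \<subseteq> Pow A"
  by (auto simp: random_subset_def)

lemma finite_set_random_subset: "finite A \<Longrightarrow> finite (set_pmf (random_subset A p))"
  using set_random_subset[of A p] by (meson finite_Pow_iff finite_subset)

lemma integrable_random_subset [simp]:
  "finite A \<Longrightarrow> integrable (measure_pmf (random_subset A p)) (f :: _ \<Rightarrow> real)"
  by (intro integrable_measure_pmf_finite finite_set_random_subset)

lemma expectation_random_subset_cong:
  fixes f g :: "'e set \<Rightarrow> real"
  assumes "\<And>S. S \<subseteq> A \<Longrightarrow> f S = g S"
  shows "measure_pmf.expectation (random_subset A p) f = measure_pmf.expectation (random_subset A p) g"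
proof (rule integral_cong_AE)
  show "AE S in measure_pmf (random_subset A p). f S = g S"
    using assms set_random_subset[of A p] by (intro AE_pmfI) blast
qed auto

lemma expectation_random_subset_prod:
  fixes x y :: "'e \<Rightarrow> real"
  assumes "finite A" "0 \<le> p" "p \<le> 1" "\<And>e. e \<in> A \<Longrightarrow> x e \<ge> 0" "\<And>e. e \<in> A \<Longrightarrow> y e \<ge> 0"
  shows "measure_pmf.expectation (random_subset A p) (\<lambda>S. \<Prod>e\<in>A. if e \<in> S then x e else y e) =
    (\<Prod>e\<in>A. p * x e + (1 - p) * y e)"
proof -
  have "measure_pmf.expectation (random_subset A p) (\<lambda>S. \<Prod>e\<in>A. if e \<in> S then x e else y e) =
    measure_pmf.expectation (Pi_pmf A False (\<lambda>_. bernoulli_pmf p))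
      (\<lambda>b. \<Prod>e\<in>A. (\<lambda>e t. if t then x e else y e) e (b e))"
    unfolding random_subset_def integral_map_pmf
    by (intro Bochner_Integration.integral_cong[OF refl] prod.cong[OF refl]) auto
  also have "\<dots> = (\<Prod>e\<in>A. measure_pmf.expectation (bernoulli_pmf p) (\<lambda>t. if t then x e else y e))"
    using assms by (intro expectation_prod_Pi_pmf)
      (auto intro!: integrable_measure_pmf_finite)
  finally show ?thesis using assms by (simp add: mult.commute)
qed

text \<open>The condition \<open>D \<subseteq> S\<close> and the weight together factor over the
  elements of \<open>A\<close>: a missing element contributes 0 if it lies in \<open>D\<close> and 1
  otherwise.\<close>

lemma expectation_superset_prod:
  fixes x :: "'e \<Rightarrow> real"
  assumes "finite A" "0 \<le> p" "p \<le> 1" "\<And>e. e \<in> A \<Longrightarrow> x e \<ge> 0" "D \<subseteq> A"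
  shows "measure_pmf.expectation (random_subset A p) (\<lambda>S. if D \<subseteq> S then \<Prod>e\<in>S. x e else 0) =
    (\<Prod>e\<in>D. p * x e) * (\<Prod>e\<in>A - D. 1 + p * (x e - 1))"
proof -
  have "(if D \<subseteq> S then \<Prod>e\<in>S. x e else 0) =
      (\<Prod>e\<in>A. if e \<in> S then x e else if e \<in> D then 0 else 1)" if "S \<subseteq> A" for S
  proof (cases "D \<subseteq> S")
    case True
    have "(\<Prod>e\<in>A. if e \<in> S then x e else if e \<in> D then 0 else 1) = (\<Prod>e\<in>A. if e \<in> S then x e else 1)"
      using True by (intro prod.cong) auto
    also have "\<dots> = (\<Prod>e\<in>S. x e)"
      using assms(1) that by (simp add: prod.If_cases Int_absorb1)
    finally show ?thesis using True by simp
  next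
    case False
    then obtain e where "e \<in> D" "e \<notin> S" by blast
    then have "(\<Prod>e\<in>A. if e \<in> S then x e else if e \<in> D then 0 else 1) = 0"
      using assms(1,5) by (intro prod_zero) auto
    then show ?thesis using False by simp
  qed
  then have "measure_pmf.expectation (random_subset A p) (\<lambda>S. if D \<subseteq> S then \<Prod>e\<in>S. x e else 0) =
     measure_pmf.expectation (random_subset A p)
       (\<lambda>S. \<Prod>e\<in>A. if e \<in> S then x e else if e \<in> D then 0 else 1)"
    by (rule expectation_random_subset_cong)
  also have "\<dots> = (\<Prod>e\<in>A. p * x e + (1 - p) * (if e \<in> D then 0 else 1))"
    using assms by (intro expectation_random_subset_prod) auto
  also have "\<dots> = (\<Prod>e\<in>D. p * x e) * (\<Prod>e\<in>A - D. 1 + p * (x e - 1))"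
  proof -
    have "(\<Prod>e\<in>A. p * x e + (1 - p) * (if e \<in> D then 0 else 1)) =
      (\<Prod>e\<in>A. if e \<in> D then p * x e else 1 + p * (x e - 1))"
      by (intro prod.cong) (auto simp: algebra_simps)
    also have "\<dots> = (\<Prod>e\<in>D. p * x e) * (\<Prod>e\<in>A - D. 1 + p * (x e - 1))"
      using assms(1,5) by (simp add: prod.If_cases Int_absorb1 Diff_eq[symmetric])
    finally show ?thesis .
  qed
  finally show ?thesis .
qed

lemma markov_random_subset:
  assumes "finite A" "\<And>S. S \<subseteq> A \<Longrightarrow> Y S \<ge> (0::real)" "\<And>S. S \<subseteq> A \<Longrightarrow> P S \<Longrightarrow> Y S \<ge> c" "c > 0"
  shows "measure_pmf.prob (random_subset A p) {S. P S} \<le>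
     measure_pmf.expectation (random_subset A p) Y / c"
proof -
  have "measure_pmf.prob (random_subset A p) {S. P S} \<le>
     measure_pmf.prob (random_subset A p) {S. c \<le> Y S}"
    using set_random_subset[of A p] assms(3)
    by (intro measure_pmf.finite_measure_mono_AE AE_pmfI) auto
  also have "\<dots> \<le> measure_pmf.expectation (random_subset A p) Y / c"
    using integral_Markov_inequality_measure[of "measure_pmf (random_subset A p)" Y "{}" c]
      assms(1,2,4) set_random_subset[of A p] by (auto intro!: AE_pmfI)
  finally show ?thesis .
qed

text \<open>Chernoff's lower tail: Markov's inequality for \<open>2 ^ (- card S)\<close>, whose mean
  \<open>(1 - p / 2) ^ card A\<close> is at most \<open>exp (- p * card A / 2)\<close>.\<close>

lemma prob_few_elements:
  assumes A: "finite A" and p: "0 \<le> p" "p \<le> 1"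
  shows "measure_pmf.prob (random_subset A p) {S. real (card S) < p * real (card A) / 2}
    \<le> exp (- (1 - ln 2) / 2 * (p * real (card A)))"
proof -
  define y where "y = p * real (card A) / 2"
  have "measure_pmf.prob (random_subset A p) {S. real (card S) < y} \<le>
    measure_pmf.expectation (random_subset A p) (\<lambda>S. if {} \<subseteq> S then \<Prod>e\<in>S. 1 / 2 else 0) /
      (2 powr (- y))"
  proof (rule markov_random_subset[OF A])
    fix S :: "'a set" assume "real (card S) < y"
    then have "2 powr (- y) \<le> 2 powr (- real (card S))" by simp
    also have "\<dots> = (if {} \<subseteq> S then \<Prod>e\<in>S. 1 / 2 else 0)"
      by (simp add: powr_minus powr_realpow power_one_over inverse_eq_divide)
    finally show "2 powr (- y) \<le> (if {} \<subseteq> S then \<Prod>e\<in>S. 1 / 2 else 0)" .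
  qed auto
  also have "measure_pmf.expectation (random_subset A p) (\<lambda>S. if {} \<subseteq> S then \<Prod>e\<in>S. 1 / 2 else 0)
      = (1 + p * (1 / 2 - 1)) ^ card A"
    using expectation_superset_prod[OF A p, of "\<lambda>_. 1 / 2" "{}"] by simp
  also have "(1 + p * (1 / 2 - 1)) ^ card A \<le> exp (p * (1 / 2 - 1)) ^ card A"
    using p by (intro power_mono exp_ge_add_one_self) auto
  also have "\<dots> = exp (- y)" by (simp add: y_def exp_of_nat_mult[symmetric] mult.commute)
  also have "exp (- y) / 2 powr (- y) = exp (- y + y * ln 2)"
    by (simp add: powr_def exp_diff[symmetric] exp_add)
  also have "- y + y * ln 2 = - (1 - ln 2) / 2 * (p * real (card A))"
    by (simp add: y_def field_simps)
  finally show ?thesis by (simp add: y_def divide_right_mono)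
qed

section \<open>Counting colourings by their fingerprints\<close>

lemma powr_sum_le:
  fixes f :: "'i \<Rightarrow> real"
  assumes "\<And>i. i \<in> I \<Longrightarrow> f i \<ge> 0" "0 < q" "q \<le> 1"
  shows "(\<Sum>i\<in>I. f i) powr q \<le> (\<Sum>i\<in>I. f i powr q)"
proof (cases "(\<Sum>i\<in>I. f i) > 0")
  case True
  define s where "s = (\<Sum>i\<in>I. f i)"
  have s: "s > 0" using True by (simp add: s_def)
  have finI: "finite I" using True by (intro ccontr[of "finite I"]) simp
  have "s powr q = s * s powr (q - 1)"
    using s by (metis add.commute diff_add_cancel less_imp_le powr_add powr_one)
  also have "\<dots> = (\<Sum>i\<in>I. f i * s powr (q - 1))" by (simp add: s_def sum_distrib_right)
  also have "\<dots> \<le> (\<Sum>i\<in>I. f i powr q)"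
  proof (rule sum_mono)
    fix i assume i: "i \<in> I"
    show "f i * s powr (q - 1) \<le> f i powr q"
    proof (cases "f i = 0")
      case False
      then have fi: "f i > 0" "f i \<le> s"
        using assms(1) i finI by (auto simp: s_def less_le intro!: member_le_sum)
      \<comment> \<open>The exponent \<open>q - 1\<close> is not positive and
        \<open>f i \<le> s\<close>; this is where \<open>q \<le> 1\<close> makes the power
        subadditive.\<close>
      have "s powr (q - 1) \<le> f i powr (q - 1)"
        using fi assms by (intro powr_mono2') auto
      then have "f i * s powr (q - 1) \<le> f i * f i powr (q - 1)"
        using fi by (intro mult_left_mono) auto
      also have "\<dots> = f i powr q"
        using fi by (metis add.commute diff_add_cancel less_imp_le powr_add powr_one)
      finally show ?thesis .
    qed simp
  qed
  finally show ?thesis by (simp add: s_def)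
next
  case False
  then have "(\<Sum>i\<in>I. f i) = 0" using sum_nonneg[of I f] assms(1) by force
  then show ?thesis by (simp add: sum_nonneg)
qed

lemma sum_power_card_subsets:
  fixes z :: real
  assumes "finite V" "z \<ge> 0"
  shows "(\<Sum>T\<in>Pow V. z ^ card T) = (1 + z) ^ card V"
  using prod_add[OF assms(1), of "\<lambda>_. z" "\<lambda>_. 1"] by (simp add: add.commute)

text \<open>View a colouring as its graph \<open>I\<close>, a set of pairs. A certificate
  \<open>T \<subseteq> I\<close> satisfies \<open>F T = F I\<close>, so palettes that contain the
  colouring can be read off from \<open>T\<close> alone, and each \<open>T\<close> accounts for at
  most the product of its palette sizes. \<open>inj_on fst T\<close> records that \<open>T\<close>
  is itself a partial colouring: it involves as many edges as it has elements.\<close>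

lemma card_PiE_certified_le:
  fixes F :: "('e \<times> nat) set \<Rightarrow> ('e \<times> nat) set"
  assumes F: "certified b F" and S: "finite S"
    and C: "C \<subseteq> S \<rightarrow>\<^sub>E {1..l}"
    and cover: "\<And>\<kappa>. \<kappa> \<in> C \<Longrightarrow> (\<lambda>e. (e, \<kappa> e)) ` S \<subseteq> F ((\<lambda>e. (e, \<kappa> e)) ` S)"
  shows "card C \<le> (\<Sum>T | T \<subseteq> S \<times> {1..l} \<and> inj_on fst T \<and> real (card T) \<le> b.
     \<Prod>e\<in>S. card {i \<in> {1..l}. (e, i) \<in> F T})"
proof -
  define \<T> where "\<T> = {T. T \<subseteq> S \<times> {1..l} \<and> inj_on fst T \<and> real (card T) \<le> b}"
  define Q where "Q T = (PiE S (\<lambda>e. {i \<in> {1..l}. (e, i) \<in> F T}))" for T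
  have fin\<T>: "finite \<T>"
    using S by (auto simp: \<T>_def intro: finite_subset[of _ "Pow (S \<times> {1..l})"])
  have "C \<subseteq> (\<Union>T\<in>\<T>. Q T)"
  proof
    fix \<kappa> assume \<kappa>: "\<kappa> \<in> C"
    define I where "I = (\<lambda>e. (e, \<kappa> e)) ` S"
    obtain T where T: "T \<subseteq> I" "real (card T) \<le> b" "F T = F I"
      using F unfolding certified_def by (metis order_refl)
    have \<kappa>P: "\<kappa> \<in> S \<rightarrow>\<^sub>E {1..l}" using \<kappa> C by blast
    then have "I \<subseteq> S \<times> {1..l}" by (auto simp: I_def)
    moreover have "inj_on fst I" by (auto simp: I_def inj_on_def)
    ultimately have "T \<in> \<T>" using T by (auto simp: \<T>_def intro: inj_on_subset)
    moreover have "\<kappa> \<in> Q T"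
    proof -
      have "(e, \<kappa> e) \<in> F T" if "e \<in> S" for e
        using cover[OF \<kappa>] that T(3) by (auto simp: I_def)
      then show ?thesis using \<kappa>P unfolding Q_def PiE_iff by auto
    qed
    ultimately show "\<kappa> \<in> (\<Union>T\<in>\<T>. Q T)" by blast
  qed
  moreover have finQ: "finite (Q T)" for T unfolding Q_def using S by (intro finite_PiE) auto
  ultimately have "card C \<le> card (\<Union>T\<in>\<T>. Q T)" using fin\<T> by (intro card_mono) auto
  also have "\<dots> \<le> (\<Sum>T\<in>\<T>. card (Q T))" by (rule card_UN_le[OF fin\<T>])
  also have "\<dots> = (\<Sum>T\<in>\<T>. \<Prod>e\<in>S. card {i \<in> {1..l}. (e, i) \<in> F T})"
    unfolding Q_def using S by (simp add: card_PiE)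
  finally show ?thesis by (simp add: \<T>_def)
qed

text \<open>The fractional moment with exponent \<open>q\<close> turns the first-moment method into a bound on
  \<open>\<Sum>e. (s e / \<rho>) powr q - 1\<close>, which still makes sense for edges with an empty palette.\<close>

lemma prob_many_colourings:
  fixes F :: "('e \<times> nat) set \<Rightarrow> ('e \<times> nat) set" and C :: "'e set \<Rightarrow> ('e \<Rightarrow> nat) set"
  assumes A: "finite A" and p: "0 \<le> p" "p \<le> 1" and l: "1 \<le> l" and \<rho>: "\<rho> \<ge> 1"
    and q: "0 < q" "q \<le> 1" and F: "certified b F" and \<theta>: "0 < \<theta>" "\<theta> \<le> 1"
    and C: "\<And>S. S \<subseteq> A \<Longrightarrow> C S \<subseteq> S \<rightarrow>\<^sub>E {1..l}"
    and cover: "\<And>S \<kappa>. S \<subseteq> A \<Longrightarrow> \<kappa> \<in> C S \<Longrightarrow>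
        (\<lambda>e. (e, \<kappa> e)) ` S \<subseteq> F ((\<lambda>e. (e, \<kappa> e)) ` S)"
    and small: "\<And>X. (\<Sum>e\<in>A. (real (card {i \<in> {1..l}. (e, i) \<in> F X}) / \<rho>) powr q - 1) \<le> - c * real (card A)"
  shows "measure_pmf.prob (random_subset A p) {S. real (card (C S)) > \<rho> ^ card S} \<le>
    exp (b * ln (1 / \<theta>) + \<theta> * (p * l * exp 1) * (l * real (card A)) - c * p * real (card A))"
proof -
  define V where "V = A \<times> {1..l}"
  define \<T> where "\<T> = {T. T \<subseteq> V \<and> inj_on fst T \<and> real (card T) \<le> b}"
  define s where "s T e = card {i \<in> {1..l}. (e, i) \<in> F T}" for T e
  define x where "x T e = (real (s T e) / \<rho>) powr q" for T e
  define Y where "Y S = (\<Sum>T\<in>\<T>. if fst ` T \<subseteq> S then \<Prod>e\<in>S. x T e else 0)" for S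
  have V: "finite V" "card V = l * card A" using A by (auto simp: V_def card_cartesian_product)
  have fin\<T>: "finite \<T>" using V by (auto simp: \<T>_def intro: finite_subset[of _ "Pow V"])
  have x0: "x T e \<ge> 0" for T e by (simp add: x_def)
  have xl: "x T e \<le> l" for T e
  proof -
    have "s T e \<le> card {1..l}" unfolding s_def by (intro card_mono) auto
    then have sl: "real (s T e) \<le> real l" by simp
    have "real (s T e) / \<rho> \<le> real (s T e) / 1" using \<rho> by (intro divide_left_mono) auto
    then have "x T e \<le> real l powr q" unfolding x_def
      using q \<rho> sl by (intro powr_mono2) auto
    also have "\<dots> \<le> real l powr 1" using q l by (intro powr_mono) auto
    finally show ?thesis using l by simp
  qed
  have Y1: "Y S \<ge> 1" if S: "S \<subseteq> A" and big: "real (card (C S)) > \<rho> ^ card S" for S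
  proof -
    have finS: "finite S" using S A finite_subset by blast
    define \<T>' where "\<T>' = {T. T \<subseteq> S \<times> {1..l} \<and> inj_on fst T \<and> real (card T) \<le> b}"
    have sub: "\<T>' \<subseteq> {T\<in>\<T>. fst ` T \<subseteq> S}" using S by (auto simp: \<T>'_def \<T>_def V_def)
    have "card (C S) \<le> (\<Sum>T\<in>\<T>'. \<Prod>e\<in>S. s T e)"
      unfolding \<T>'_def s_def using card_PiE_certified_le[OF F finS C[OF S] cover[OF S]] .
    then have "real (card (C S)) \<le> real (\<Sum>T\<in>\<T>'. \<Prod>e\<in>S. s T e)"
      by (simp only: of_nat_le_iff)
    then have le: "real (card (C S)) \<le> (\<Sum>T\<in>\<T>'. \<Prod>e\<in>S. real (s T e))" by simp
    have "1 \<le> real (card (C S)) / \<rho> ^ card S" using big \<rho> by simp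
    also have "\<dots> \<le> (\<Sum>T\<in>\<T>'. \<Prod>e\<in>S. real (s T e)) / \<rho> ^ card S"
      using le \<rho> by (intro divide_right_mono) auto
    also have "\<dots> = (\<Sum>T\<in>\<T>'. \<Prod>e\<in>S. real (s T e) / \<rho>)"
      by (simp add: sum_divide_distrib prod_dividef)
    finally have "1 \<le> (\<Sum>T\<in>\<T>'. \<Prod>e\<in>S. real (s T e) / \<rho>)" .
    then have "1 \<le> (\<Sum>T\<in>\<T>'. \<Prod>e\<in>S. real (s T e) / \<rho>) powr q"
      using q by (simp add: ge_one_powr_ge_zero)
    also have "\<dots> \<le> (\<Sum>T\<in>\<T>'. (\<Prod>e\<in>S. real (s T e) / \<rho>) powr q)"
      using q \<rho> by (intro powr_sum_le prod_nonneg) auto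
    also have "\<dots> = (\<Sum>T\<in>\<T>'. \<Prod>e\<in>S. x T e)" by (simp add: x_def prod_powr_distrib)
    also have "\<dots> \<le> (\<Sum>T\<in>{T\<in>\<T>. fst ` T \<subseteq> S}. \<Prod>e\<in>S. x T e)"
      using sub fin\<T> x0 by (intro sum_mono2 prod_nonneg) auto
    also have "\<dots> = Y S" unfolding Y_def
      by (rule sum.mono_neutral_cong_left) (use fin\<T> in auto)
    finally show ?thesis .
  qed
  have Y0: "Y S \<ge> 0" for S unfolding Y_def using x0 by (intro sum_nonneg) (auto intro!: prod_nonneg)
  \<comment> \<open>Per element of the fingerprint: \<open>p\<close> for the presence of its edge,
    \<open>l\<close> as a bound on \<open>x T e\<close>, and \<open>exp 1\<close> for dropping a
    term \<open>x T e - 1 \<ge> - 1\<close> from the exponent.\<close>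
  define z where "z = p * l * exp 1"
  have z0: "z \<ge> 0" using p by (simp add: z_def)
  have each: "measure_pmf.expectation (random_subset A p)
      (\<lambda>S. if fst ` T \<subseteq> S then \<Prod>e\<in>S. x T e else 0) \<le> exp (- c * p * real (card A)) * z ^ card T"
    if T: "T \<in> \<T>" for T
  proof -
    define D where "D = fst ` T"
    have D: "D \<subseteq> A" "card D = card T" "finite D"
      using T V finite_subset[of T V] by (auto simp: D_def \<T>_def V_def card_image)
    have "measure_pmf.expectation (random_subset A p)
      (\<lambda>S. if D \<subseteq> S then \<Prod>e\<in>S. x T e else 0) = (\<Prod>e\<in>D. p * x T e) * (\<Prod>e\<in>A - D. 1 + p * (x T e - 1))"
      using A p D x0 by (intro expectation_superset_prod) auto
    also have "\<dots> \<le> (\<Prod>e\<in>D. p * l) * (\<Prod>e\<in>A - D. exp (p * (x T e - 1)))"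
    proof (intro mult_mono prod_mono conjI)
      fix e
      have "0 \<le> (1 - p) + p * x T e" using p x0[of T e] by (intro add_nonneg_nonneg) auto
      then show "0 \<le> 1 + p * (x T e - 1)" by (simp add: algebra_simps)
    next
      show "0 \<le> (\<Prod>e\<in>A - D. 1 + p * (x T e - 1))"
      proof (intro prod_nonneg)
        fix e
        have "0 \<le> (1 - p) + p * x T e" using p x0[of T e] by (intro add_nonneg_nonneg) auto
        then show "0 \<le> 1 + p * (x T e - 1)" by (simp add: algebra_simps)
      qed
    qed (use p x0 xl in \<open>auto intro!: mult_left_mono prod_nonneg\<close>)
    also have "(\<Prod>e\<in>A - D. exp (p * (x T e - 1))) = exp (p * (\<Sum>e\<in>A - D. x T e - 1))"
      using A by (simp add: exp_sum sum_distrib_left)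
    also have "(\<Prod>e\<in>D. p * real l) * exp (p * (\<Sum>e\<in>A - D. x T e - 1)) \<le>
       (p * l) ^ card T * exp (- c * p * real (card A) + card T)"
    proof (intro mult_mono)
      have "(\<Sum>e\<in>A. x T e - 1) = (\<Sum>e\<in>A - D. x T e - 1) + (\<Sum>e\<in>D. x T e - 1)"
        using A D(1) by (rule sum.subset_diff[rotated])
      moreover have "(\<Sum>e\<in>D. x T e - 1) \<ge> (\<Sum>e\<in>D. - 1)" using x0 by (intro sum_mono) auto
      ultimately have "(\<Sum>e\<in>A - D. x T e - 1) \<le> (\<Sum>e\<in>A. x T e - 1) + card T"
        using D by simp
      also have "\<dots> \<le> - c * real (card A) + card T"
        using small[of T] by (simp add: x_def s_def)
      finally have "p * (\<Sum>e\<in>A - D. x T e - 1) \<le> p * (- c * real (card A) + card T)"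
        using p by (intro mult_left_mono) auto
      also have "\<dots> \<le> - c * p * real (card A) + card T"
        using p mult_right_mono[of p 1 "real (card T)"] by (simp add: algebra_simps)
      finally show "exp (p * (\<Sum>e\<in>A - D. x T e - 1)) \<le> exp (- c * p * real (card A) + card T)" by simp
    qed (use p D in auto)
    also have "\<dots> = exp (- c * p * real (card A)) * z ^ card T"
      unfolding exp_add z_def power_mult_distrib
      using exp_of_nat_mult[of "card T" "1 :: real"] by (simp add: mult_ac)
    finally show ?thesis by (simp add: D_def)
  qed
  have "measure_pmf.prob (random_subset A p) {S. real (card (C S)) > \<rho> ^ card S} \<le>
     measure_pmf.expectation (random_subset A p) Y / 1"
    by (rule markov_random_subset[OF A]) (use Y0 Y1 in auto)
  also have "\<dots> = (\<Sum>T\<in>\<T>. measure_pmf.expectation (random_subset A p)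
      (\<lambda>S. if fst ` T \<subseteq> S then \<Prod>e\<in>S. x T e else 0))"
    unfolding Y_def using A by (simp add: Bochner_Integration.integral_sum)
  also have "\<dots> \<le> (\<Sum>T\<in>\<T>. exp (- c * p * real (card A)) * z ^ card T)"
    by (intro sum_mono each)
  \<comment> \<open>Since \<open>card T \<le> b\<close>, the factor
    \<open>\<theta> powr (- b) * \<theta> ^ card T\<close> is at least 1. It replaces a count of the
    sets of size at most \<open>b\<close> by the generating function
    \<open>(1 + \<theta> * z) ^ card V\<close>, and \<open>\<theta>\<close> stays free for
    balancing.\<close>
  also have "\<dots> \<le> (\<Sum>T\<in>\<T>. exp (- c * p * real (card A)) * (\<theta> powr (- b) * (\<theta> * z) ^ card T))"
  proof (intro sum_mono mult_left_mono)
    fix T assume T: "T \<in> \<T>"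
    have "1 = \<theta> powr (- b) * \<theta> powr b" using \<theta> by (simp add: powr_minus)
    also have "\<dots> \<le> \<theta> powr (- b) * \<theta> powr (card T)"
      using \<theta> T by (intro mult_left_mono powr_mono') (auto simp: \<T>_def)
    finally have "1 \<le> \<theta> powr (- b) * \<theta> ^ card T" using \<theta> by (simp add: powr_realpow)
    then have "1 * z ^ card T \<le> \<theta> powr (- b) * \<theta> ^ card T * z ^ card T"
      using z0 by (intro mult_right_mono) auto
    then show "z ^ card T \<le> \<theta> powr (- b) * (\<theta> * z) ^ card T"
      by (simp add: power_mult_distrib mult.assoc)
  qed auto
  also have "\<dots> = exp (- c * p * real (card A)) * (\<theta> powr (- b) * (\<Sum>T\<in>\<T>. (\<theta> * z) ^ card T))"
    by (simp add: sum_distrib_left)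
  also have "\<dots> \<le> exp (- c * p * real (card A)) * (\<theta> powr (- b) * (1 + \<theta> * z) ^ card V)"
  proof (intro mult_left_mono)
    have "(\<Sum>T\<in>\<T>. (\<theta> * z) ^ card T) \<le> (\<Sum>T\<in>Pow V. (\<theta> * z) ^ card T)"
      using V z0 \<theta> by (intro sum_mono2) (auto simp: \<T>_def)
    then show "(\<Sum>T\<in>\<T>. (\<theta> * z) ^ card T) \<le> (1 + \<theta> * z) ^ card V"
      using sum_power_card_subsets[of V "\<theta> * z"] V z0 \<theta> by simp
  qed auto
  also have "\<dots> \<le> exp (- c * p * real (card A)) * (exp (b * ln (1 / \<theta>)) * exp (\<theta> * z) ^ card V)"
    using \<theta> z0 by (intro mult_left_mono mult_mono power_mono exp_ge_add_one_self)
      (auto simp: powr_def ln_div)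
  also have "\<dots> = exp (b * ln (1 / \<theta>) + \<theta> * z * (l * real (card A)) - c * p * real (card A))"
    unfolding V(2) by (simp add: exp_of_nat_mult[symmetric] exp_add[symmetric] mult_ac)
  finally show ?thesis by (simp add: z_def)
qed

section \<open>Densities and embeddings\<close>

lemma finite_all_pairs [simp]: "finite V \<Longrightarrow> finite (all_pairs V)"
  by (auto simp: all_pairs_def intro: finite_subset[of _ "Pow V"])

lemma card_all_pairs: "finite V \<Longrightarrow> card (all_pairs V) = card V choose 2"
  by (simp add: all_pairs_def n_subsets)

lemma card_all_pairs_bounds:
  assumes "n \<ge> 2"
  shows "real n ^ 2 / 4 \<le> real (card (all_pairs {1..n}))" "real (card (all_pairs {1..n})) \<le> real n ^ 2"
proof -
  have "card (all_pairs {1..n}) = n * (n - 1) div 2" by (simp add: card_all_pairs choose_two)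
  moreover have "even (n * (n - 1))" by (cases "even n") auto
  ultimately have "2 * card (all_pairs {1..n}) = n * (n - 1)" by (metis dvd_mult_div_cancel)
  then have "2 * real (card (all_pairs {1..n})) = real (n * (n - 1))" by (metis of_nat_mult of_nat_numeral)
  also have "\<dots> = real n * (real n - 1)" using assms by (simp add: of_nat_diff)
  finally have eq: "real (card (all_pairs {1..n})) = real n * (real n - 1) / 2" by simp
  have "real n * 2 \<le> real n * real n" using assms by (intro mult_left_mono) auto
  then show "real n ^ 2 / 4 \<le> real (card (all_pairs {1..n}))"
    "real (card (all_pairs {1..n})) \<le> real n ^ 2"
    unfolding eq by (auto simp: power2_eq_square field_simps)
qed

lemma finite_densities:
  assumes "simple_graph H"
  shows "finite {(real (ecount F) - 1) / (real (vcount F) - 2) | F. subgraph F H \<and> vcount F \<ge> 3}"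
proof -
  have "finite (verts H)" "finite (edges H)"
    using assms finite_subset[of "edges H" "all_pairs (verts H)"] by (auto simp: simple_graph_def)
  then have "finite (Pow (verts H) \<times> Pow (edges H))" by simp
  moreover have "{F. subgraph F H \<and> vcount F \<ge> 3} \<subseteq> Pow (verts H) \<times> Pow (edges H)"
    by (auto simp: subgraph_def)
  ultimately have "finite {F. subgraph F H \<and> vcount F \<ge> 3}" using finite_subset by blast
  then show ?thesis unfolding setcompr_eq_image by (rule finite_imageI)
qed

lemma max_2_density_ge:
  assumes "simple_graph H" "subgraph F H" "vcount F \<ge> 3"
  shows "(real (ecount F) - 1) / (real (vcount F) - 2) \<le> max_2_density H"
  unfolding max_2_density_def
  by (rule Max_ge[OF finite_densities[OF assms(1)]]) (use assms in blast)

lemma max_2_density_attained: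
  assumes "simple_graph H" "subgraph F H" "vcount F \<ge> 3"
  obtains F' where "subgraph F' H" "vcount F' \<ge> 3"
    "max_2_density H = (real (ecount F') - 1) / (real (vcount F') - 2)"
proof -
  have "max_2_density H \<in> {(real (ecount F) - 1) / (real (vcount F) - 2) | F. subgraph F H \<and> vcount F \<ge> 3}"
    unfolding max_2_density_def
    by (rule Max_in[OF finite_densities[OF assms(1)]]) (use assms in blast)
  then show thesis using that by blast
qed

lemma non_matching_subgraph:
  assumes H: "simple_graph H" "non_matching H"
  obtains F where "subgraph F H" "vcount F = 3" "ecount F = 2"
proof -
  obtain e f where ef: "e \<in> edges H" "f \<in> edges H" "e \<noteq> f" "e \<inter> f \<noteq> {}"
    using H(2) by (auto simp: non_matching_def)
  have c: "card e = 2" "card f = 2" "e \<subseteq> verts H" "f \<subseteq> verts H"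
    using ef H(1) by (auto simp: simple_graph_def all_pairs_def)
  have fin: "finite e" "finite f" using c by (auto intro: card_ge_0_finite)
  have "card (e \<inter> f) < 2"
  proof (rule ccontr)
    assume "\<not> card (e \<inter> f) < 2"
    then have "e \<inter> f = e" using c fin by (intro card_seteq) auto
    moreover have "e \<inter> f = f" using \<open>\<not> card (e \<inter> f) < 2\<close> c fin by (intro card_seteq) auto
    ultimately have "e = f" by simp
    then show False using ef by auto
  qed
  moreover have "card (e \<inter> f) \<noteq> 0" using ef fin by simp
  ultimately have "card (e \<inter> f) = 1" by simp
  then have "card (e \<union> f) = 3" using card_Un_Int[OF fin] c by simp
  moreover have "subgraph (e \<union> f, {e, f}) H"
    using c ef fin by (auto simp: subgraph_def simple_graph_def all_pairs_def)
  ultimately show thesis using that[of "(e \<union> f, {e, f})"] ef by (simp add: vcount_def ecount_def)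
qed

lemma max_2_density_ge_1:
  assumes "simple_graph H" "non_matching H"
  shows "max_2_density H \<ge> 1"
proof -
  obtain F where "subgraph F H" "vcount F = 3" "ecount F = 2"
    using non_matching_subgraph[OF assms] .
  then show ?thesis using max_2_density_ge[OF assms(1), of F] by simp
qed

text \<open>Since \<open>max_2_density H \<ge> 1\<close>, a maximiser on at least three vertices has
  at least two edges, which is what it takes to spoil a rainbow copy by a repeated colour.\<close>

lemma densest_subgraph:
  assumes "simple_graph H" "non_matching H"
  obtains F where "subgraph F H" "vcount F \<ge> 3" "ecount F \<ge> 2"
    "real (ecount F) - 1 = max_2_density H * (real (vcount F) - 2)"
proof -
  obtain F0 where "subgraph F0 H" "vcount F0 = 3" using non_matching_subgraph[OF assms] .
  then obtain F where F: "subgraph F H" "vcount F \<ge> 3"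
    "max_2_density H = (real (ecount F) - 1) / (real (vcount F) - 2)"
    using max_2_density_attained[OF assms(1), of F0] by auto
  then have eq: "real (ecount F) - 1 = max_2_density H * (real (vcount F) - 2)" by simp
  have "1 * 1 \<le> max_2_density H * (real (vcount F) - 2)"
    using max_2_density_ge_1[OF assms] F by (intro mult_mono) auto
  then have "ecount F \<ge> 2" using eq by linarith
  then show thesis using that F eq by blast
qed

text \<open>For \<open>J\<close> spanning at least three vertices this is the definition of the
  maximum 2-density. A single edge, where the quotient makes no sense, fits into the product form
  with both sides 0.\<close>

lemma edges_density:
  assumes H: "simple_graph H" "non_matching H" and J: "J \<subseteq> edges H" "J \<noteq> {}"
  shows "2 \<le> card (\<Union>J)" "\<Union>J \<subseteq> verts H"
    "real (card J) - 1 \<le> max_2_density H * (real (card (\<Union>J)) - 2)"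
proof -
  have E: "e \<subseteq> verts H" "card e = 2" if "e \<in> J" for e
    using that J H(1) by (auto simp: simple_graph_def all_pairs_def)
  show UV: "\<Union>J \<subseteq> verts H" using E by blast
  then have fin: "finite (\<Union>J)" using H(1) finite_subset by (auto simp: simple_graph_def)
  obtain e where e: "e \<in> J" using J by blast
  show c2: "2 \<le> card (\<Union>J)" using E[OF e] card_mono[OF fin, of e] e by auto
  show "real (card J) - 1 \<le> max_2_density H * (real (card (\<Union>J)) - 2)"
  proof (cases "card (\<Union>J) = 2")
    case True
    have "f = \<Union>J" if "f \<in> J" for f
      using E(2)[OF that] True fin that by (intro card_seteq) auto
    then have "J \<subseteq> {\<Union>J}" by blast
    then have "card J \<le> 1" using card_mono[of "{\<Union>J}" J] by simp
    then show ?thesis using True by simp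
  next
    case False
    then have c3: "3 \<le> card (\<Union>J)" using c2 by simp
    have "subgraph (\<Union>J, J) H"
      using J UV E fin by (auto simp: subgraph_def simple_graph_def all_pairs_def)
    then have "(real (card J) - 1) / (real (card (\<Union>J)) - 2) \<le> max_2_density H"
      using max_2_density_ge[OF H(1), of "(\<Union>J, J)"] c3 by (simp add: vcount_def ecount_def)
    then show ?thesis using c3 by (simp add: field_simps)
  qed
qed

text \<open>With \<tau> = n^(-1/d) the density hypothesis says n^(u-2) \<tau>^(s-1) \<ge> 1: rooted
  at one edge, a subgraph with \<open>s\<close> edges on \<open>u\<close> vertices is expected at
  least about once at the threshold. The remaining \<open>w - u\<close> vertices are free.\<close>

lemma threshold_power_le:
  assumes d: "d \<ge> 1" and n: "n \<ge> 1" and uw: "2 \<le> u" "u \<le> w" and s: "s \<ge> 1"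
    and dens: "real s - 1 \<le> d * (real u - 2)"
  shows "real n ^ (w - u) \<le> real n ^ (w - 2) * (real n powr (- 1 / d)) ^ (s - 1)"
proof -
  have "(real s - 1) / d \<le> real u - 2" using d dens by (simp add: field_simps)
  then have "real (w - u) \<le> real (w - 2) + (- 1 / d) * real (s - 1)"
    using uw s by (simp add: of_nat_diff)
  then have "real n powr real (w - u) \<le> real n powr (real (w - 2) + (- 1 / d) * real (s - 1))"
    using n by (intro powr_mono) auto
  also have "\<dots> = real n powr real (w - 2) * (real n powr (- 1 / d)) powr real (s - 1)"
    unfolding powr_add powr_powr by simp
  finally show ?thesis using n by (simp add: powr_realpow)
qed

section \<open>Counting embeddings into \<open>{1..n}\<close>\<close>

definition embeddings :: "'a set \<Rightarrow> nat \<Rightarrow> ('a \<Rightarrow> nat) set" where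
  "embeddings V n = {\<phi> \<in> V \<rightarrow>\<^sub>E {1..n}. inj_on \<phi> V}"

lemma finite_embeddings [simp]: "finite V \<Longrightarrow> finite (embeddings V n)"
  unfolding embeddings_def by (rule finite_subset[of _ "V \<rightarrow>\<^sub>E {1..n}"], blast, simp add: finite_PiE)

text \<open>Vertices are placed one after the other; at each stage at least \<open>n / 2\<close>
  images remain.\<close>

lemma card_embeddings_ge:
  fixes V :: "'a set"
  assumes "finite V" "2 * card V \<le> n"
  shows "(real n / 2) ^ card V \<le> real (card (embeddings V n))"
  using assms
proof (induction V rule: finite_induct)
  case empty
  have "embeddings ({} :: 'a set) n = {\<lambda>_. undefined}" by (auto simp: embeddings_def)
  then show ?case by simp
next
  case (insert v V)
  define Q where "Q = (SIGMA \<phi>:embeddings V n. {1..n} - \<phi> ` V)"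
  have "(\<lambda>(\<phi>, i). \<phi>(v := i)) ` Q \<subseteq> embeddings (insert v V) n"
  proof clarify
    fix \<phi> i assume "(\<phi>, i) \<in> Q"
    then show "\<phi>(v := i) \<in> embeddings (insert v V) n" using insert.hyps
      by (auto simp: Q_def embeddings_def PiE_def extensional_def Pi_def inj_on_def)
  qed
  moreover have "inj_on (\<lambda>(\<phi>, i). \<phi>(v := i)) Q"
  proof (rule inj_onI, clarify)
    fix \<phi> i \<psi> j assume a: "(\<phi>, i) \<in> Q" "(\<psi>, j) \<in> Q" "\<phi>(v := i) = \<psi>(v := j)"
    have "\<phi> w = \<psi> w" for w
    proof (cases "w = v")
      case True
      then show ?thesis using a(1,2) insert.hyps
        by (auto simp: Q_def embeddings_def PiE_def extensional_def)
    next
      case False then show ?thesis using a(3) by (metis fun_upd_apply)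
    qed
    moreover have "i = j" using a(3) by (metis fun_upd_same)
    ultimately show "\<phi> = \<psi> \<and> i = j" by blast
  qed
  ultimately have "card Q \<le> card (embeddings (insert v V) n)"
    using insert.hyps by (metis card_image card_mono finite_embeddings finite_insert)
  moreover have "card Q = (\<Sum>\<phi>\<in>embeddings V n. card ({1..n} - \<phi> ` V))"
    unfolding Q_def using insert.hyps by (intro card_SigmaI) auto
  moreover have "real (\<Sum>\<phi>\<in>embeddings V n. card ({1..n} - \<phi> ` V)) \<ge> real (card (embeddings V n)) * (real n / 2)"
  proof -
    have "real n / 2 \<le> real (card ({1..n} - \<phi> ` V))" if "\<phi> \<in> embeddings V n" for \<phi>
    proof -
      have "card ({1..n} - \<phi> ` V) \<ge> card {1..n} - card (\<phi> ` V)" by (rule diff_card_le_card_Diff) (use insert.hyps in simp)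
      moreover have "card (\<phi> ` V) \<le> card V" using insert.hyps by (intro card_image_le) auto
      ultimately have "card ({1..n} - \<phi> ` V) + card V \<ge> n" by simp
      then show ?thesis using insert.prems insert.hyps by simp
    qed
    then have "(\<Sum>\<phi>\<in>embeddings V n. real n / 2) \<le> (\<Sum>\<phi>\<in>embeddings V n. real (card ({1..n} - \<phi> ` V)))"
      by (rule sum_mono)
    then show ?thesis by simp
  qed
  moreover have "(real n / 2) ^ card (insert v V) \<le> real (card (embeddings V n)) * (real n / 2)"
    using insert by (simp add: mult.commute mult_left_mono)
  ultimately show ?case by linarith
qed

lemma card_maps_into_le:
  assumes "finite V" "V0 \<subseteq> V" "finite B"
  shows "card {\<phi> \<in> V \<rightarrow>\<^sub>E {1..n}. \<phi> ` V0 \<subseteq> B} \<le> card B ^ card V0 * n ^ (card V - card V0)"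
proof -
  have "{\<phi> \<in> V \<rightarrow>\<^sub>E {1..n}. \<phi> ` V0 \<subseteq> B} \<subseteq> PiE V (\<lambda>v. if v \<in> V0 then B else {1..n})"
    by (auto simp: PiE_def Pi_def)
  then have "card {\<phi> \<in> V \<rightarrow>\<^sub>E {1..n}. \<phi> ` V0 \<subseteq> B} \<le> card (PiE V (\<lambda>v. if v \<in> V0 then B else {1..n}))"
    using assms by (intro card_mono finite_PiE) auto
  also have "\<dots> = (\<Prod>v\<in>V. if v \<in> V0 then card B else n)"
    using assms by (simp add: card_PiE if_distrib[of card] cong: if_cong)
  also have "\<dots> = card B ^ card V0 * n ^ card (V - V0)"
    using assms by (simp add: prod.If_cases Int_absorb1 Diff_eq[symmetric])
  finally show ?thesis using assms by (simp add: card_Diff_subset finite_subset)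
qed

lemma inj_on_image_edges:
  assumes "simple_graph H" "inj_on \<phi> (verts H)"
  shows "inj_on (\<lambda>e. \<phi> ` e) (edges H)"
  by (rule inj_on_subset[OF inj_on_image_Pow[OF assms(2)]])
     (use assms(1) in \<open>auto simp: simple_graph_def all_pairs_def\<close>)

lemma embedding_image_pair:
  assumes "simple_graph H" "\<phi> \<in> embeddings (verts H) n" "e \<in> edges H"
  shows "\<phi> ` e \<in> all_pairs {1..n}"
proof -
  have e: "e \<subseteq> verts H" "card e = 2" using assms by (auto simp: simple_graph_def all_pairs_def)
  have "inj_on \<phi> e" using assms(2) e by (auto simp: embeddings_def intro: inj_on_subset)
  then have "card (\<phi> ` e) = 2" using e by (simp add: card_image)
  moreover have "\<phi> ` e \<subseteq> {1..n}" using assms(2) e by (auto simp: embeddings_def PiE_def Pi_def)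
  ultimately show ?thesis by (simp add: all_pairs_def)
qed

lemma copy_of_embedding:
  assumes H: "simple_graph H" and \<phi>: "\<phi> \<in> embeddings (verts H) n" and S: "(\<lambda>e. \<phi> ` e) ` edges H \<subseteq> S"
  shows "copy_of H ({1..n}, S) (\<phi> ` verts H, (\<lambda>e. \<phi> ` e) ` edges H)"
proof -
  have inj: "inj_on \<phi> (verts H)" using \<phi> by (simp add: embeddings_def)
  have "\<phi> ` e \<in> all_pairs (\<phi> ` verts H)" if "e \<in> edges H" for e
    using embedding_image_pair[OF H \<phi> that] H that by (auto simp: all_pairs_def simple_graph_def)
  moreover have "\<phi> ` verts H \<subseteq> {1..n}" using \<phi> by (auto simp: embeddings_def PiE_def Pi_def)
  ultimately have "subgraph (\<phi> ` verts H, (\<lambda>e. \<phi> ` e) ` edges H) ({1..n}, S)"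
    using H S by (auto simp: subgraph_def simple_graph_def)
  moreover have "graph_iso H (\<phi> ` verts H, (\<lambda>e. \<phi> ` e) ` edges H)"
    using inj by (auto simp: graph_iso_def bij_betw_def intro!: exI[of _ \<phi>])
  ultimately show ?thesis by (simp add: copy_of_def)
qed

text \<open>By symmetry under permutations of the vertex set.\<close>

lemma card_embeddings_on_pair:
  assumes H: "simple_graph H" and e: "e \<in> edges H" and P: "P \<in> all_pairs {1..n}" "Q \<in> all_pairs {1..n}"
  shows "card {\<phi> \<in> embeddings (verts H) n. \<phi> ` e = P} \<le> card {\<phi> \<in> embeddings (verts H) n. \<phi> ` e = Q}"
proof -
  have fin: "finite P" "finite Q" "card P = card Q" "P \<subseteq> {1..n}" "Q \<subseteq> {1..n}"
    using P by (auto simp: all_pairs_def intro: card_ge_0_finite)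
  obtain f where f: "bij_betw f P Q" using fin finite_same_card_bij by blast
  have "card ({1..n} - P) = card ({1..n} - Q)" using fin by (simp add: card_Diff_subset)
  then obtain g where g: "bij_betw g ({1..n} - P) ({1..n} - Q)"
    using finite_same_card_bij[of "{1..n} - P" "{1..n} - Q"] by blast
  define \<sigma> where "\<sigma> x = (if x \<in> P then f x else g x)" for x
  have \<sigma>P: "bij_betw \<sigma> P Q" using f by (rule bij_betw_cong[THEN iffD1, rotated]) (simp add: \<sigma>_def)
  have \<sigma>C: "bij_betw \<sigma> ({1..n} - P) ({1..n} - Q)"
    using g by (rule bij_betw_cong[THEN iffD1, rotated]) (simp add: \<sigma>_def)
  have \<sigma>: "bij_betw \<sigma> {1..n} {1..n}"
    using bij_betw_combine[OF \<sigma>P \<sigma>C] fin by (auto simp: Un_absorb1)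
  define T where "T \<phi> = restrict (\<sigma> \<circ> \<phi>) (verts H)" for \<phi> :: "'a \<Rightarrow> nat"
  have ev: "e \<subseteq> verts H" using H e by (auto simp: simple_graph_def all_pairs_def)
  have "T ` {\<phi> \<in> embeddings (verts H) n. \<phi> ` e = P} \<subseteq> {\<phi> \<in> embeddings (verts H) n. \<phi> ` e = Q}"
  proof clarify
    fix \<phi> assume \<phi>: "\<phi> \<in> embeddings (verts H) n" and [simp]: "P = \<phi> ` e"
    have r: "\<phi> ` verts H \<subseteq> {1..n}" using \<phi> by (auto simp: embeddings_def PiE_def Pi_def)
    have "inj_on (\<sigma> \<circ> \<phi>) (verts H)"
      using \<phi> \<sigma> r by (intro comp_inj_on) (auto simp: embeddings_def bij_betw_def intro: inj_on_subset)
    moreover have "\<sigma> (\<phi> v) \<in> {1..n}" if "v \<in> verts H" for v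
      using \<sigma> r that bij_betwE by blast
    ultimately have "T \<phi> \<in> embeddings (verts H) n"
      unfolding T_def embeddings_def by (auto simp: PiE_def Pi_def inj_on_def)
    moreover have "T \<phi> ` e = \<sigma> ` \<phi> ` e" using ev by (auto simp: T_def)
    then have "T \<phi> ` e = Q" using \<sigma>P by (simp add: bij_betw_def)
    ultimately show "T \<phi> \<in> embeddings (verts H) n \<and> T \<phi> ` e = Q" by blast
  qed
  moreover have "inj_on T {\<phi> \<in> embeddings (verts H) n. \<phi> ` e = P}"
  proof (rule inj_onI)
    fix \<phi> \<psi> assume a: "\<phi> \<in> {\<phi> \<in> embeddings (verts H) n. \<phi> ` e = P}"
      "\<psi> \<in> {\<phi> \<in> embeddings (verts H) n. \<phi> ` e = P}" "T \<phi> = T \<psi>"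
    show "\<phi> = \<psi>"
    proof (rule PiE_ext)
      show "\<phi> \<in> verts H \<rightarrow>\<^sub>E {1..n}" "\<psi> \<in> verts H \<rightarrow>\<^sub>E {1..n}" using a by (auto simp: embeddings_def)
      fix v assume v: "v \<in> verts H"
      have "\<sigma> (\<phi> v) = \<sigma> (\<psi> v)" using fun_cong[OF a(3), of v] v by (simp add: T_def)
      moreover have "\<phi> v \<in> {1..n}" "\<psi> v \<in> {1..n}" using a v by (auto simp: embeddings_def PiE_def Pi_def)
      ultimately show "\<phi> v = \<psi> v" using \<sigma> inj_onD[of \<sigma> "{1..n}" "\<phi> v" "\<psi> v"] by (simp add: bij_betw_def)
    qed
  qed
  moreover have "finite {\<phi> \<in> embeddings (verts H) n. \<phi> ` e = Q}"
    using H by (simp add: simple_graph_def)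
  ultimately show ?thesis by (intro card_inj_on_le[of T])
qed

text \<open>By \<open>card_embeddings_on_pair\<close> all pairs are hit by \<open>e\<close> equally
  often, so an average over embeddings is an average over pairs, here with the denominators
  cleared.\<close>

lemma sum_embeddings_pair:
  fixes x :: "nat set \<Rightarrow> real"
  assumes H: "simple_graph H" and e: "e \<in> edges H" and n: "n \<ge> 2"
  shows "(\<Sum>\<phi>\<in>embeddings (verts H) n. x (\<phi> ` e)) * real (card (all_pairs {1..n})) =
    real (card (embeddings (verts H) n)) * (\<Sum>P\<in>all_pairs {1..n}. x P)"
proof -
  let ?A = "all_pairs {1..n}" and ?M = "embeddings (verts H) n"
  have finM: "finite ?M" using H by (simp add: simple_graph_def)
  have "{1, 2} \<in> ?A" using n by (auto simp: all_pairs_def)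
  define c where "c = card {\<phi> \<in> ?M. \<phi> ` e = {1, 2}}"
  have c: "card {\<phi> \<in> ?M. \<phi> ` e = P} = c" if "P \<in> ?A" for P
    unfolding c_def using card_embeddings_on_pair[OF H e] that \<open>{1, 2} \<in> ?A\<close> by (meson antisym)
  have group: "(\<Sum>\<phi>\<in>?M. y (\<phi> ` e)) = (\<Sum>P\<in>?A. real c * y P)" for y :: "nat set \<Rightarrow> real"
  proof -
    have "(\<Sum>\<phi>\<in>?M. y (\<phi> ` e)) = (\<Sum>P\<in>?A. \<Sum>\<phi> | \<phi> \<in> ?M \<and> \<phi> ` e = P. y (\<phi> ` e))"
      using finM embedding_image_pair[OF H _ e] by (intro sum.group[symmetric]) auto
    also have "\<dots> = (\<Sum>P\<in>?A. real c * y P)" using c by (intro sum.cong) auto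
    finally show ?thesis .
  qed
  have "real (card ?M) = real c * real (card ?A)" using group[of "\<lambda>_. 1"] by simp
  then show ?thesis using group[of x] by (simp add: sum_distrib_left[symmetric])
qed

section \<open>The hypergraph of rainbow copies\<close>

text \<open>Labelled rainbow copies instead of subgraphs, so that automorphisms of \<open>H\<close>
  never have to be counted. Different placements may have the same edge set, and
  \<open>placement_weight\<close> keeps their multiplicity.\<close>

definition placements :: "'a graph \<Rightarrow> nat \<Rightarrow> nat \<Rightarrow> (('a \<Rightarrow> nat) \<times> ('a set \<Rightarrow> nat)) set" where
  "placements H l n = {(\<phi>, \<kappa>). \<phi> \<in> embeddings (verts H) n \<and>
     \<kappa> \<in> edges H \<rightarrow>\<^sub>E {1..l} \<and> inj_on \<kappa> (edges H)}"

definition placement_edges :: "'a graph \<Rightarrow> ('a \<Rightarrow> nat) \<times> ('a set \<Rightarrow> nat) \<Rightarrow> (nat set \<times> nat) set" where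
  "placement_edges H x = (\<lambda>e. (fst x ` e, snd x e)) ` edges H"

definition placement_weight :: "'a graph \<Rightarrow> nat \<Rightarrow> nat \<Rightarrow> (nat set \<times> nat) set \<Rightarrow> real" where
  "placement_weight H l n f = real (card {x \<in> placements H l n. placement_edges H x = f})"

lemma finite_graph:
  assumes "simple_graph H"
  shows "finite (verts H)" "finite (edges H)"
proof -
  show "finite (verts H)" using assms by (simp add: simple_graph_def)
  then have "finite (all_pairs (verts H))" by simp
  then show "finite (edges H)" using assms by (auto simp: simple_graph_def intro: finite_subset)
qed

lemma finite_placements [simp]:
  assumes "simple_graph H"
  shows "finite (placements H l n)"
proof (rule finite_subset)
  show "placements H l n \<subseteq> embeddings (verts H) n \<times> (edges H \<rightarrow>\<^sub>E {1..l})"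
    by (auto simp: placements_def)
  show "finite (embeddings (verts H) n \<times> (edges H \<rightarrow>\<^sub>E {1..l}))"
    using finite_graph[OF assms] by (intro finite_cartesian_product finite_PiE) auto
qed

lemma placement_edges_props:
  assumes H: "simple_graph H" and x: "x \<in> placements H l n"
  shows "placement_edges H x \<subseteq> all_pairs {1..n} \<times> {1..l}"
    and "card (placement_edges H x) = ecount H"
    and "inj_on (\<lambda>e. (fst x ` e, snd x e)) (edges H)"
proof -
  obtain \<phi> \<kappa> where [simp]: "x = (\<phi>, \<kappa>)" by (cases x)
  have \<phi>: "\<phi> \<in> embeddings (verts H) n" and \<kappa>: "\<kappa> \<in> edges H \<rightarrow>\<^sub>E {1..l}" "inj_on \<kappa> (edges H)"
    using x by (auto simp: placements_def)
  show "placement_edges H x \<subseteq> all_pairs {1..n} \<times> {1..l}"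
    using embedding_image_pair[OF H \<phi>] \<kappa>(1) by (auto simp: placement_edges_def)
  show "inj_on (\<lambda>e. (fst x ` e, snd x e)) (edges H)" using \<kappa>(2) by (auto simp: inj_on_def)
  then show "card (placement_edges H x) = ecount H"
    by (simp add: placement_edges_def card_image ecount_def)
qed

lemma deg_placement_weight:
  assumes H: "simple_graph H" and W: "finite W"
  shows "deg W (placement_weight H l n) S =
    real (card {x \<in> placements H l n. S \<subseteq> placement_edges H x \<and> placement_edges H x \<subseteq> W})"
proof -
  let ?M = "{x \<in> placements H l n. S \<subseteq> placement_edges H x \<and> placement_edges H x \<subseteq> W}"
  have "real (card ?M) = (\<Sum>x\<in>?M. 1)" by simp
  also have "\<dots> = (\<Sum>f | f \<subseteq> W \<and> S \<subseteq> f. \<Sum>x | x \<in> ?M \<and> placement_edges H x = f. 1)"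
    using H W by (intro sum.group[symmetric]) auto
  also have "\<dots> = deg W (placement_weight H l n) S"
    unfolding deg_def placement_weight_def
    by (intro sum.cong[OF refl]) (auto intro!: arg_cong[of _ _ card])
  finally show ?thesis ..
qed

lemma placement_weight_nonzero:
  assumes "placement_weight H l n f \<noteq> 0"
  obtains x where "x \<in> placements H l n" "placement_edges H x = f"
proof -
  have "{x \<in> placements H l n. placement_edges H x = f} \<noteq> {}"
    using assms unfolding placement_weight_def by (intro notI) simp
  then show thesis using that by auto
qed

lemma uniform_placement_weight:
  assumes H: "simple_graph H"
  shows "uniform (all_pairs {1..n} \<times> {1..l}) (ecount H) (placement_weight H l n)"
  unfolding uniform_def
proof (intro conjI allI impI)
  fix f
  show "placement_weight H l n f \<ge> 0" by (simp add: placement_weight_def)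
  assume "placement_weight H l n f \<noteq> 0"
  then obtain x where x: "x \<in> placements H l n" "placement_edges H x = f"
    by (rule placement_weight_nonzero)
  show "f \<subseteq> all_pairs {1..n} \<times> {1..l}" "card f = ecount H"
    using placement_edges_props[OF H x(1)] x(2) by auto
qed

lemma card_Union_pairs_le:
  assumes "finite \<P>" "\<And>P. P \<in> \<P> \<Longrightarrow> card P = 2"
  shows "card (\<Union>\<P>) \<le> 2 * card \<P>"
proof -
  have "card (\<Union>\<P>) \<le> (\<Sum>P\<in>\<P>. card P)" by (rule card_Union_le_sum_card)
  then show ?thesis using assms by simp
qed

text \<open>The vertices covered by \<open>J\<close> must go to the at most
  \<open>2 * ecount F\<close> points covered by \<open>\<P>\<close>, the others are free;
  \<open>threshold_power_le\<close> converts the number of free vertices into powers of the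
  threshold. It serves the co-degrees with \<open>F = H\<close> and the variance with a densest
  subgraph \<open>F\<close>.\<close>

lemma card_embeddings_containing_le:
  assumes H: "simple_graph H" "non_matching H" and F: "subgraph F H" and n: "n \<ge> 1"
    and \<P>: "finite \<P>" "\<And>P. P \<in> \<P> \<Longrightarrow> card P = 2" "card \<P> \<le> ecount F"
    and J: "J \<subseteq> edges F" "J \<noteq> {}"
  shows "real (card {\<phi> \<in> verts F \<rightarrow>\<^sub>E {1..n}. \<phi> ` (\<Union>J) \<subseteq> \<Union>\<P>}) \<le>
    (2 * real (ecount F)) ^ vcount F * (real n ^ (vcount F - 2) *
      (real n powr (- 1 / max_2_density H)) ^ (card J - 1))"
proof -
  have sF: "simple_graph F" and "edges F \<subseteq> edges H" using F by (auto simp: subgraph_def)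
  then have JH: "J \<subseteq> edges H" using J by blast
  note fin = finite_graph[OF sF]
  note d = edges_density[OF H JH J(2)]
  have UJ: "\<Union>J \<subseteq> verts F" using J(1) sF by (auto simp: simple_graph_def all_pairs_def)
  have finP: "finite (\<Union>\<P>)" using \<P> by (intro finite_Union) (auto intro: card_ge_0_finite)
  have cJ: "card J \<ge> 1" using J fin finite_subset by (auto simp: Suc_le_eq card_gt_0_iff)
  have "ecount F \<ge> 1" using cJ card_mono[OF fin(2) J(1)] by (simp add: ecount_def)
  have u: "card (\<Union>J) \<le> vcount F" using fin UJ by (simp add: vcount_def card_mono)
  have "card (\<Union>\<P>) \<le> 2 * ecount F" using card_Union_pairs_le[OF \<P>(1,2)] \<P>(3) by linarith
  then have "real (card (\<Union>\<P>)) ^ card (\<Union>J) \<le> (2 * real (ecount F)) ^ card (\<Union>J)"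
    by (intro power_mono) auto
  also have "\<dots> \<le> (2 * real (ecount F)) ^ vcount F"
    using u \<open>ecount F \<ge> 1\<close> by (intro power_increasing) auto
  finally have 1: "real (card (\<Union>\<P>)) ^ card (\<Union>J) \<le> (2 * real (ecount F)) ^ vcount F" .
  have 2: "real n ^ (vcount F - card (\<Union>J)) \<le> real n ^ (vcount F - 2) *
      (real n powr (- 1 / max_2_density H)) ^ (card J - 1)"
    using threshold_power_le[OF max_2_density_ge_1[OF H] n d(1) u cJ d(3)] .
  have "real (card {\<phi> \<in> verts F \<rightarrow>\<^sub>E {1..n}. \<phi> ` (\<Union>J) \<subseteq> \<Union>\<P>}) \<le>
    real (card (\<Union>\<P>) ^ card (\<Union>J) * n ^ (vcount F - card (\<Union>J)))"
    using card_maps_into_le[OF fin(1) UJ finP, of n] unfolding vcount_def of_nat_le_iff .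
  also have "\<dots> = real (card (\<Union>\<P>)) ^ card (\<Union>J) * real n ^ (vcount F - card (\<Union>J))" by simp
  also have "\<dots> \<le> (2 * real (ecount F)) ^ vcount F * (real n ^ (vcount F - 2) *
      (real n powr (- 1 / max_2_density H)) ^ (card J - 1))"
    using 1 2 by (intro mult_mono) auto
  finally show ?thesis .
qed

lemma subgraph_refl: "simple_graph H \<Longrightarrow> subgraph H H"
  by (simp add: subgraph_def)

text \<open>A placement through \<open>S\<close> is described by the set \<open>J\<close> of edges
  of \<open>H\<close> that lands on \<open>S\<close> (at most \<open>2 ^ ecount H\<close> choices),
  a map sending the vertices of \<open>J\<close> to points of \<open>S\<close>, and a colouring. Any
  nonempty \<open>J\<close> of the right size may occur, hence a density taken over all
  subgraphs.\<close>

lemma degrees_bounded_placement_weight: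
  fixes H :: "'a graph"
  assumes H: "simple_graph H" "non_matching H" and n: "n \<ge> 1"
  shows "degrees_bounded (all_pairs {1..n} \<times> {1..l})
    (2 ^ ecount H * ((2 * real (ecount H)) ^ vcount H * real l ^ ecount H))
    (real n powr (- 1 / max_2_density H)) (real n ^ (vcount H - 2)) (placement_weight H l n)"
  unfolding degrees_bounded_def
proof (intro allI impI)
  fix S assume S: "S \<subseteq> all_pairs {1..n} \<times> {1..l}" "S \<noteq> {}"
  let ?W = "all_pairs {1..n} \<times> {1..l}" and ?d = "max_2_density H"
  note fin = finite_graph[OF H(1)]
  have finS: "finite S" using S(1) finite_subset by fastforce
  have pairs: "card P = 2" if "P \<in> fst ` S" for P using that S(1) by (auto simp: all_pairs_def)
  define b where "b = (2 * real (ecount H)) ^ vcount H * (real n ^ (vcount H - 2) *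
      (real n powr (- 1 / ?d)) ^ (card S - 1))"
  have b0: "b \<ge> 0" by (simp add: b_def)
  define \<J> where "\<J> = {J. J \<subseteq> edges H \<and> card J = card S}"
  define M where "M J = {\<phi> \<in> verts H \<rightarrow>\<^sub>E {1..n}. \<phi> ` (\<Union>J) \<subseteq> \<Union>(fst ` S)} \<times> (edges H \<rightarrow>\<^sub>E {1..l})" for J
  have fin\<J>: "finite \<J>" using fin by (auto simp: \<J>_def intro: finite_subset[of _ "Pow (edges H)"])
  have card\<J>: "card \<J> \<le> 2 ^ ecount H"
    using card_mono[of "Pow (edges H)" \<J>] fin by (auto simp: \<J>_def card_Pow ecount_def)
  have finM: "finite (M J)" for J
    unfolding M_def using fin
    by (intro finite_cartesian_product finite_PiE finite_subset[of "{\<phi> \<in> verts H \<rightarrow>\<^sub>E {1..n}. _ \<phi>}" "verts H \<rightarrow>\<^sub>E {1..n}"]) auto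
  have "{x \<in> placements H l n. S \<subseteq> placement_edges H x \<and> placement_edges H x \<subseteq> ?W} \<subseteq> (\<Union>J\<in>\<J>. M J)"
  proof
    fix x assume "x \<in> {x \<in> placements H l n. S \<subseteq> placement_edges H x \<and> placement_edges H x \<subseteq> ?W}"
    then have x: "x \<in> placements H l n" "S \<subseteq> placement_edges H x" by auto
    define h where "h e = (fst x ` e, snd x e)" for e
    define J where "J = {e \<in> edges H. h e \<in> S}"
    have "h ` J = S" using x(2) by (auto simp: J_def h_def placement_edges_def)
    moreover have "inj_on h J"
      using placement_edges_props(3)[OF H(1) x(1)] unfolding h_def J_def by (rule inj_on_subset) auto
    ultimately have "card J = card S" by (metis card_image)
    then have "J \<in> \<J>" by (auto simp: \<J>_def J_def)
    moreover have "x \<in> M J"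
    proof -
      have "fst x ` e \<in> fst ` S" if "e \<in> J" for e using that imageI[of "h e" S fst] by (simp add: J_def h_def)
      then have "fst x ` (\<Union>J) \<subseteq> \<Union>(fst ` S)" by blast
      then show ?thesis using x(1) unfolding M_def placements_def embeddings_def
        by (cases x) simp
    qed
    ultimately show "x \<in> (\<Union>J\<in>\<J>. M J)" by blast
  qed
  then have "card {x \<in> placements H l n. S \<subseteq> placement_edges H x \<and> placement_edges H x \<subseteq> ?W} \<le>
      card (\<Union>J\<in>\<J>. M J)"
    using fin\<J> finM by (intro card_mono) auto
  also have "\<dots> \<le> (\<Sum>J\<in>\<J>. card (M J))" by (rule card_UN_le[OF fin\<J>])
  finally have "deg ?W (placement_weight H l n) S \<le> real (\<Sum>J\<in>\<J>. card (M J))"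
    by (subst deg_placement_weight[OF H(1)]) (simp, simp only: of_nat_le_iff)
  also have "\<dots> = (\<Sum>J\<in>\<J>. real (card (M J)))" by simp
  also have "\<dots> \<le> (\<Sum>J\<in>\<J>. b * real l ^ ecount H)"
  proof (rule sum_mono)
    fix J assume J: "J \<in> \<J>"
    then have J': "J \<subseteq> edges H" "J \<noteq> {}" "card J = card S" using finS S(2) by (auto simp: \<J>_def)
    have "card (fst ` S) \<le> card S" by (rule card_image_le[OF finS])
    also have "\<dots> \<le> ecount H" using J' fin by (metis card_mono ecount_def)
    finally have "real (card {\<phi> \<in> verts H \<rightarrow>\<^sub>E {1..n}. \<phi> ` (\<Union>J) \<subseteq> \<Union>(fst ` S)}) \<le> b"
      unfolding b_def J'(3)[symmetric] using finS pairs J' n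
      by (intro card_embeddings_containing_le[OF H subgraph_refl[OF H(1)]]) auto
    moreover have "card (edges H \<rightarrow>\<^sub>E {1..l}) = l ^ ecount H"
      using fin by (simp add: card_PiE ecount_def)
    ultimately show "real (card (M J)) \<le> b * real l ^ ecount H"
      unfolding M_def card_cartesian_product by (simp add: mult_right_mono)
  qed
  also have "\<dots> = real (card \<J>) * (b * real l ^ ecount H)" by simp
  also have "\<dots> \<le> 2 ^ ecount H * (b * real l ^ ecount H)"
  proof (rule mult_right_mono)
    have "real (card \<J>) \<le> real (2 ^ ecount H)" using card\<J> by (simp only: of_nat_le_iff)
    then show "real (card \<J>) \<le> 2 ^ ecount H" by simp
  qed (use b0 in auto)
  finally show "deg ?W (placement_weight H l n) S \<le>
     2 ^ ecount H * ((2 * real (ecount H)) ^ vcount H * real l ^ ecount H) *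
       real n ^ (vcount H - 2) * (real n powr (- 1 / ?d)) ^ (card S - 1)"
    by (simp add: b_def mult_ac)
qed

lemma rainbow_free_independent:
  assumes H: "simple_graph H" and c: "\<not> has_rainbow_copy H ({1..n}, S) \<kappa>"
  shows "independent_in (placement_weight H l n) ((\<lambda>e. (e, \<kappa> e)) ` S)"
  unfolding independent_in_def
proof (intro allI impI notI)
  fix f assume w: "placement_weight H l n f \<noteq> 0" and f: "f \<subseteq> (\<lambda>e. (e, \<kappa> e)) ` S"
  from w obtain x where "x \<in> placements H l n" "placement_edges H x = f"
    by (rule placement_weight_nonzero)
  then obtain \<phi> \<kappa>' where x: "(\<phi>, \<kappa>') \<in> placements H l n" "placement_edges H (\<phi>, \<kappa>') = f"
    by (cases x) simp
  have \<phi>: "\<phi> \<in> embeddings (verts H) n" and inj: "inj_on \<kappa>' (edges H)"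
    using x(1) by (auto simp: placements_def)
  have in_S: "\<phi> ` e \<in> S" "\<kappa> (\<phi> ` e) = \<kappa>' e" if "e \<in> edges H" for e
  proof -
    have "(\<phi> ` e, \<kappa>' e) \<in> (\<lambda>e. (e, \<kappa> e)) ` S"
      using that x(2) f by (auto simp: placement_edges_def)
    then show "\<phi> ` e \<in> S" "\<kappa> (\<phi> ` e) = \<kappa>' e" by auto
  qed
  have "copy_of H ({1..n}, S) (\<phi> ` verts H, (\<lambda>e. \<phi> ` e) ` edges H)"
    using in_S by (intro copy_of_embedding[OF H \<phi>]) auto
  moreover have "inj_on \<kappa> ((\<lambda>e. \<phi> ` e) ` edges H)"
    using inj in_S(2) by (auto simp: inj_on_def)
  ultimately show False using c unfolding has_rainbow_copy_def by fastforce
qed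

text \<open>An embedding whose palettes admit distinct colours underlies a placement inside
  \<open>C\<close>, and there are few of those. All other embeddings contribute at most
  \<open>- c\<close> by \<open>palettes\<close>, the exceptional ones at most
  \<open>ecount H * l\<close>, and \<open>few\<close> limits their effect to \<open>c / 2\<close> on
  average. Each embedding sums over \<open>ecount H\<close> edges, hence
  \<open>c / (2 * ecount H)\<close>.\<close>

lemma average_over_pairs:
  fixes H :: "'a graph" and c q \<rho> :: real
  assumes H: "simple_graph H" and r: "ecount H \<ge> 1" and l: "l \<ge> 1" and \<rho>: "\<rho> \<ge> 1"
    and q: "0 < q" "q \<le> 1" and c: "c > 0"
    and palettes: "\<And>s K. K \<subseteq> edges H \<Longrightarrow> K \<noteq> {} \<Longrightarrow> (\<And>e. e \<in> edges H \<Longrightarrow> s e \<le> l) \<Longrightarrow>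
       (\<And>e. e \<in> K \<Longrightarrow> s e < card K) \<Longrightarrow> (\<Sum>e\<in>edges H. (real (s e) / \<rho>) powr q - 1) \<le> - c"
    and n: "n \<ge> 2" "2 * vcount H \<le> n" and C: "finite C"
    and few: "deg C (placement_weight H l n) {} * (c + real (ecount H) * real l) \<le> c / 2 * (real n / 2) ^ vcount H"
  shows "(\<Sum>P\<in>all_pairs {1..n}. (real (card {i \<in> {1..l}. (P, i) \<in> C}) / \<rho>) powr q - 1) \<le>
    - (c / (2 * real (ecount H))) * real (card (all_pairs {1..n}))"
proof -
  let ?A = "all_pairs {1..n}" and ?M = "embeddings (verts H) n" and ?r = "real (ecount H)"
  note fin = finite_graph[OF H]
  define s where "s P = card {i \<in> {1..l}. (P, i) \<in> C}" for P
  define x where "x P = (real (s P) / \<rho>) powr q - 1" for P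
  have sl: "s P \<le> l" for P
  proof -
    have "s P \<le> card {1..l}" unfolding s_def by (intro card_mono) auto
    then show ?thesis by simp
  qed
  have xl: "x P \<le> real l" for P
  proof -
    have "real (s P) / \<rho> \<le> real (s P) / 1" using \<rho> by (intro divide_left_mono) auto
    also have "\<dots> \<le> real l" using sl by simp
    finally have "(real (s P) / \<rho>) powr q \<le> real l powr q" using q \<rho> by (intro powr_mono2) auto
    also have "\<dots> \<le> real l powr 1" using q l by (intro powr_mono) auto
    finally show ?thesis using l by (simp add: x_def)
  qed
  define Bad where "Bad = fst ` {y \<in> placements H l n. placement_edges H y \<subseteq> C}"
  have Bad: "Bad \<subseteq> ?M" by (auto simp: Bad_def placements_def)
  have "card Bad \<le> card {y \<in> placements H l n. placement_edges H y \<subseteq> C}"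
    unfolding Bad_def using H by (intro card_image_le) simp
  then have cBad: "real (card Bad) \<le> deg C (placement_weight H l n) {}"
    using deg_placement_weight[OF H C, of l n "{}"] by simp
  have good: "(\<Sum>e\<in>edges H. x (\<phi> ` e)) \<le> - c" if \<phi>: "\<phi> \<in> ?M - Bad" for \<phi>
  proof -
    define P where "P e = {i \<in> {1..l}. (\<phi> ` e, i) \<in> C}" for e
    have "\<not> (\<exists>\<kappa>. inj_on \<kappa> (edges H) \<and> (\<forall>e\<in>edges H. \<kappa> e \<in> P e))"
    proof
      assume "\<exists>\<kappa>. inj_on \<kappa> (edges H) \<and> (\<forall>e\<in>edges H. \<kappa> e \<in> P e)"
      then obtain \<kappa> where \<kappa>: "inj_on \<kappa> (edges H)" "\<And>e. e \<in> edges H \<Longrightarrow> \<kappa> e \<in> P e" by blast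
      have "(\<phi>, restrict \<kappa> (edges H)) \<in> placements H l n"
        using \<phi> \<kappa> by (auto simp: placements_def P_def inj_on_def)
      moreover have "placement_edges H (\<phi>, restrict \<kappa> (edges H)) \<subseteq> C"
        using \<kappa>(2) by (auto simp: placement_edges_def P_def)
      ultimately have "\<phi> \<in> Bad" unfolding Bad_def by force
      then show False using \<phi> by simp
    qed
    then obtain K where K: "K \<subseteq> edges H" "K \<noteq> {}" "\<forall>e\<in>K. card (P e) < card K"
      using distinct_representatives_or_small[OF fin(2), of P] by (auto simp: P_def)
    then have "(\<Sum>e\<in>edges H. (real (s (\<phi> ` e)) / \<rho>) powr q - 1) \<le> - c"
      using sl by (intro palettes[of K]) (auto simp: s_def P_def)
    then show ?thesis by (simp add: x_def)
  qed
  have any: "(\<Sum>e\<in>edges H. x (\<phi> ` e)) \<le> ?r * real l" for \<phi>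
    using sum_mono[of "edges H" "\<lambda>e. x (\<phi> ` e)" "\<lambda>_. real l"] xl by (simp add: ecount_def)
  have finM: "finite ?M" using fin by simp
  have "(\<Sum>\<phi>\<in>?M. \<Sum>e\<in>edges H. x (\<phi> ` e)) =
     (\<Sum>\<phi>\<in>?M - Bad. \<Sum>e\<in>edges H. x (\<phi> ` e)) + (\<Sum>\<phi>\<in>Bad. \<Sum>e\<in>edges H. x (\<phi> ` e))"
    by (rule sum.subset_diff[OF Bad finM])
  also have "\<dots> \<le> (\<Sum>\<phi>\<in>?M - Bad. - c) + (\<Sum>\<phi>\<in>Bad. ?r * real l)"
    using good any by (intro add_mono sum_mono) auto
  also have "\<dots> = - c * real (card ?M) + real (card Bad) * (c + ?r * real l)"
    using Bad finM by (simp add: card_Diff_subset finite_subset of_nat_diff card_mono algebra_simps)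
  also have "real (card Bad) * (c + ?r * real l) \<le> c / 2 * (real n / 2) ^ vcount H"
    using cBad c by (intro order_trans[OF mult_right_mono few]) auto
  also have "c / 2 * (real n / 2) ^ vcount H \<le> c / 2 * real (card ?M)"
    using card_embeddings_ge[of "verts H" n] n c fin by (intro mult_left_mono) (auto simp: vcount_def)
  finally have up: "(\<Sum>\<phi>\<in>?M. \<Sum>e\<in>edges H. x (\<phi> ` e)) \<le> - (c / 2) * real (card ?M)"
    by simp
  have "(\<Sum>\<phi>\<in>?M. \<Sum>e\<in>edges H. x (\<phi> ` e)) * real (card ?A) =
     (\<Sum>e\<in>edges H. (\<Sum>\<phi>\<in>?M. x (\<phi> ` e)) * real (card ?A))"
    by (subst sum.swap) (rule sum_distrib_right)
  also have "\<dots> = (\<Sum>e\<in>edges H. real (card ?M) * (\<Sum>P\<in>?A. x P))"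
    using sum_embeddings_pair[OF H _ n(1)] by (intro sum.cong) auto
  also have "\<dots> = ?r * (real (card ?M) * (\<Sum>P\<in>?A. x P))" by (simp add: ecount_def)
  finally have eq: "(\<Sum>\<phi>\<in>?M. \<Sum>e\<in>edges H. x (\<phi> ` e)) * real (card ?A) =
     ?r * (real (card ?M) * (\<Sum>P\<in>?A. x P))" .
  have "real (card ?M) * (?r * (\<Sum>P\<in>?A. x P)) \<le> real (card ?M) * (- (c / 2) * real (card ?A))"
    using mult_right_mono[OF up, of "real (card ?A)"] eq by (simp add: mult_ac)
  moreover have "0 < real (card ?M)"
  proof -
    have "0 < (real n / 2) ^ card (verts H)" using n by simp
    also have "\<dots> \<le> real (card ?M)"
      using card_embeddings_ge[of "verts H" n] n fin by (simp add: vcount_def)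
    finally show ?thesis .
  qed
  ultimately have "?r * (\<Sum>P\<in>?A. x P) \<le> - (c / 2) * real (card ?A)"
    by (simp only: mult_le_cancel_left_pos)
  then have "(\<Sum>P\<in>?A. x P) \<le> - (c / (2 * ?r)) * real (card ?A)"
    using r by (simp add: field_simps)
  then show ?thesis by (simp add: x_def s_def)
qed

lemma vcount_ge_3:
  assumes "simple_graph H" "non_matching H"
  shows "vcount H \<ge> 3"
proof -
  obtain F where "subgraph F H" "vcount F = 3" using non_matching_subgraph[OF assms] .
  then show ?thesis using card_mono[OF finite_graph(1)[OF assms(1)], of "verts F"]
    by (simp add: subgraph_def vcount_def)
qed

text \<open>The order of choice matters: the palettes give \<open>q\<close> and \<open>c\<close>,
  these determine \<open>\<eta>\<close>, the containers for \<open>\<eta>\<close> give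
  \<open>B\<close>, and \<open>A\<close> comes last because it must outweigh
  \<open>B\<close>.\<close>

lemma many_rainbow_free_colourings_unlikely:
  fixes H :: "'a graph" and l :: nat and \<delta> :: real
  assumes H: "simple_graph H" "non_matching H" and r: "ecount H \<ge> 3" and l: "ecount H \<le> l"
    and bound: "real l \<le> (real (ecount H) - 1) powr (real (ecount H) / (real (ecount H) - 2))"
    and \<delta>: "\<delta> > 0"
  defines "\<rho> \<equiv> (real (ecount H) - 1) powr (1 + \<delta>)"
  shows "\<exists>A>0. \<exists>c>0. \<exists>n0. \<forall>n\<ge>n0. \<forall>p. 0 \<le> p \<longrightarrow> p \<le> 1 \<longrightarrow>
       p \<ge> A * real n powr (- 1 / max_2_density H) \<longrightarrow>
       measure_pmf.prob (random_subset (all_pairs {1..n}) p)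
         {S. real (rainbow_free_colourings H l ({1..n}, S)) > \<rho> ^ card S} \<le> exp (- c * real n)"
proof -
  define r where "r = real (ecount H)"
  define v where "v = vcount H"
  have r3: "r \<ge> 3" and l1: "l \<ge> 1" and v3: "v \<ge> 3"
    using r l vcount_ge_3[OF H] by (auto simp: r_def v_def)
  have \<rho>1: "\<rho> \<ge> 1" using r \<delta> by (simp add: \<rho>_def ge_one_powr_ge_zero)
  obtain q c where q: "0 < q" "q \<le> 1" and c: "c > 0"
    and pal: "\<forall>(E :: 'a set set) s K. finite E \<longrightarrow> card E = ecount H \<longrightarrow> K \<subseteq> E \<longrightarrow> K \<noteq> {} \<longrightarrow>
       (\<forall>e\<in>E. s e \<le> l) \<longrightarrow> (\<forall>e\<in>K. s e < card K) \<longrightarrow>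
       (\<Sum>e\<in>E. (real (s e) / \<rho>) powr q - 1) \<le> - c"
    using palette_exponent[OF r l1 \<delta> bound, where ?'e = "'a set"] unfolding \<rho>_def
    by (elim exE conjE)
  define K where "K = 2 ^ ecount H * ((2 * real (ecount H)) ^ vcount H * real l ^ ecount H)"
  \<comment> \<open>Chosen so that \<open>\<eta> * m * N * (c + r * l)\<close> equals
    \<open>c / 2 * (n / 2) ^ v\<close>, the bound that \<open>average_over_pairs\<close> demands for
    the placements inside a container.\<close>
  define \<eta> where "\<eta> = c / (2 * (c + r * l) * l * 2 ^ v)"
  have K0: "K > 0" using r l1 by (simp add: K_def)
  have crl: "c + r * l > 0" using c r3 by (simp add: add_pos_nonneg)
  have \<eta>0: "\<eta> > 0" using c crl l1 by (simp add: \<eta>_def)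
  obtain B where B: "B \<ge> 0" and containers: "\<forall>(V :: (nat set \<times> nat) set) N \<tau> m g. finite V \<longrightarrow>
     real (card V) \<le> N \<longrightarrow> N > 0 \<longrightarrow> \<tau> > 0 \<longrightarrow> m > 0 \<longrightarrow> uniform V (Suc (ecount H - 1)) g \<longrightarrow>
     degrees_bounded V K \<tau> m g \<longrightarrow>
     (\<exists>F. certified (B * \<tau> * N) F \<and>
        (\<forall>X. F X \<subseteq> V \<and> (X \<subseteq> V \<longrightarrow> independent_in g X \<longrightarrow> X \<subseteq> F X) \<and> deg (F X) g {} < \<eta> * m * N))"
    using hypergraph_containers[OF K0 \<eta>0, of "ecount H - 1", where ?'v = "nat set \<times> nat"]
    by (elim exE conjE)
  define c1 where "c1 = c / (2 * r)"
  have c1: "c1 > 0" using c r3 by (simp add: c1_def)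
  \<comment> \<open>The exponent has two positive terms, and each may cost a quarter of the gain
    \<open>c1 * p * card P\<close>: \<open>\<theta>\<close> takes care of the second and
    \<open>A\<close> of the first. The summand 1 in \<open>A\<close> gives
    \<open>p \<ge> \<tau> \<ge> 1 / n\<close>, so that the remaining half grows at least linearly in
    \<open>n\<close>.\<close>
  define \<theta> where "\<theta> = min 1 (c1 / (4 * exp 1 * l * l))"
  have \<theta>: "0 < \<theta>" "\<theta> \<le> 1" "\<theta> \<le> c1 / (4 * exp 1 * l * l)" using c1 l1 by (auto simp: \<theta>_def)
  define A where "A = 16 * B * l * ln (1 / \<theta>) / c1 + 1"
  have ln\<theta>: "ln (1 / \<theta>) \<ge> 0" using \<theta> by simp
  have A1: "A \<ge> 1" using B ln\<theta> c1 by (simp add: A_def)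
  have AB: "B * l * ln (1 / \<theta>) \<le> c1 / 16 * A" using c1 by (simp add: A_def field_simps)
  show ?thesis
  proof (rule exI[of _ A], rule conjI[rotated], rule exI[of _ "c1 / 8"], rule conjI[rotated],
      rule exI[of _ "max 2 (2 * v)"], intro allI impI)
    fix n :: nat and p :: real
    assume n: "n \<ge> max 2 (2 * v)" and p: "0 \<le> p" "p \<le> 1"
      and pA: "p \<ge> A * real n powr (- 1 / max_2_density H)"
    define \<tau> where "\<tau> = real n powr (- 1 / max_2_density H)"
    define N where "N = real l * real n ^ 2"
    define m where "m = real n ^ (vcount H - 2)"
    define P where "P = all_pairs {1..n}"
    define V where "V = P \<times> {1..l}"
    define g where "g = placement_weight H l n"
    have n1: "n \<ge> 1" "n \<ge> 2" using n by auto
    have P: "finite P" "real n ^ 2 / 4 \<le> real (card P)" "real (card P) \<le> real n ^ 2"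
      using card_all_pairs_bounds[OF n1(2)] by (auto simp: P_def)
    have "\<exists>F. certified (B * \<tau> * N) F \<and>
        (\<forall>X. F X \<subseteq> V \<and> (X \<subseteq> V \<longrightarrow> independent_in g X \<longrightarrow> X \<subseteq> F X) \<and> deg (F X) g {} < \<eta> * m * N)"
    proof (rule containers[rule_format])
      show "finite V" using P by (simp add: V_def)
      show "real (card V) \<le> N" using P(3) l1 by (simp add: V_def N_def card_cartesian_product)
      show "N > 0" "\<tau> > 0" "m > 0" using n1 l1 by (auto simp: N_def \<tau>_def m_def)
      have "Suc (ecount H - 1) = ecount H" using r by simp
      then show "uniform V (Suc (ecount H - 1)) g"
        using uniform_placement_weight[OF H(1), of n l] by (simp only: V_def P_def g_def)
      show "degrees_bounded V K \<tau> m g"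
        using degrees_bounded_placement_weight[OF H n1(1), of l]
        unfolding K_def \<tau>_def m_def g_def V_def P_def .
    qed
    then obtain F where F: "certified (B * \<tau> * N) F"
      and FX: "\<And>X. F X \<subseteq> V" "\<And>X. X \<subseteq> V \<Longrightarrow> independent_in g X \<Longrightarrow> X \<subseteq> F X"
        "\<And>X. deg (F X) g {} < \<eta> * m * N" by metis
    have nv: "m * real n ^ 2 = real n ^ v"
    proof -
      have "v = (vcount H - 2) + 2" using v3 by (simp add: v_def)
      then show ?thesis unfolding m_def by (metis power_add)
    qed
    have small: "(\<Sum>e\<in>P. (real (card {i \<in> {1..l}. (e, i) \<in> F X}) / \<rho>) powr q - 1) \<le> - c1 * real (card P)" for X
    proof -
      have "deg (F X) g {} * (c + r * l) \<le> \<eta> * m * N * (c + r * l)"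
        using FX(3)[of X] crl by (intro mult_right_mono) auto
      also have "\<dots> = \<eta> * (c + r * l) * l * (m * real n ^ 2)" by (simp add: N_def mult_ac)
      also have "\<dots> = c / 2 * (real n / 2) ^ v"
      proof -
        have "\<eta> * D * l = c / (2 * 2 ^ v)" if "\<eta> = c / (2 * D * l * 2 ^ v)" "D > 0" for D :: real
          unfolding that(1) using that(2) l1 by (simp add: field_simps)
        then have "\<eta> * (c + r * l) * l = c / (2 * 2 ^ v)" using \<eta>_def crl by blast
        then show ?thesis unfolding nv by (simp add: power_divide)
      qed
      finally show ?thesis unfolding P_def c1_def r_def
        by (intro average_over_pairs)
          (use H(1) r l1 \<rho>1 q c n finite_subset[OF FX(1)] P finite_graph(2)[OF H(1)] pal in
            \<open>simp_all add: v_def r_def g_def V_def ecount_def\<close>)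
    qed
    let ?C = "\<lambda>S. {\<kappa> \<in> S \<rightarrow>\<^sub>E {1..l}. \<not> has_rainbow_copy H ({1..n}, S) \<kappa>}"
    have cover: "(\<lambda>e. (e, \<kappa> e)) ` S \<subseteq> F ((\<lambda>e. (e, \<kappa> e)) ` S)" if S: "S \<subseteq> P" and \<kappa>: "\<kappa> \<in> ?C S" for S \<kappa>
    proof (rule FX(2))
      show "(\<lambda>e. (e, \<kappa> e)) ` S \<subseteq> V" using S \<kappa> by (auto simp: V_def)
      show "independent_in g ((\<lambda>e. (e, \<kappa> e)) ` S)"
        unfolding g_def using \<kappa> by (intro rainbow_free_independent[OF H(1)]) auto
    qed
    have "measure_pmf.prob (random_subset P p) {S. real (card (?C S)) > \<rho> ^ card S} \<le>
      exp (B * \<tau> * N * ln (1 / \<theta>) + \<theta> * (p * l * exp 1) * (l * real (card P)) - c1 * p * real (card P))"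
      by (rule prob_many_colourings[OF P(1) p l1 \<rho>1 q F \<theta>(1,2) _ cover small]) auto
    also have "\<dots> \<le> exp (- (c1 / 8) * real n)"
    proof -
      have "B * \<tau> * N * ln (1 / \<theta>) = (B * l * ln (1 / \<theta>)) * (\<tau> * real n ^ 2)"
        by (simp add: N_def mult_ac)
      also have "\<dots> \<le> (c1 / 16 * A) * (\<tau> * real n ^ 2)"
        using AB by (intro mult_right_mono) (auto simp: \<tau>_def)
      also have "\<dots> = (c1 / 16) * ((A * \<tau>) * real n ^ 2)" by (simp add: mult_ac)
      also have "\<dots> \<le> (c1 / 16) * (p * real n ^ 2)"
        using pA c1 by (intro mult_left_mono mult_right_mono) (auto simp: \<tau>_def)
      also have "\<dots> = (c1 / 4) * (p * (real n ^ 2 / 4))" by simp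
      also have "\<dots> \<le> (c1 / 4) * (p * real (card P))"
        using P p c1 by (intro mult_left_mono) auto
      finally have 1: "B * \<tau> * N * ln (1 / \<theta>) \<le> (c1 / 4) * (p * real (card P))" .
      have "\<theta> * (p * l * exp 1) * (l * real (card P)) = \<theta> * (exp 1 * l * l) * (p * real (card P))"
        by (simp add: mult_ac)
      also have "\<dots> \<le> (c1 / (4 * exp 1 * l * l)) * (exp 1 * l * l) * (p * real (card P))"
        using \<theta>(3) p by (intro mult_right_mono) auto
      also have "\<dots> = (c1 / 4) * (p * real (card P))" using l1 by (simp add: field_simps)
      finally have 2: "\<theta> * (p * l * exp 1) * (l * real (card P)) \<le> (c1 / 4) * (p * real (card P))" .
      have "real n powr (- 1) \<le> \<tau>"
        unfolding \<tau>_def using n1 max_2_density_ge_1[OF H] by (intro powr_mono) (auto simp: field_simps)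
      also have "\<dots> \<le> A * \<tau>" using A1 by (simp add: \<tau>_def mult_le_cancel_right1)
      also have "\<dots> \<le> p" using pA by (simp add: \<tau>_def)
      finally have "1 / real n \<le> p" using n1 by (simp add: powr_minus_divide)
      then have "1 / real n * (real n ^ 2 / 4) \<le> p * real (card P)"
        using P p by (intro mult_mono) auto
      then have 3: "real n / 4 \<le> p * real (card P)" using n1 by (simp add: power2_eq_square)
      have "B * \<tau> * N * ln (1 / \<theta>) + \<theta> * (p * l * exp 1) * (l * real (card P)) - c1 * p * real (card P)
        \<le> - (c1 / 2) * (p * real (card P))" using 1 2 by (simp add: mult.assoc)
      also have "\<dots> \<le> - (c1 / 2) * (real n / 4)" using 3 c1 by (intro mult_left_mono_neg) auto
      finally show ?thesis by simp
    qed
    finally show "measure_pmf.prob (random_subset (all_pairs {1..n}) p)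
         {S. real (rainbow_free_colourings H l ({1..n}, S)) > \<rho> ^ card S} \<le> exp (- (c1 / 8) * real n)"
      by (simp add: P_def rainbow_free_colourings_def)
  qed (use A1 c1 in auto)
qed

section \<open>Copies of a densest subgraph\<close>

text \<open>Counts embeddings rather than subgraphs; the overcount by automorphisms is harmless
  because only upper bounds are wanted.\<close>

definition copies_within :: "'a graph \<Rightarrow> nat \<Rightarrow> nat set set \<Rightarrow> nat" where
  "copies_within F n S = card {\<phi> \<in> embeddings (verts F) n. (\<lambda>e. \<phi> ` e) ` edges F \<subseteq> S}"

text \<open>Giving colour 1 to two edges of every copy of \<open>F\<close> destroys all rainbow copies of \<open>H\<close>.\<close>

lemma rainbow_free_colourings_ge:
  fixes H F :: "'a graph"
  assumes H: "simple_graph H" and F: "subgraph F H" "ecount F \<ge> 2"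
    and l: "l \<ge> 1" and S: "S \<subseteq> all_pairs {1..n}"
  shows "l ^ (card S - 2 * copies_within F n S) \<le> rainbow_free_colourings H l ({1..n}, S)"
proof -
  have sF: "simple_graph F" "edges F \<subseteq> edges H" "verts F \<subseteq> verts H" using F by (auto simp: subgraph_def)
  have finS: "finite S" using S finite_subset by fastforce
  obtain e1 e2 where e: "e1 \<in> edges F" "e2 \<in> edges F" "e1 \<noteq> e2"
    using F(2) unfolding ecount_def by (metis card_2_iff' One_nat_def card_le_Suc0_iff_eq
        finite_graph(2)[OF sF(1)] not_less_eq_eq numeral_2_eq_2)
  define M where "M = {\<phi> \<in> embeddings (verts F) n. (\<lambda>e. \<phi> ` e) ` edges F \<subseteq> S}"
  have finM: "finite M" using finite_graph(1)[OF sF(1)] by (simp add: M_def)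
  define Z where "Z = (\<Union>\<phi>\<in>M. {\<phi> ` e1, \<phi> ` e2})"
  have Z: "Z \<subseteq> S" using e by (auto simp: Z_def M_def)
  have "card Z \<le> (\<Sum>\<phi>\<in>M. card {\<phi> ` e1, \<phi> ` e2})" unfolding Z_def by (rule card_UN_le[OF finM])
  also have "\<dots> \<le> (\<Sum>\<phi>\<in>M. 2)" by (intro sum_mono) (simp add: card_insert_if)
  finally have cZ: "card Z \<le> 2 * copies_within F n S" by (simp add: M_def copies_within_def)
  define Q where "Q = PiE S (\<lambda>e. if e \<in> Z then {1} else {1..l})"
  have "card Q = (\<Prod>e\<in>S. if e \<in> Z then 1 else l)"
    unfolding Q_def using finS by (subst card_PiE) (auto intro!: prod.cong)
  also have "\<dots> = l ^ card (S - Z)" using finS by (simp add: prod.If_cases Diff_eq[symmetric])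
  finally have cQ: "card Q = l ^ card (S - Z)" .
  have "\<not> has_rainbow_copy H ({1..n}, S) \<kappa>" if \<kappa>: "\<kappa> \<in> Q" for \<kappa>
  proof
    assume "has_rainbow_copy H ({1..n}, S) \<kappa>"
    then obtain G where G: "copy_of H ({1..n}, S) G" "inj_on \<kappa> (edges G)"
      by (auto simp: has_rainbow_copy_def)
    then obtain \<psi> where \<psi>: "bij_betw \<psi> (verts H) (verts G)" "edges G = (\<lambda>e. \<psi> ` e) ` edges H"
      by (auto simp: copy_of_def graph_iso_def)
    have GS: "verts G \<subseteq> {1..n}" "edges G \<subseteq> S" using G(1) by (auto simp: copy_of_def subgraph_def)
    have inj: "inj_on \<psi> (verts H)" using \<psi>(1) by (simp add: bij_betw_def)
    \<comment> \<open>Restricting to \<open>F\<close> gives an element of \<open>M\<close>; the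
      images of \<open>e1\<close> and \<open>e2\<close> therefore lie in \<open>Z\<close> and share
      colour 1, while being distinct edges of the supposedly rainbow copy.\<close>
    define \<phi> where "\<phi> = restrict \<psi> (verts F)"
    have im: "\<phi> ` f = \<psi> ` f" if "f \<in> edges F" for f
      using that sF(1) by (auto simp: \<phi>_def simple_graph_def all_pairs_def)
    have "inj_on \<phi> (verts F)" using inj_on_subset[OF inj sF(3)] by (auto simp: \<phi>_def inj_on_def)
    moreover have "\<psi> x \<in> {1..n}" if "x \<in> verts F" for x
    proof -
      have "\<psi> x \<in> verts G" using \<psi>(1) sF(3) that by (auto simp: bij_betw_def)
      then show ?thesis using GS(1) by blast
    qed
    ultimately have "\<phi> \<in> embeddings (verts F) n" by (auto simp: embeddings_def \<phi>_def)
    moreover have "(\<lambda>e. \<phi> ` e) ` edges F \<subseteq> S" using im \<psi>(2) GS(2) sF(2) by fastforce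
    ultimately have "\<phi> \<in> M" by (simp add: M_def)
    then have "\<phi> ` e1 \<in> Z" "\<phi> ` e2 \<in> Z" by (auto simp: Z_def)
    moreover have "\<kappa> f = 1" if "f \<in> Z" for f
    proof -
      have "\<kappa> f \<in> (if f \<in> Z then {1} else {1..l})" using \<kappa> that Z unfolding Q_def by blast
      then show ?thesis using that by simp
    qed
    ultimately have "\<kappa> (\<psi> ` e1) = \<kappa> (\<psi> ` e2)" using im e by simp
    moreover have "\<psi> ` e1 \<in> edges G" "\<psi> ` e2 \<in> edges G" using \<psi>(2) e sF(2) by auto
    ultimately have "\<psi> ` e1 = \<psi> ` e2" using G(2) by (auto simp: inj_on_def)
    then show False using inj_on_image_edges[OF H inj] e sF(2) by (auto simp: inj_on_def)
  qed
  moreover have "Q \<subseteq> S \<rightarrow>\<^sub>E {1..l}" unfolding Q_def using l by (intro PiE_mono) auto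
  ultimately have "Q \<subseteq> {\<kappa> \<in> S \<rightarrow>\<^sub>E {1..l}. \<not> has_rainbow_copy H ({1..n}, S) \<kappa>}" by blast
  moreover have "finite {\<kappa> \<in> S \<rightarrow>\<^sub>E {1..l}. \<not> has_rainbow_copy H ({1..n}, S) \<kappa>}"
    by (rule finite_subset[of _ "S \<rightarrow>\<^sub>E {1..l}"]) (use finS in \<open>auto intro: finite_PiE\<close>)
  ultimately have "card Q \<le> rainbow_free_colourings H l ({1..n}, S)"
    by (simp add: rainbow_free_colourings_def card_mono)
  moreover have "l ^ (card S - 2 * copies_within F n S) \<le> l ^ card (S - Z)"
  proof (rule power_increasing)
    have "card (S - Z) = card S - card Z" using Z finS by (simp add: card_Diff_subset finite_subset)
    then show "card S - 2 * copies_within F n S \<le> card (S - Z)" using cZ by simp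
  qed (use l in simp)
  ultimately show ?thesis using cQ by simp
qed

lemma card_embeddings_le: "finite V \<Longrightarrow> card (embeddings V n) \<le> n ^ card V"
  using card_mono[of "V \<rightarrow>\<^sub>E {1..n}" "embeddings V n"]
  by (auto simp: card_PiE embeddings_def intro: finite_PiE)

lemma copies_within_eq_sum:
  assumes "simple_graph F"
  shows "real (copies_within F n S) =
    (\<Sum>\<phi>\<in>embeddings (verts F) n. if (\<lambda>e. \<phi> ` e) ` edges F \<subseteq> S then 1 else 0)"
  using finite_graph(1)[OF assms]
  by (simp add: copies_within_def sum.If_cases Int_def)

lemma card_embedded_edges:
  assumes "simple_graph F" "\<phi> \<in> embeddings (verts F) n"
  shows "(\<lambda>e. \<phi> ` e) ` edges F \<subseteq> all_pairs {1..n}" "card ((\<lambda>e. \<phi> ` e) ` edges F) = ecount F"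
proof -
  show "(\<lambda>e. \<phi> ` e) ` edges F \<subseteq> all_pairs {1..n}" using embedding_image_pair[OF assms] by blast
  have "inj_on (\<lambda>e. \<phi> ` e) (edges F)"
    using assms(2) by (intro inj_on_image_edges[OF assms(1)]) (simp add: embeddings_def)
  then show "card ((\<lambda>e. \<phi> ` e) ` edges F) = ecount F" by (simp add: ecount_def card_image)
qed

lemma expectation_if_superset:
  assumes "finite A" "0 \<le> p" "p \<le> 1" "D \<subseteq> A"
  shows "measure_pmf.expectation (random_subset A p) (\<lambda>S. if D \<subseteq> S then 1 else 0) = p ^ card D"
proof -
  have "(\<lambda>S. if D \<subseteq> S then 1 else 0 :: real) = (\<lambda>S. if D \<subseteq> S then \<Prod>e\<in>S. 1 else 0)"
    by (intro ext) simp
  then show ?thesis using expectation_superset_prod[OF assms(1-3), of "\<lambda>_. 1" D] assms(4) by simp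
qed

section \<open>Second moment of the number of copies of a densest subgraph\<close>

context
  fixes H F :: "'a graph" and n :: nat and p :: real
  assumes H: "simple_graph H" "non_matching H"
    and F: "subgraph F H" "vcount F \<ge> 3" "ecount F \<ge> 2"
    and dens: "real (ecount F) - 1 = max_2_density H * (real (vcount F) - 2)"
    and n: "n \<ge> 2" and p: "0 \<le> p" "p \<le> 1"
begin

lemma simple_F: "simple_graph F" using F by (simp add: subgraph_def)

text \<open>Because \<open>F\<close> attains the maximum density, the estimate of
  \<open>threshold_power_le\<close> becomes an equality: at the threshold \<tau>, the expected
  numbers of copies of \<open>F\<close> and of edges have the same order n^2 \<tau>.\<close>

lemma threshold_power_eq:
  "real n ^ (vcount F - 2) * (real n powr (- 1 / max_2_density H)) ^ (ecount F - 1) = 1"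
proof -
  have "max_2_density H \<ge> 1" by (rule max_2_density_ge_1[OF H])
  then have "real (vcount F - 2) + (- 1 / max_2_density H) * real (ecount F - 1) = 0"
    using F dens by (simp add: of_nat_diff)
  moreover have "real n ^ (vcount F - 2) * (real n powr (- 1 / max_2_density H)) ^ (ecount F - 1) =
    real n powr (real (vcount F - 2) + (- 1 / max_2_density H) * real (ecount F - 1))"
    using n unfolding powr_add by (simp add: powr_realpow[symmetric] powr_powr)
  ultimately show ?thesis using n by simp
qed

lemma expectation_copies_within:
  "measure_pmf.expectation (random_subset (all_pairs {1..n}) p) (\<lambda>S. real (copies_within F n S)) =
    real (card (embeddings (verts F) n)) * p ^ ecount F"
  unfolding copies_within_eq_sum[OF simple_F]
  using card_embedded_edges[OF simple_F] p
  by (subst Bochner_Integration.integral_sum) (auto simp: expectation_if_superset)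

text \<open>Copies without a common edge are independent. A pair sharing the edges \<open>J\<close>
  contributes at most \<open>p ^ (2 * e - card J)\<close>, and
  \<open>card_embeddings_containing_le\<close> bounds the number of such pairs. The target
  \<open>n^3 * p^2\<close> is smaller than the square of \<open>n^2 * p\<close> by a factor
  \<open>n\<close>, which is the gain in Chebyshev's inequality.\<close>

lemma variance_copies_within:
  assumes p\<tau>: "p \<le> real n powr (- 1 / max_2_density H)"
  shows "measure_pmf.expectation (random_subset (all_pairs {1..n}) p)
      (\<lambda>S. (real (copies_within F n S) - real (card (embeddings (verts F) n)) * p ^ ecount F) ^ 2) \<le>
    2 ^ ecount F * (2 * real (ecount F)) ^ vcount F * (real n ^ 3 * p ^ 2)"
proof -
  define \<tau> where "\<tau> = real n powr (- 1 / max_2_density H)"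
  define M where "M = embeddings (verts F) n"
  define D where "D \<phi> = (\<lambda>e. \<phi> ` e) ` edges F" for \<phi> :: "'a \<Rightarrow> nat"
  define e where "e = ecount F"
  define K where "K = (2 * real e) ^ vcount F"
  let ?P = "all_pairs {1..n}"
  let ?E = "measure_pmf.expectation (random_subset ?P p)"
  note fin = finite_graph[OF simple_F]
  have finM: "finite M" using fin by (simp add: M_def)
  have D: "D \<phi> \<subseteq> ?P" "card (D \<phi>) = e" "finite (D \<phi>)" if "\<phi> \<in> M" for \<phi>
    using card_embedded_edges[OF simple_F, of \<phi> n] that fin by (auto simp: D_def M_def e_def)
  have e2: "e \<ge> 2" using F by (simp add: e_def)
  have \<tau>: "0 < \<tau>" "p \<le> \<tau>" using n p\<tau> by (auto simp: \<tau>_def)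
  have sq: "(real (copies_within F n S) - real (card M) * p ^ e) ^ 2 =
     (\<Sum>\<phi>\<in>M. \<Sum>\<psi>\<in>M. ((if D \<phi> \<subseteq> S then 1 else 0) - p ^ e) * ((if D \<psi> \<subseteq> S then 1 else 0) - p ^ e))" for S
  proof -
    have "real (copies_within F n S) - real (card M) * p ^ e = (\<Sum>\<phi>\<in>M. (if D \<phi> \<subseteq> S then 1 else 0) - p ^ e)"
      unfolding copies_within_eq_sum[OF simple_F] by (simp add: sum_subtractf M_def D_def)
    then show ?thesis by (simp add: power2_eq_square sum_product)
  qed
  have cov: "?E (\<lambda>S. ((if D \<phi> \<subseteq> S then 1 else 0) - p ^ e) * ((if D \<psi> \<subseteq> S then 1 else 0) - p ^ e)) =
      p ^ card (D \<phi> \<union> D \<psi>) - p ^ e * p ^ e" if "\<phi> \<in> M" "\<psi> \<in> M" for \<phi> \<psi>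
  proof -
    have "((if D \<phi> \<subseteq> S then 1 else 0) - p ^ e) * ((if D \<psi> \<subseteq> S then 1 else 0) - p ^ e) =
      (if D \<phi> \<union> D \<psi> \<subseteq> S then 1 else 0) - p ^ e * (if D \<phi> \<subseteq> S then 1 else 0)
       - p ^ e * (if D \<psi> \<subseteq> S then 1 else 0) + p ^ e * p ^ e" for S
      by (auto simp: algebra_simps)
    moreover have "?E (\<lambda>S. if D \<phi> \<union> D \<psi> \<subseteq> S then 1 else 0) = p ^ card (D \<phi> \<union> D \<psi>)"
      using p D(1)[OF that(1)] D(1)[OF that(2)] by (intro expectation_if_superset) auto
    ultimately show ?thesis using p D[OF that(1)] D[OF that(2)]
      by (simp add: expectation_if_superset del: Un_subset_iff)
  qed
  have inner: "(\<Sum>\<psi>\<in>M. p ^ card (D \<phi> \<union> D \<psi>) - p ^ e * p ^ e) \<le>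
      2 ^ e * (K * (p ^ 2 * \<tau> ^ (e - 2)))" if \<phi>: "\<phi> \<in> M" for \<phi>
  proof -
    \<comment> \<open>\<open>J\<close> stands for the set of edges of \<open>F\<close> that the
      second copy places on the first; the empty set is left out because its covariance
      vanishes.\<close>
    define \<J> where "\<J> = Pow (edges F) - {{}}"
    define t where "t J = p ^ (2 * e - card J)" for J :: "'a set set"
    have fin\<J>: "finite \<J>" using fin by (simp add: \<J>_def)
    have t0: "t J \<ge> 0" for J using p by (simp add: t_def)
    let ?B = "\<lambda>J. {\<psi> \<in> verts F \<rightarrow>\<^sub>E {1..n}. \<psi> ` (\<Union>J) \<subseteq> \<Union>(D \<phi>)}"
    have le: "p ^ card (D \<phi> \<union> D \<psi>) - p ^ e * p ^ e \<le> (\<Sum>J\<in>\<J>. if \<psi> \<in> ?B J then t J else 0)"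
      if \<psi>: "\<psi> \<in> M" for \<psi>
    proof -
      define J where "J = {f \<in> edges F. \<psi> ` f \<in> D \<phi>}"
      have "inj_on (\<lambda>e. \<psi> ` e) (edges F)"
        using inj_on_image_edges[OF simple_F] \<psi> by (auto simp: M_def embeddings_def)
      then have "inj_on (\<lambda>e. \<psi> ` e) J" by (rule inj_on_subset) (auto simp: J_def)
      moreover have "(\<lambda>e. \<psi> ` e) ` J = D \<phi> \<inter> D \<psi>"
        unfolding J_def D_def[of \<psi>] by blast
      ultimately have cJ: "card J = card (D \<phi> \<inter> D \<psi>)" by (metis card_image)
      have "card (D \<phi> \<union> D \<psi>) = 2 * e - card J"
        using card_Un_Int[OF D(3)[OF \<phi>] D(3)[OF \<psi>]] D(2)[OF \<phi>] D(2)[OF \<psi>] cJ by simp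
      then have eq: "p ^ card (D \<phi> \<union> D \<psi>) = t J" by (simp add: t_def)
      show ?thesis
      proof (cases "J = {}")
        case True
        then have "t J = p ^ e * p ^ e" by (simp add: t_def power_add[symmetric] mult_2)
        then show ?thesis using eq t0 by (auto intro!: sum_nonneg)
      next
        case False
        then have J: "J \<in> \<J>" by (auto simp: \<J>_def J_def)
        have "\<psi> ` (\<Union>J) \<subseteq> \<Union>(D \<phi>)" by (auto simp: J_def)
        then have "\<psi> \<in> ?B J" using \<psi> by (simp add: M_def embeddings_def)
        then have "t J \<le> (\<Sum>J\<in>\<J>. if \<psi> \<in> ?B J then t J else 0)"
          using member_le_sum[OF J, of "\<lambda>J. if \<psi> \<in> ?B J then t J else 0"] t0 fin\<J> by simp
        moreover have "p ^ e * p ^ e \<ge> 0" using p by simp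
        ultimately show ?thesis using eq by linarith
      qed
    qed
    have "(\<Sum>\<psi>\<in>M. p ^ card (D \<phi> \<union> D \<psi>) - p ^ e * p ^ e) \<le>
       (\<Sum>\<psi>\<in>M. \<Sum>J\<in>\<J>. if \<psi> \<in> ?B J then t J else 0)"
      by (rule sum_mono[OF le])
    also have "\<dots> = (\<Sum>J\<in>\<J>. \<Sum>\<psi>\<in>M. if \<psi> \<in> ?B J then t J else 0)" by (rule sum.swap)
    also have "\<dots> \<le> (\<Sum>J\<in>\<J>. K * (p ^ 2 * \<tau> ^ (e - 2)))"
    proof (rule sum_mono)
      fix J assume "J \<in> \<J>"
      then have J: "J \<subseteq> edges F" "J \<noteq> {}" by (auto simp: \<J>_def)
      have cJ: "1 \<le> card J" "card J \<le> e"
        using J fin by (auto simp: Suc_le_eq card_gt_0_iff finite_subset e_def ecount_def card_mono)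
      have finB: "finite (?B J)" using fin by (intro finite_subset[of "?B J" "verts F \<rightarrow>\<^sub>E {1..n}"]) (auto intro: finite_PiE)
      have "real (card (?B J)) \<le> K * (real n ^ (vcount F - 2) * \<tau> ^ (card J - 1))"
        unfolding K_def \<tau>_def e_def using D[OF \<phi>] J n
        by (intro card_embeddings_containing_le[OF H F(1)]) (auto simp: e_def all_pairs_def)
      then have "real (card (?B J)) * t J \<le> K * (real n ^ (vcount F - 2) * \<tau> ^ (card J - 1)) * t J"
        using t0 by (rule mult_right_mono)
      \<comment> \<open>Two factors \<open>p\<close> are kept and all others are replaced by the
        larger \<open>\<tau>\<close>; then \<open>threshold_power_eq\<close> cancels the power of
        \<open>n\<close>, with a result that does not depend on \<open>J\<close>.\<close>
      moreover have "t J \<le> p ^ 2 * \<tau> ^ (2 * e - 2 - card J)"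
      proof -
        have "2 * e - card J = 2 + (2 * e - 2 - card J)" using cJ e2 by simp
        then have "t J = p ^ 2 * p ^ (2 * e - 2 - card J)" unfolding t_def by (metis power_add)
        also have "\<dots> \<le> p ^ 2 * \<tau> ^ (2 * e - 2 - card J)"
          using p \<tau> by (intro mult_left_mono power_mono) auto
        finally show ?thesis .
      qed
      then have "K * (real n ^ (vcount F - 2) * \<tau> ^ (card J - 1)) * t J \<le>
         K * (real n ^ (vcount F - 2) * \<tau> ^ (card J - 1)) * (p ^ 2 * \<tau> ^ (2 * e - 2 - card J))"
        using \<tau> by (intro mult_left_mono) (auto simp: K_def)
      moreover have "K * (real n ^ (vcount F - 2) * \<tau> ^ (card J - 1)) * (p ^ 2 * \<tau> ^ (2 * e - 2 - card J)) =
         K * (p ^ 2 * \<tau> ^ (e - 2))"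
      proof -
        have "(card J - 1) + (2 * e - 2 - card J) = (e - 1) + (e - 2)" using cJ e2 by simp
        then have "\<tau> ^ (card J - 1) * \<tau> ^ (2 * e - 2 - card J) = \<tau> ^ (e - 1) * \<tau> ^ (e - 2)"
          by (metis power_add)
        then have "real n ^ (vcount F - 2) * \<tau> ^ (card J - 1) * \<tau> ^ (2 * e - 2 - card J) = \<tau> ^ (e - 2)"
          using threshold_power_eq by (simp add: \<tau>_def e_def mult.assoc)
        then show ?thesis by (metis (no_types, opaque_lifting) mult.assoc mult.left_commute)
      qed
      moreover have "(\<Sum>\<psi>\<in>M. if \<psi> \<in> ?B J then t J else 0) \<le> real (card (?B J)) * t J"
      proof -
        have "(\<Sum>\<psi>\<in>M. if \<psi> \<in> ?B J then t J else 0) = real (card (M \<inter> ?B J)) * t J"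
          using finM by (simp add: sum.If_cases Int_def)
        also have "\<dots> \<le> real (card (?B J)) * t J"
          using finB t0 card_mono[OF finB, of "M \<inter> ?B J"] by (intro mult_right_mono) auto
        finally show ?thesis .
      qed
      ultimately show "(\<Sum>\<psi>\<in>M. if \<psi> \<in> ?B J then t J else 0) \<le> K * (p ^ 2 * \<tau> ^ (e - 2))" by linarith
    qed
    also have "\<dots> = real (card \<J>) * (K * (p ^ 2 * \<tau> ^ (e - 2)))" by simp
    also have "\<dots> \<le> 2 ^ e * (K * (p ^ 2 * \<tau> ^ (e - 2)))"
    proof (rule mult_right_mono)
      have "card \<J> \<le> card (Pow (edges F))" unfolding \<J>_def using fin by (intro card_mono) auto
      also have "\<dots> = 2 ^ e" using fin by (simp add: card_Pow e_def ecount_def)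
      finally have "real (card \<J>) \<le> real (2 ^ e)" by (simp only: of_nat_le_iff)
      then show "real (card \<J>) \<le> 2 ^ e" by simp
    qed (use \<tau> in \<open>simp add: K_def\<close>)
    finally show ?thesis .
  qed
  have "?E (\<lambda>S. (real (copies_within F n S) - real (card M) * p ^ e) ^ 2) =
     (\<Sum>\<phi>\<in>M. \<Sum>\<psi>\<in>M. p ^ card (D \<phi> \<union> D \<psi>) - p ^ e * p ^ e)"
    unfolding sq using cov by (simp add: Bochner_Integration.integral_sum)
  also have "\<dots> \<le> (\<Sum>\<phi>\<in>M. 2 ^ e * (K * (p ^ 2 * \<tau> ^ (e - 2))))"
    by (rule sum_mono[OF inner])
  also have "\<dots> = real (card M) * (2 ^ e * (K * (p ^ 2 * \<tau> ^ (e - 2))))" by simp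
  also have "\<dots> \<le> real n ^ vcount F * (2 ^ e * (K * (p ^ 2 * \<tau> ^ (e - 2))))"
  proof (rule mult_right_mono)
    have "card M \<le> n ^ vcount F" using card_embeddings_le[OF fin(1)] by (simp add: M_def vcount_def)
    then show "real (card M) \<le> real n ^ vcount F" by (metis of_nat_le_iff of_nat_power)
  qed (use \<tau> in \<open>simp add: K_def\<close>)
  also have "\<dots> = 2 ^ e * K * p ^ 2 * (real n ^ vcount F * \<tau> ^ (e - 2))" by (simp add: mult_ac)
  also have "\<dots> \<le> 2 ^ e * K * p ^ 2 * real n ^ 3"
  proof (rule mult_left_mono)
    \<comment> \<open>One factor \<open>n * \<tau> \<ge> 1\<close> is spent to turn
      \<open>\<tau> ^ (e - 2)\<close> into \<open>\<tau> ^ (e - 1)\<close>, where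
      \<open>threshold_power_eq\<close> applies again.\<close>
    have "real n powr (- 1) \<le> \<tau>"
      unfolding \<tau>_def using n max_2_density_ge_1[OF H] by (intro powr_mono) (auto simp: field_simps)
    then have n\<tau>: "1 \<le> real n * \<tau>" using n by (simp add: powr_minus_divide field_simps)
    have "vcount F = 2 + (vcount F - 2)" using F by simp
    then have "real n ^ vcount F * \<tau> ^ (e - 2) = real n ^ 2 * (real n ^ (vcount F - 2) * \<tau> ^ (e - 2))"
      by (metis mult.assoc power_add)
    also have "\<dots> \<le> real n ^ 2 * (real n ^ (vcount F - 2) * \<tau> ^ (e - 2)) * (real n * \<tau>)"
      using n\<tau> \<tau> mult_left_mono[OF n\<tau>, of "real n ^ 2 * (real n ^ (vcount F - 2) * \<tau> ^ (e - 2))"] by simp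
    also have "\<dots> = real n ^ 3 * (real n ^ (vcount F - 2) * (\<tau> ^ (e - 2) * \<tau>))"
      by (simp add: power2_eq_square power3_eq_cube mult_ac)
    also have "\<tau> ^ (e - 2) * \<tau> = \<tau> ^ (e - 1)"
    proof -
      have "e - 1 = Suc (e - 2)" using e2 by simp
      then show ?thesis by (simp add: mult.commute)
    qed
    also have "real n ^ 3 * (real n ^ (vcount F - 2) * \<tau> ^ (e - 1)) = real n ^ 3"
      using threshold_power_eq by (simp add: \<tau>_def e_def)
    finally show "real n ^ vcount F * \<tau> ^ (e - 2) \<le> real n ^ 3" .
  qed (simp add: K_def)
  finally show ?thesis by (simp add: M_def e_def K_def mult_ac)
qed

end

section \<open>The counting theorem\<close>

lemma rainbow_free_colourings_ge_powr:
  fixes H F :: "'a graph"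
  assumes H: "simple_graph H" and F: "subgraph F H" "ecount F \<ge> 2"
    and l: "l \<ge> 1" and S: "S \<subseteq> all_pairs {1..n}"
    and few: "2 * real (copies_within F n S) \<le> \<delta> * real (card S)"
  shows "real l powr ((1 - \<delta>) * real (card S)) \<le> real (rainbow_free_colourings H l ({1..n}, S))"
proof -
  have "(1 - \<delta>) * real (card S) \<le> real (card S - 2 * copies_within F n S)"
    using few by (simp add: algebra_simps)
  then have "real l powr ((1 - \<delta>) * real (card S)) \<le> real l powr real (card S - 2 * copies_within F n S)"
    using l by (intro powr_mono) auto
  also have "\<dots> = real (l ^ (card S - 2 * copies_within F n S))" using l by (simp add: powr_realpow)
  also have "\<dots> \<le> real (rainbow_free_colourings H l ({1..n}, S))"
    unfolding of_nat_le_iff by (rule rainbow_free_colourings_ge[OF H F l S])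
  finally show ?thesis .
qed

text \<open>If \<open>n^2 * p\<close> is at least \<open>n powr (1 / 4)\<close>, then
  \<open>card S\<close> is at least half its mean by \<open>prob_few_elements\<close>, and
  Chebyshev's inequality controls the copies. Below that, \<open>card S\<close> need not be
  concentrated, but the expected number of copies is at most \<open>n powr (- 1 / 2)\<close>, so
  usually none exists. Any exponent strictly between 0 and 1/2 could separate the two cases.\<close>

lemma many_copies_unlikely:
  fixes H F :: "'a graph" and \<delta> :: real
  assumes H: "simple_graph H" "non_matching H"
    and F: "subgraph F H" "vcount F \<ge> 3" "ecount F \<ge> 2"
    and dens: "real (ecount F) - 1 = max_2_density H * (real (vcount F) - 2)"
    and \<delta>: "\<delta> > 0"
  shows "\<exists>a>0. \<exists>K. \<exists>c>0. \<forall>n\<ge>2. \<forall>p. 0 \<le> p \<longrightarrow> p \<le> 1 \<longrightarrow>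
       p \<le> a * real n powr (- 1 / max_2_density H) \<longrightarrow>
       measure_pmf.prob (random_subset (all_pairs {1..n}) p)
         {S. 2 * real (copies_within F n S) > \<delta> * real (card S)} \<le>
       K / real n + exp (- c * real n powr (1 / 4)) + real n powr (- 1 / 2)"
proof -
  \<comment> \<open>In the first case the copies number less than \<open>2 * a * n^2 * p\<close>
    while \<open>card S \<ge> n^2 * p / 8\<close>, so \<open>a \<le> \<delta> / 32\<close> suffices.
    \<open>a \<le> 1\<close> gives \<open>p \<le> \<tau>\<close> and
    \<open>a ^ (ecount F - 1) \<le> a\<close>.\<close>
  define a where "a = min 1 (\<delta> / 32)"
  have a: "0 < a" "a \<le> 1" "a \<le> \<delta> / 32" using \<delta> by (auto simp: a_def)
  define K where "K = 2 ^ ecount F * (2 * real (ecount F)) ^ vcount F"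
  have K: "K \<ge> 0" by (simp add: K_def)
  define c where "c = (1 - ln (2 :: real)) / 8"
  have c: "c > 0" using ln2_le_25_over_36 by (simp add: c_def)
  show ?thesis
  proof (rule exI[of _ a], rule conjI[rotated], rule exI[of _ "K / a ^ 2"], rule exI[of _ c],
      rule conjI[rotated], intro allI impI)
    fix n :: nat and p :: real
    assume n: "n \<ge> 2" and p: "0 \<le> p" "p \<le> 1" and pa: "p \<le> a * real n powr (- 1 / max_2_density H)"
    define \<tau> where "\<tau> = real n powr (- 1 / max_2_density H)"
    define X where "X S = real (copies_within F n S)" for S
    define \<mu> where "\<mu> = real (card (embeddings (verts F) n)) * p ^ ecount F"
    let ?P = "all_pairs {1..n}"
    let ?pr = "measure_pmf.prob (random_subset ?P p)"
    let ?E = "measure_pmf.expectation (random_subset ?P p)"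
    have finP: "finite ?P" by simp
    have N2: "real n ^ 2 / 4 \<le> real (card ?P)" using card_all_pairs_bounds[OF n] by simp
    have \<tau>: "\<tau> > 0" using n by (simp add: \<tau>_def)
    have "a * \<tau> \<le> 1 * \<tau>" using a \<tau> by (intro mult_right_mono) auto
    then have p\<tau>: "p \<le> \<tau>" using pa by (simp add: \<tau>_def)
    note ctx = H F dens n p
    have mean: "?E X = \<mu>"
      unfolding X_def \<mu>_def using expectation_copies_within[OF ctx] .
    have var: "?E (\<lambda>S. (X S - \<mu>) ^ 2) \<le> K * (real n ^ 3 * p ^ 2)"
      unfolding X_def \<mu>_def K_def using variance_copies_within[OF ctx] p\<tau> by (simp add: \<tau>_def)
    have "card (embeddings (verts F) n) \<le> n ^ vcount F"
      using card_embeddings_le[of "verts F"] F(1) by (simp add: subgraph_def simple_graph_def vcount_def)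
    then have "real (card (embeddings (verts F) n)) \<le> real n ^ vcount F"
      by (metis of_nat_le_iff of_nat_power)
    then have "\<mu> \<le> real n ^ vcount F * p ^ ecount F" unfolding \<mu>_def using p by (intro mult_right_mono) auto
    also have "\<dots> = real n ^ 2 * p * (real n ^ (vcount F - 2) * p ^ (ecount F - 1))"
    proof -
      have "vcount F = 2 + (vcount F - 2)" "ecount F = 1 + (ecount F - 1)" using F by auto
      then have "real n ^ vcount F = real n ^ 2 * real n ^ (vcount F - 2)"
        "p ^ ecount F = p * p ^ (ecount F - 1)"
        by (metis power_add, metis power_add power_one_right)
      then show ?thesis by simp
    qed
    finally have \<mu>: "\<mu> \<le> real n ^ 2 * p * (real n ^ (vcount F - 2) * p ^ (ecount F - 1))" .
    let ?bad = "{S. 2 * X S > \<delta> * real (card S)}"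
    show "?pr {S. 2 * real (copies_within F n S) > \<delta> * real (card S)} \<le>
       K / a ^ 2 / real n + exp (- c * real n powr (1 / 4)) + real n powr (- 1 / 2)"
    proof (cases "real n ^ 2 * p \<ge> real n powr (1 / 4)")
      case True
      have "real n powr (1 / 4) > 0" using n by simp
      then have "0 < real n ^ 2 * p" using True by linarith
      then have p0: "p > 0" using n by (simp add: zero_less_mult_iff)
      have "p ^ (ecount F - 1) \<le> (a * \<tau>) ^ (ecount F - 1)"
        using p pa by (intro power_mono) (auto simp: \<tau>_def)
      also have "\<dots> \<le> a * \<tau> ^ (ecount F - 1)"
      proof -
        have "a ^ (ecount F - 1) \<le> a ^ 1" using a F by (intro power_decreasing) auto
        then show ?thesis using \<tau> by (simp add: power_mult_distrib mult_right_mono)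
      qed
      finally have "real n ^ (vcount F - 2) * p ^ (ecount F - 1) \<le>
          real n ^ (vcount F - 2) * (a * \<tau> ^ (ecount F - 1))"
        by (intro mult_left_mono) auto
      also have "\<dots> = a" using threshold_power_eq[OF ctx] by (simp add: \<tau>_def mult.left_commute)
      finally have "real n ^ 2 * p * (real n ^ (vcount F - 2) * p ^ (ecount F - 1)) \<le> real n ^ 2 * p * a"
        using p by (intro mult_left_mono) auto
      with \<mu> have \<mu>a: "\<mu> \<le> a * (real n ^ 2 * p)" by (simp add: mult_ac)
      define s where "s = a * (real n ^ 2 * p)"
      have s: "s > 0" using a n p0 by (simp add: s_def)
      have "?pr {S. X S \<ge> \<mu> + s} \<le> ?E (\<lambda>S. (X S - \<mu>) ^ 2) / s ^ 2"
      proof (rule markov_random_subset[OF finP])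
        fix S assume "\<mu> + s \<le> X S"
        then have "s \<le> X S - \<mu>" by simp
        then show "s ^ 2 \<le> (X S - \<mu>) ^ 2" using s by (intro power_mono) auto
      qed (use s in auto)
      also have "\<dots> \<le> K * (real n ^ 3 * p ^ 2) / s ^ 2" using var by (intro divide_right_mono) auto
      also have "\<dots> = K / a ^ 2 / real n"
        using n a p0 by (simp add: s_def power2_eq_square power3_eq_cube field_simps)
      finally have b1: "?pr {S. X S \<ge> \<mu> + s} \<le> K / a ^ 2 / real n" .
      have "?pr {S. real (card S) < p * real (card ?P) / 2}
          \<le> exp (- (1 - ln 2) / 2 * (p * real (card ?P)))"
        by (rule prob_few_elements[OF finP p])
      also have "\<dots> \<le> exp (- c * real n powr (1 / 4))"
      proof -
        have "p * (real n ^ 2 / 4) \<le> p * real (card ?P)" using N2 p by (intro mult_left_mono) auto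
        then have "real n powr (1 / 4) / 4 \<le> p * real (card ?P)" using True by (simp add: mult.commute)
        then have "4 * c * (real n powr (1 / 4) / 4) \<le> 4 * c * (p * real (card ?P))"
          using c by (intro mult_left_mono) auto
        moreover have "- (1 - ln 2) / 2 * (p * real (card ?P)) = - (4 * c * (p * real (card ?P)))"
        proof -
          have "- (1 - ln (2 :: real)) / 2 = - (4 * c)" by (simp add: c_def field_simps)
          then show ?thesis by (simp only: mult_minus_left)
        qed
        ultimately have "- (1 - ln 2) / 2 * (p * real (card ?P)) \<le> - c * real n powr (1 / 4)"
          by linarith
        then show ?thesis by (simp only: exp_le_cancel_iff)
      qed
      finally have b2: "?pr {S. real (card S) < p * real (card ?P) / 2} \<le> exp (- c * real n powr (1 / 4))" .
      have sub: "?bad \<subseteq> {S. X S \<ge> \<mu> + s} \<union> {S. real (card S) < p * real (card ?P) / 2}"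
      proof (rule subsetI, rule ccontr)
        fix S assume "S \<in> ?bad"
          and "S \<notin> {S. X S \<ge> \<mu> + s} \<union> {S. real (card S) < p * real (card ?P) / 2}"
        then have S: "2 * X S > \<delta> * real (card S)" "X S < \<mu> + s"
          "real (card S) \<ge> p * real (card ?P) / 2" by simp_all
        have "2 * X S < 4 * (a * (real n ^ 2 * p))" using S(2) \<mu>a unfolding s_def by linarith
        also have "\<dots> \<le> 4 * (\<delta> / 32 * (real n ^ 2 * p))"
          using a p by (intro mult_left_mono mult_right_mono) auto
        also have "\<dots> = \<delta> * (p * (real n ^ 2 / 4) / 2)" by simp
        also have "\<dots> \<le> \<delta> * (p * real (card ?P) / 2)"
          using N2 p \<delta> by (intro mult_left_mono divide_right_mono) auto
        also have "\<dots> \<le> \<delta> * real (card S)" using S(3) \<delta> by (intro mult_left_mono) auto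
        finally show False using S(1) by simp
      qed
      have "?pr ?bad \<le> ?pr ({S. X S \<ge> \<mu> + s} \<union> {S. real (card S) < p * real (card ?P) / 2})"
        using sub by (intro measure_pmf.finite_measure_mono) auto
      also have "\<dots> \<le> ?pr {S. X S \<ge> \<mu> + s} + ?pr {S. real (card S) < p * real (card ?P) / 2}"
        by (rule measure_Un_le) auto
      finally show ?thesis using b1 b2 powr_ge_zero[of "real n" "- 1 / 2"] unfolding X_def by linarith
    next
      case False
      have "real n powr (1 / 4) \<le> real n powr 1" using n by (intro powr_mono) auto
      also have "real n powr 1 = real n" using n by simp
      finally have "real n ^ 2 * p \<le> real n" using False by linarith
      then have "real n * (real n * p) \<le> real n * 1" by (simp add: power2_eq_square mult.assoc)
      then have np: "real n * p \<le> 1" using n by (simp only: mult_le_cancel_left_pos of_nat_0_less_iff)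
      have "?pr ?bad \<le> ?pr {S. X S \<ge> 1}"
      proof (rule measure_pmf.finite_measure_mono)
        show "?bad \<subseteq> {S. X S \<ge> 1}"
        proof
          fix S assume "S \<in> ?bad"
          moreover have "0 \<le> \<delta> * real (card S)" using \<delta> by simp
          ultimately have "0 < X S" by simp
          then show "S \<in> {S. X S \<ge> 1}" by (simp add: X_def Suc_le_eq)
        qed
      qed simp
      also have "\<dots> \<le> ?E X / 1" by (rule markov_random_subset[OF finP]) (auto simp: X_def)
      also have "\<dots> = \<mu>" using mean by simp
      also have "\<mu> \<le> real n ^ 2 * p * (real n * p)"
      proof (rule order_trans[OF \<mu> mult_left_mono])
        \<comment> \<open>Density at least 1 means \<open>vcount F \<le> ecount F + 1\<close>; this
          lets the powers of \<open>n\<close> be absorbed into powers of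
          \<open>n * p \<le> 1\<close>, of which one factor is kept.\<close>
        have "1 * (real (vcount F) - 2) \<le> real (ecount F) - 1"
          unfolding dens using max_2_density_ge_1[OF H] F by (intro mult_right_mono) auto
        then have "real (vcount F) \<le> real (ecount F + 1)" by simp
        then have "vcount F \<le> ecount F + 1" by (simp only: of_nat_le_iff)
        then have "vcount F - 2 \<le> ecount F - 1" by simp
        then have "p ^ (ecount F - 1) \<le> p ^ (vcount F - 2)" using p by (intro power_decreasing) auto
        then have "real n ^ (vcount F - 2) * p ^ (ecount F - 1) \<le> real n ^ (vcount F - 2) * p ^ (vcount F - 2)"
          by (intro mult_left_mono) auto
        also have "\<dots> = (real n * p) ^ (vcount F - 2)" by (simp add: power_mult_distrib)
        also have "\<dots> \<le> (real n * p) ^ 1" using np p F by (intro power_decreasing) auto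
        finally show "real n ^ (vcount F - 2) * p ^ (ecount F - 1) \<le> real n * p" by simp
      qed (use p in auto)
      also have "\<dots> = (real n ^ 2 * p) ^ 2 / real n" using n by (simp add: power2_eq_square)
      also have "\<dots> \<le> (real n powr (1 / 4)) ^ 2 / real n"
        using False p by (intro divide_right_mono power_mono) auto
      also have "\<dots> = real n powr (- 1 / 2)"
      proof -
        have "(real n powr (1 / 4)) ^ 2 / real n = real n powr (1 / 4 + 1 / 4) / real n powr 1"
          using n unfolding powr_add by (simp add: power2_eq_square)
        also have "\<dots> = real n powr (- 1 / 2)" unfolding powr_diff[symmetric] by simp
        finally show ?thesis .
      qed
      finally show ?thesis using K a by (simp add: X_def add_increasing)
    qed
  qed (use a c in auto)
qed

section \<open>Bounds valid for every graph, and the passage to \<open>random_graph\<close>\<close>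

lemma rainbow_free_colourings_le:
  assumes "finite S"
  shows "rainbow_free_colourings H l (V, S) \<le> l ^ card S"
proof -
  have "rainbow_free_colourings H l (V, S) \<le> card (S \<rightarrow>\<^sub>E {1..l})"
    unfolding rainbow_free_colourings_def using assms by (intro card_mono finite_PiE) auto
  then show ?thesis using assms by (simp add: card_PiE)
qed

text \<open>Pigeonhole: with fewer colours than \<open>H\<close> has edges no copy can be rainbow,
  so every colouring by \<open>{1..k}\<close> counts.\<close>

lemma rainbow_free_colourings_ge_few_colours:
  assumes H: "simple_graph H" and k: "k < ecount H" "k \<le> l" and S: "finite S"
  shows "k ^ card S \<le> rainbow_free_colourings H l (V, S)"
proof -
  have "\<not> has_rainbow_copy H (V, S) \<kappa>" if \<kappa>: "\<kappa> \<in> S \<rightarrow>\<^sub>E {1..k}" for \<kappa>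
  proof
    assume "has_rainbow_copy H (V, S) \<kappa>"
    then obtain G where G: "copy_of H (V, S) G" "inj_on \<kappa> (edges G)"
      by (auto simp: has_rainbow_copy_def)
    then obtain \<psi> where \<psi>: "bij_betw \<psi> (verts H) (verts G)" "edges G = (\<lambda>e. \<psi> ` e) ` edges H"
      by (auto simp: copy_of_def graph_iso_def)
    have "edges G \<subseteq> S" using G(1) by (auto simp: copy_of_def subgraph_def)
    then have "\<kappa> ` edges G \<subseteq> {1..k}" using \<kappa> by blast
    then have "card (edges G) \<le> k" using card_inj_on_le[OF G(2), of "{1..k}"] by simp
    moreover have "card (edges G) = ecount H"
      unfolding \<psi>(2) ecount_def
      by (intro card_image inj_on_image_edges[OF H]) (use \<psi>(1) in \<open>simp add: bij_betw_def\<close>)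
    ultimately show False using k by simp
  qed
  moreover have "S \<rightarrow>\<^sub>E {1..k} \<subseteq> S \<rightarrow>\<^sub>E {1..l}" using k by (intro PiE_mono) auto
  moreover have "finite {\<kappa> \<in> S \<rightarrow>\<^sub>E {1..l}. \<not> has_rainbow_copy H (V, S) \<kappa>}"
    by (rule finite_subset[of _ "S \<rightarrow>\<^sub>E {1..l}"]) (use S in \<open>auto intro: finite_PiE\<close>)
  ultimately have "card (S \<rightarrow>\<^sub>E {1..k}) \<le> rainbow_free_colourings H l (V, S)"
    unfolding rainbow_free_colourings_def by (intro card_mono) auto
  then show ?thesis using S by (simp add: card_PiE)
qed

lemma prob_random_graph:
  "measure_pmf.prob (random_graph n p) {G. Q G} =
    measure_pmf.prob (random_subset (all_pairs {1..n}) p) {S. Q ({1..n}, S)}"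
proof -
  have "random_graph n p = map_pmf (\<lambda>S. ({1..n}, S)) (random_subset (all_pairs {1..n}) p)"
    by (simp add: random_graph_def random_subset_def map_pmf_comp)
  then show ?thesis by (simp add: vimage_def)
qed

lemma whpI:
  assumes bad: "\<forall>\<^sub>F n in sequentially.
      measure_pmf.prob (random_subset (all_pairs {1..n}) (p n)) (Bad n) \<le> \<beta> n"
    and \<beta>: "\<beta> \<longlonglongrightarrow> 0"
    and good: "\<And>n S. S \<subseteq> all_pairs {1..n} \<Longrightarrow> S \<notin> Bad n \<Longrightarrow> Q ({1..n}, S)"
  shows "whp p Q"
proof -
  have "1 - \<beta> n \<le> measure_pmf.prob (random_graph n (p n)) {G. Q G}"
    if n: "measure_pmf.prob (random_subset (all_pairs {1..n}) (p n)) (Bad n) \<le> \<beta> n" for n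
  proof -
    let ?R = "random_subset (all_pairs {1..n}) (p n)"
    have "1 - \<beta> n \<le> measure_pmf.prob ?R (- Bad n)"
      using n measure_pmf.prob_compl[of "Bad n" ?R] by (simp add: Compl_eq_Diff_UNIV)
    also have "\<dots> \<le> measure_pmf.prob ?R {S. Q ({1..n}, S)}"
      using good set_random_subset[of "all_pairs {1..n}" "p n"]
      by (intro measure_pmf.finite_measure_mono_AE AE_pmfI) auto
    finally show ?thesis unfolding prob_random_graph .
  qed
  then have lower: "\<forall>\<^sub>F n in sequentially. 1 - \<beta> n \<le> measure_pmf.prob (random_graph n (p n)) {G. Q G}"
    using bad by (rule eventually_mono[rotated])
  have upper: "\<forall>\<^sub>F n in sequentially. measure_pmf.prob (random_graph n (p n)) {G. Q G} \<le> 1" by simp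
  have "(\<lambda>n. 1 - \<beta> n) \<longlonglongrightarrow> 1" using tendsto_diff[OF tendsto_const \<beta>, of 1] by simp
  then show ?thesis unfolding whp_def by (rule tendsto_sandwich[OF lower upper _ tendsto_const])
qed

theorem corollary1p3:
  fixes H :: "'a graph" and l :: nat and \<delta> :: real
  assumes "simple_graph H" and "no_isolated_vertices H" and "non_matching H"
    and "ecount H \<ge> 3"
    and "ecount H \<le> l"
    and "real l \<le> (real (ecount H) - 1) powr (real (ecount H) / (real (ecount H) - 2))"
    and "\<delta> > 0"
  shows "\<exists>(a::real)>0. \<exists>(A::real)>0. \<forall>p :: nat \<Rightarrow> real. (\<forall>n. 0 \<le> p n \<and> p n \<le> 1) \<longrightarrow>
    ((\<forall>\<^sub>F n in sequentially. p n \<le> a * real n powr (- 1 / max_2_density H)) \<longrightarrow>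
       whp p (\<lambda>G.
         real l powr ((1 - \<delta>) * real (ecount G)) \<le> real (rainbow_free_colourings H l G) \<and>
         real (rainbow_free_colourings H l G) \<le> real l ^ ecount G)) \<and>
    ((\<forall>\<^sub>F n in sequentially. p n \<ge> A * real n powr (- 1 / max_2_density H)) \<longrightarrow>
       whp p (\<lambda>G.
         (real (ecount H) - 1) ^ ecount G \<le> real (rainbow_free_colourings H l G) \<and>
         real (rainbow_free_colourings H l G)
           \<le> (real (ecount H) - 1) powr ((1 + \<delta>) * real (ecount G))))"
proof -
  note H = assms(1,3)
  let ?d = "max_2_density H" and ?r = "ecount H"
  let ?R = "\<lambda>n p. measure_pmf.prob (random_subset (all_pairs {1..n}) p)"
  obtain F where F: "subgraph F H" "vcount F \<ge> 3" "ecount F \<ge> 2"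
    "real (ecount F) - 1 = ?d * (real (vcount F) - 2)"
    using densest_subgraph[OF H] .
  obtain a K c where a: "a > 0" and c: "c > 0"
    and sparse: "\<forall>n\<ge>2. \<forall>p. 0 \<le> p \<longrightarrow> p \<le> 1 \<longrightarrow> p \<le> a * real n powr (- 1 / ?d) \<longrightarrow>
       ?R n p {S. 2 * real (copies_within F n S) > \<delta> * real (card S)} \<le>
         K / real n + exp (- c * real n powr (1 / 4)) + real n powr (- 1 / 2)"
    using many_copies_unlikely[OF H F assms(7)] by (elim exE conjE)
  obtain A c' n0 where A: "A > 0" and c': "c' > 0"
    and dense: "\<forall>n\<ge>n0. \<forall>p. 0 \<le> p \<longrightarrow> p \<le> 1 \<longrightarrow> p \<ge> A * real n powr (- 1 / ?d) \<longrightarrow>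
       ?R n p {S. real (rainbow_free_colourings H l ({1..n}, S)) >
           ((real ?r - 1) powr (1 + \<delta>)) ^ card S} \<le> exp (- c' * real n)"
    using many_rainbow_free_colourings_unlikely[OF H assms(4-7)] by (elim exE conjE)
  have l1: "l \<ge> 1" using assms(4,5) by simp
  have finS: "finite S" if "S \<subseteq> all_pairs {1..n}" for S and n :: nat
    using that finite_subset by fastforce
  \<comment> \<open>The upper bound in (i) and the lower bound in (ii) hold for every graph, so each
    bad event concerns the other inequality only.\<close>
  show ?thesis
  proof (rule exI[of _ a], rule conjI[OF a], rule exI[of _ A], rule conjI[OF A], intro allI impI conjI)
    fix p :: "nat \<Rightarrow> real"
    assume p: "\<forall>n. 0 \<le> p n \<and> p n \<le> 1"
      and small: "\<forall>\<^sub>F n in sequentially. p n \<le> a * real n powr (- 1 / ?d)"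
    show "whp p (\<lambda>G. real l powr ((1 - \<delta>) * real (ecount G)) \<le> real (rainbow_free_colourings H l G) \<and>
         real (rainbow_free_colourings H l G) \<le> real l ^ ecount G)"
    proof (rule whpI)
      show "\<forall>\<^sub>F n in sequentially. ?R n (p n) {S. 2 * real (copies_within F n S) > \<delta> * real (card S)} \<le>
         K / real n + exp (- c * real n powr (1 / 4)) + real n powr (- 1 / 2)"
        using small eventually_ge_at_top[of 2] by eventually_elim (use sparse p in blast)
      show "(\<lambda>n. K / real n + exp (- c * real n powr (1 / 4)) + real n powr (- 1 / 2)) \<longlonglongrightarrow> 0"
        using c by real_asymp
      fix n :: nat and S assume S: "S \<subseteq> all_pairs {1..n}" "S \<notin> {S. 2 * real (copies_within F n S) > \<delta> * real (card S)}"
      have "real (rainbow_free_colourings H l ({1..n}, S)) \<le> real (l ^ card S)"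
        unfolding of_nat_le_iff by (rule rainbow_free_colourings_le[OF finS[OF S(1)]])
      moreover have "real l powr ((1 - \<delta>) * real (card S)) \<le> real (rainbow_free_colourings H l ({1..n}, S))"
        using S by (intro rainbow_free_colourings_ge_powr[OF H(1) F(1,3) l1]) auto
      ultimately show "real l powr ((1 - \<delta>) * real (ecount ({1..n}, S))) \<le> real (rainbow_free_colourings H l ({1..n}, S)) \<and>
         real (rainbow_free_colourings H l ({1..n}, S)) \<le> real l ^ ecount ({1..n}, S)"
        by (simp add: ecount_def)
    qed
  next
    fix p :: "nat \<Rightarrow> real"
    assume p: "\<forall>n. 0 \<le> p n \<and> p n \<le> 1"
      and large: "\<forall>\<^sub>F n in sequentially. p n \<ge> A * real n powr (- 1 / ?d)"
    show "whp p (\<lambda>G. (real ?r - 1) ^ ecount G \<le> real (rainbow_free_colourings H l G) \<and>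
         real (rainbow_free_colourings H l G) \<le> (real ?r - 1) powr ((1 + \<delta>) * real (ecount G)))"
    proof (rule whpI)
      show "\<forall>\<^sub>F n in sequentially. ?R n (p n) {S. real (rainbow_free_colourings H l ({1..n}, S)) >
           ((real ?r - 1) powr (1 + \<delta>)) ^ card S} \<le> exp (- c' * real n)"
        using large eventually_ge_at_top[of n0] by eventually_elim (use dense p in blast)
      show "(\<lambda>n. exp (- c' * real n)) \<longlonglongrightarrow> 0" using c' by real_asymp
      fix n :: nat and S assume S: "S \<subseteq> all_pairs {1..n}"
        "S \<notin> {S. real (rainbow_free_colourings H l ({1..n}, S)) > ((real ?r - 1) powr (1 + \<delta>)) ^ card S}"
      have r1: "real ?r - 1 = real (?r - 1)" "real ?r - 1 > 0" using assms(4) by auto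
      have "real ((?r - 1) ^ card S) \<le> real (rainbow_free_colourings H l ({1..n}, S))"
        unfolding of_nat_le_iff using assms(4,5)
        by (intro rainbow_free_colourings_ge_few_colours[OF H(1) _ _ finS[OF S(1)]]) auto
      then have lower: "(real ?r - 1) ^ card S \<le> real (rainbow_free_colourings H l ({1..n}, S))"
        unfolding r1(1) by (simp only: of_nat_power)
      have "((real ?r - 1) powr (1 + \<delta>)) ^ card S = (real ?r - 1) powr ((1 + \<delta>) * real (card S))"
        using r1(2) by (simp add: powr_realpow[symmetric] powr_powr)
      then have upper: "real (rainbow_free_colourings H l ({1..n}, S)) \<le>
          (real ?r - 1) powr ((1 + \<delta>) * real (card S))"
        using S(2) by (simp only: mem_Collect_eq not_less)
      show "(real ?r - 1) ^ ecount ({1..n}, S) \<le> real (rainbow_free_colourings H l ({1..n}, S)) \<and>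
         real (rainbow_free_colourings H l ({1..n}, S)) \<le> (real ?r - 1) powr ((1 + \<delta>) * real (ecount ({1..n}, S)))"
        unfolding ecount_def[of "({1..n}, S)"] snd_conv using lower upper by (rule conjI)
    qed
  qed
qed

end
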